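(* Let $d\in\mathbb{N}$, and let $(Q_n)_n$ be a sequence of distributions in $\mathcal{Q}^1$ such that $\lim_{n\to\infty}D_1(Q_n,Q)=0$ for some $Q\in\mathcal{Q}^1$. Then $$\lim_{n\to\infty}L(Q_n)=L(Q).$$ In case of $Q\in\mathcal{Q}_o\cap\mathcal{Q}^1$, the probability densities $f:=\exp\circ\,\psi(\cdot\,|\,Q)$ and $f_n:=\exp\circ\,\psi(\cdot\,|\,Q_n)$ are well defined for sufficiently large $n$ and satisfy $$\lim_{n\to\infty,\,x\to y}f_n(x)=f(y)\quad\text{for all }y\in\mathbb{R}^d\setminus\partial\{f>0\},$$ $$\limsup_{n\to\infty,\,x\to y}f_n(x)\le f(y)\quad\text{for all }y\in\partial\{f>0\},$$ $$\lim_{n\to\infty}\int|f_n(x)-f(x)|\,dx=0.$$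
   Context: $\mathcal{Q}^1=\mathcal{Q}^1(d)$ is the set of probability distributions $Q$ on $\mathbb{R}^d$ with $\int\|x\|\,Q(dx)<\infty$. $\mathcal{Q}_o=\mathcal{Q}_o(d)$ is the set of probability distributions $Q$ on $\mathbb{R}^d$ whose convex support $\operatorname{csupp}(Q):=\bigcap\{C:C\subseteq\mathbb{R}^d\text{ closed and convex},\ Q(C)=1\}$ has nonempty interior. Mallows (Wasserstein-1) distance for $Q,Q'\in\mathcal{Q}^1$: $D_1(Q,Q'):=\inf_{(X,X')}\mathbb{E}\|X-X'\|$, the infimum being over all pairs $(X,X')$ of random vectors on a common probability space with $X\sim Q$, $X'\sim Q'$. $\Phi=\Phi(d)$ is the family of concave functions $\phi:\mathbb{R}^d\to[-\infty,\infty)$ which are upper semicontinuous and coercive ($\phi(x)\to-\infty$ as $\|x\|\to\infty$). For a probability distribution $Q$ and $\phi\in\Phi$, $L(\phi,Q):=\int\phi\,dQ-\int e^{\phi(x)}\,dx+1$ and $L(Q):=\sup_{\phi\in\Phi}L(\phi,Q)\in[-\infty,\infty]$. For $Q\in\mathcal{Q}_o\cap\mathcal{Q}^1$, $\psi(\cdot\,|\,Q)$ denotes the unique maximizer of $L(\cdot,Q)$ over $\Phi$ (it exists, is unique, and $\int e^{\psi(x|Q)}\,dx=1$); "well defined" for $f_n$ means $Q_n\in\mathcal{Q}_o\cap\mathcal{Q}^1$. The notation $\lim_{n\to\infty,\,x\to y}$ and $\limsup_{n\to\infty,\,x\to y}$ denotes joint limits, i.e. along arbitrary sequences $x_n\to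 y$ as $n\to\infty$. $\partial A$ is the topological boundary of $A$, and $\{f>0\}=\{x\in\mathbb{R}^d:f(x)>0\}$. *)

theory Defs
  imports "HOL-Probability.Probability"
begin

definition prob_distribution :: "'a::euclidean_space measure \<Rightarrow> bool" where
  "prob_distribution Q \<longleftrightarrow> prob_space Q \<and> sets Q = sets borel"

definition Q1_class :: "'a::euclidean_space measure set" where
  "Q1_class = {Q. prob_distribution Q \<and> integrable Q norm}"

definition csupp :: "'a::euclidean_space measure \<Rightarrow> 'a set" where
  "csupp Q = \<Inter>{C. closed C \<and> convex C \<and> measure Q C = 1}"

definition Qo_class :: "'a::euclidean_space measure set" where
  "Qo_class = {Q. prob_distribution Q \<and> interior (csupp Q) \<noteq> {}}"

text \<open>
  Type variables cannot be quantified inside a definition, so the pairs of random vectors live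
  on probability spaces over the type \<open>'a \<times> 'a\<close>. This loses no pair: any pair on any
  probability space can be replaced by the coordinate maps on its joint law, without changing the
  marginal laws or the expected distance. The infimum is taken in \<^typ>\<open>ennreal\<close>, where it is
  defined whether or not the distributions have finite first moments.
\<close>

definition mallows_dist :: "'a::euclidean_space measure \<Rightarrow> 'a measure \<Rightarrow> ennreal" where
  "mallows_dist Q Q' =
    Inf {(\<integral>\<^sup>+ w. ennreal (norm (X w - X' w)) \<partial>M) | (M :: ('a \<times> 'a) measure) X X'.
      prob_space M \<and> X \<in> borel_measurable M \<and> X' \<in> borel_measurable M \<and>
      distr M borel X = Q \<and> distr M borel X' = Q'}"

text \<open>
  Functions into \<open>[-\<infinity>,\<infinity>)\<close> are functions into \<^typ>\<open>ereal\<close> that avoid \<open>\<infinity>\<close>. In the concavity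
  inequality \<open>t\<close> ranges over the open unit interval, so no product of \<open>0\<close> and \<open>-\<infinity>\<close> occurs.
\<close>

definition ereal_concave :: "('a::real_vector \<Rightarrow> ereal) \<Rightarrow> bool" where
  "ereal_concave \<phi> \<longleftrightarrow>
    (\<forall>x y. \<forall>t::real. 0 < t \<and> t < 1 \<longrightarrow>
      ereal (1 - t) * \<phi> x + ereal t * \<phi> y \<le> \<phi> ((1 - t) *\<^sub>R x + t *\<^sub>R y))"

definition upper_semicont :: "('a::topological_space \<Rightarrow> ereal) \<Rightarrow> bool" where
  "upper_semicont \<phi> \<longleftrightarrow> (\<forall>x. Limsup (at x) \<phi> \<le> \<phi> x)"

definition coercive :: "('a::real_normed_vector \<Rightarrow> ereal) \<Rightarrow> bool" where
  "coercive \<phi> \<longleftrightarrow> (\<phi> \<longlongrightarrow> -\<infinity>) at_infinity"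

definition Phi_class :: "('a::euclidean_space \<Rightarrow> ereal) set" where
  "Phi_class = {\<phi>. (\<forall>x. \<phi> x \<noteq> \<infinity>) \<and> ereal_concave \<phi> \<and> upper_semicont \<phi> \<and> coercive \<phi>}"

text \<open>
  The exponential on \<open>[-\<infinity>,\<infinity>)\<close>; the value at \<open>\<infinity>\<close> is irrelevant because members of
  \<^const>\<open>Phi_class\<close> avoid it.
\<close>

definition exp_ereal :: "ereal \<Rightarrow> real" where
  "exp_ereal a = (if a = -\<infinity> then 0 else exp (real_of_ereal a))"

text \<open>
  The integral of an extended-real function as the integral of its positive part minus that of
  its negative part (\<^const>\<open>e2ennreal\<close> maps negative numbers to \<open>0\<close>). Members of
  \<^const>\<open>Phi_class\<close> are bounded above, so for them the positive part has a finite integral with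
  respect to a probability distribution and the difference is never \<open>\<infinity> - \<infinity>\<close>.
\<close>

definition ereal_integral :: "'a measure \<Rightarrow> ('a \<Rightarrow> ereal) \<Rightarrow> ereal" where
  "ereal_integral M g =
    enn2ereal (\<integral>\<^sup>+ x. e2ennreal (g x) \<partial>M) - enn2ereal (\<integral>\<^sup>+ x. e2ennreal (- g x) \<partial>M)"

definition L_fun :: "('a::euclidean_space \<Rightarrow> ereal) \<Rightarrow> 'a measure \<Rightarrow> ereal" where
  "L_fun \<phi> Q =
    ereal_integral Q \<phi> - enn2ereal (\<integral>\<^sup>+ x. ennreal (exp_ereal (\<phi> x)) \<partial>lborel) + 1"

definition L_sup :: "'a::euclidean_space measure \<Rightarrow> ereal" where
  "L_sup Q = (SUP \<phi>\<in>Phi_class. L_fun \<phi> Q)"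

definition psi :: "'a::euclidean_space measure \<Rightarrow> 'a \<Rightarrow> ereal" where
  "psi Q = (THE \<psi>. \<psi> \<in> Phi_class \<and> (\<forall>\<phi>\<in>Phi_class. L_fun \<phi> Q \<le> L_fun \<psi> Q))"

end

theory Submission
  imports Defs
begin

text \<open>
  Three facts about concave functions carry the proof; no subsequences have to be extracted.

  \<^item> Strict concavity is quantitative. Since
    \<open>2 exp ((g + h)/2) = exp g + exp h - (exp (g/2) - exp (h/2))\<^sup>2\<close>, two functions whose values of
    the functional are within \<open>t\<close> of its supremum satisfy
    \<open>\<integral>(exp (g/2) - exp (h/2))\<^sup>2 \<le> 2t\<close> (\<open>dist1_hellinger\<close>). Near-maximizers are thus close in mean.

  \<^item> Near-maximizers obey uniform bounds. Nonempty interior of the convex support means that every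
    half-space at some distance from a point \<open>c\<close> keeps a mass bounded below, and this survives small
    changes of the distribution (\<open>spread_stable\<close>). A superlevel set that misses a point of a ball
    around \<open>c\<close> misses such a half-space, which a large integral forbids. So near-maximizers are
    bounded below on that ball and, their exponentials having integral at most one, lie below a
    common cone \<open>a - b * norm (x - c)\<close> (\<open>a_priori_bounds\<close>).

  \<^item> The Mallows distance controls integrals of Lipschitz functions only. A function within the
    above bounds has \<open>k\<close>-Lipschitz concave majorants, and for large \<open>k\<close> these increase the integral
    of the exponential by an arbitrarily small amount, uniformly (\<open>lipmaj_uniform\<close>).

  A near-maximizer for one distribution is therefore, after passing to a majorant, a near-maximizer
  for every close distribution. This gives convergence of the suprema (\<open>L_sup_spread_limit\<close>) and,
  by the first fact, convergence in mean of the densities (\<open>psi_limit\<close>). A concave function that is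
  large at a point is large on a nearby ball, and one that is small at a point is small on half of a
  ball around it; each makes a pointwise discrepancy visible in the mean, which turns convergence in
  mean into the pointwise statements (\<open>limsup_of_dist1_limit\<close>, \<open>liminf_of_dist1_limit\<close>). The same
  observation gives uniqueness of the maximizer, and existence: a maximizing sequence is Cauchy in
  mean, and its joint upper limit is concave and attains the supremum (\<open>maximizer_exists\<close>).

  If the convex support has empty interior, the distribution lives on a hyperplane, and functions
  falling off steeply away from it make the functional arbitrarily large. They are Lipschitz, so the
  same happens along the sequence (\<open>L_sup_degenerate_limit\<close>).
\<close>

section \<open>Concave functions through their superlevel sets\<close>

text \<open>Real lower bounds replace extended-real values, so that no sum involving infinity arises later.\<close>

lemma ereal_concaveD:
  fixes phi :: "'a::real_vector \<Rightarrow> ereal"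
  assumes "ereal_concave phi" "ereal s \<le> phi x" "ereal r \<le> phi y" "0 \<le> t" "t \<le> 1"
  shows "ereal ((1 - t) * s + t * r) \<le> phi ((1 - t) *\<^sub>R x + t *\<^sub>R y)"
proof (cases "t = 0 \<or> t = 1")
  case True
  then show ?thesis using assms by auto
next
  case False
  with assms have t: "0 < t" "t < 1" by auto
  have "ereal ((1 - t) * s + t * r) = ereal (1 - t) * ereal s + ereal t * ereal r" by simp
  also have "\<dots> \<le> ereal (1 - t) * phi x + ereal t * phi y"
    using t assms by (intro add_mono ereal_mult_left_mono) auto
  also have "\<dots> \<le> phi ((1 - t) *\<^sub>R x + t *\<^sub>R y)"
    using assms(1) t unfolding ereal_concave_def by blast
  finally show ?thesis .
qed

lemma ereal_concaveI:
  fixes phi :: "'a::real_vector \<Rightarrow> ereal"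
  assumes fin: "\<And>x. phi x \<noteq> \<infinity>"
    and le: "\<And>x y s r t. ereal s < phi x \<Longrightarrow> ereal r < phi y \<Longrightarrow> 0 < t \<Longrightarrow> t < 1 \<Longrightarrow>
      ereal ((1 - t) * s + t * r) \<le> phi ((1 - t) *\<^sub>R x + t *\<^sub>R y)"
  shows "ereal_concave phi"
  unfolding ereal_concave_def
proof (intro allI impI)
  fix x y and t :: real assume t: "0 < t \<and> t < 1"
  show "ereal (1 - t) * phi x + ereal t * phi y \<le> phi ((1 - t) *\<^sub>R x + t *\<^sub>R y)"
  proof (cases "phi x = -\<infinity> \<or> phi y = -\<infinity>")
    case True
    then have "ereal (1 - t) * phi x = -\<infinity> \<or> ereal t * phi y = -\<infinity>"
      using t by auto
    moreover have "ereal (1 - t) * phi x \<noteq> \<infinity>" "ereal t * phi y \<noteq> \<infinity>"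
      using t fin[of x] fin[of y] by (cases "phi x"; cases "phi y"; auto)+
    ultimately have minf: "ereal (1 - t) * phi x + ereal t * phi y = -\<infinity>" by auto
    show ?thesis by (subst minf) simp
  next
    case False
    then obtain p q where p: "phi x = ereal p" and q: "phi y = ereal q"
      using fin[of x] fin[of y] by (cases "phi x"; cases "phi y") auto
    show ?thesis
    proof (rule ereal_le_epsilon)
      fix e :: ereal assume e: "0 < e"
      show "ereal (1 - t) * phi x + ereal t * phi y \<le> phi ((1 - t) *\<^sub>R x + t *\<^sub>R y) + e"
      proof (cases e)
        case (real e')
        then have "0 < e'" using e by simp
        then have "ereal ((1 - t) * (p - e') + t * (q - e')) \<le> phi ((1 - t) *\<^sub>R x + t *\<^sub>R y)"
          using p q t by (intro le) auto
        then have "ereal ((1 - t) * p + t * q) - ereal e' \<le> phi ((1 - t) *\<^sub>R x + t *\<^sub>R y)"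
          by (simp add: algebra_simps)
        then show ?thesis using p q real by (cases "phi ((1 - t) *\<^sub>R x + t *\<^sub>R y)") auto
      qed (use e fin in auto)
    qed
  qed
qed

lemma upper_semicont_iff:
  fixes phi :: "'a::metric_space \<Rightarrow> ereal"
  shows "upper_semicont phi \<longleftrightarrow> (\<forall>x s. phi x < s \<longrightarrow> (\<exists>d>0. \<forall>y. dist y x < d \<longrightarrow> phi y < s))"
  unfolding upper_semicont_def Limsup_le_iff eventually_at
  by (metis UNIV_I dist_self)

lemma Phi_classD:
  assumes "phi \<in> Phi_class"
  shows "phi x \<noteq> \<infinity>" "ereal_concave phi" "upper_semicont phi" "coercive phi"
  using assms by (auto simp: Phi_class_def)

lemma open_sublevel:
  fixes phi :: "'a::metric_space \<Rightarrow> ereal"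
  assumes "upper_semicont phi" shows "open {x. phi x < s}"
  using assms unfolding upper_semicont_iff open_dist by auto

lemma closed_superlevel:
  fixes phi :: "'a::metric_space \<Rightarrow> ereal"
  assumes "upper_semicont phi" shows "closed {x. s \<le> phi x}"
  using open_sublevel[OF assms, of s] unfolding closed_def
  by (simp add: Collect_neg_eq[symmetric] not_le)

lemma convex_superlevel:
  assumes "ereal_concave phi" shows "convex {x. ereal s \<le> phi x}"
proof (rule convexI)
  fix x y u v assume "x \<in> {x. ereal s \<le> phi x}" "y \<in> {x. ereal s \<le> phi x}"
    and uv: "(0::real) \<le> u" "0 \<le> v" "u + v = 1"
  then have "ereal ((1 - v) * s + v * s) \<le> phi ((1 - v) *\<^sub>R x + v *\<^sub>R y)"
    by (intro ereal_concaveD[OF assms]) auto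
  moreover have "u = 1 - v" "(1 - v) * s + v * s = s" using uv by (simp_all add: algebra_simps)
  ultimately show "u *\<^sub>R x + v *\<^sub>R y \<in> {x. ereal s \<le> phi x}"
    by (simp del: distrib_left_numeral)
qed

lemma upper_semicont_measurable:
  fixes phi :: "'a::metric_space \<Rightarrow> ereal"
  assumes "upper_semicont phi" shows "phi \<in> borel_measurable borel"
  by (rule borel_measurableI_less) (use open_sublevel[OF assms] in auto)

lemma Phi_class_measurable:
  assumes "phi \<in> Phi_class" shows "phi \<in> borel_measurable borel"
  using Phi_classD(3)[OF assms] by (rule upper_semicont_measurable)

lemma exp_ereal_simps [simp]: "exp_ereal (ereal s) = exp s" "exp_ereal (-\<infinity>) = 0"
  by (auto simp: exp_ereal_def)

lemma exp_ereal_nonneg [simp]: "0 \<le> exp_ereal s"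
  by (auto simp: exp_ereal_def)

lemma exp_ereal_mono: "s \<le> t \<Longrightarrow> t \<noteq> \<infinity> \<Longrightarrow> exp_ereal s \<le> exp_ereal t"
  by (cases s; cases t) auto

lemma exp_ereal_pos_iff: "s \<noteq> \<infinity> \<Longrightarrow> 0 < exp_ereal s \<longleftrightarrow> s \<noteq> -\<infinity>"
  by (cases s) auto

lemma exp_ereal_measurable [measurable]: "exp_ereal \<in> borel_measurable borel"
  unfolding exp_ereal_def by measurable

text \<open>Coercivity bounds the function outside a ball; on the ball, the open sets where it is below some natural number form a cover.\<close>

lemma Phi_class_bounded_above:
  fixes phi :: "'a::euclidean_space \<Rightarrow> ereal"
  assumes "phi \<in> Phi_class"
  shows "\<exists>M::real. \<forall>x. phi x \<le> ereal M"
proof -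
  have "\<forall>\<^sub>F x in at_infinity. phi x < ereal 0"
    using Phi_classD(4)[OF assms] unfolding coercive_def by (rule order_tendstoD) simp
  then obtain R where R: "\<And>x. R \<le> norm x \<Longrightarrow> phi x < ereal 0"
    unfolding eventually_at_infinity by auto
  define S where "S n = {x. phi x < ereal (real n)}" for n :: nat
  have "cball 0 R \<subseteq> (\<Union>n. S n)"
  proof
    fix x :: 'a assume "x \<in> cball 0 R"
    obtain n :: nat where "phi x < ereal (real n)"
      using Phi_classD(1)[OF assms, of x] by (cases "phi x") (use reals_Archimedean2 in auto)
    then show "x \<in> (\<Union>n. S n)" by (auto simp: S_def)
  qed
  then obtain F where F: "finite F" "cball 0 R \<subseteq> (\<Union>n\<in>F. S n)"
    using compactE_image[OF compact_cball, of UNIV S 0 R] open_sublevel[OF Phi_classD(3)[OF assms]]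
    unfolding S_def by metis
  define M where "M = Max (insert 0 F)"
  have "phi x \<le> ereal (real M)" for x
  proof (cases "norm x \<le> R")
    case True
    then have "x \<in> cball 0 R" by simp
    with F obtain n where "n \<in> F" "phi x < ereal (real n)" by (auto simp: S_def)
    moreover have "n \<le> M" unfolding M_def using F \<open>n \<in> F\<close> by simp
    ultimately show ?thesis
      by (meson ereal_less_eq(3) less_imp_le of_nat_mono order_trans)
  next
    case False
    then have "phi x \<le> ereal 0" using R[of x] by simp
    then show ?thesis by (rule order_trans) simp
  qed
  then show ?thesis by auto
qed

section \<open>The functional in terms of real integrals\<close>

definition mass :: "('a::euclidean_space \<Rightarrow> ereal) \<Rightarrow> ennreal" where
  "mass phi = (\<integral>\<^sup>+ x. ennreal (exp_ereal (phi x)) \<partial>lborel)"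

definition mean :: "'a measure \<Rightarrow> ('a \<Rightarrow> ereal) \<Rightarrow> real" where
  "mean Q phi = (\<integral>x. real_of_ereal (phi x) \<partial>Q)"

text \<open>The members of the class at which the functional is a real number, see \<open>proper_iff\<close>.\<close>

definition proper :: "'a::euclidean_space measure \<Rightarrow> ('a \<Rightarrow> ereal) \<Rightarrow> bool" where
  "proper Q phi \<longleftrightarrow> phi \<in> Phi_class \<and> integrable Q (\<lambda>x. real_of_ereal (phi x)) \<and>
    (AE x in Q. phi x \<noteq> -\<infinity>) \<and> mass phi < \<top>"

definition Lval :: "'a::euclidean_space measure \<Rightarrow> ('a \<Rightarrow> ereal) \<Rightarrow> real" where
  "Lval Q phi = mean Q phi - enn2real (mass phi) + 1"

lemma prob_distributionD:
  assumes "prob_distribution Q"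
  shows "prob_space Q" "sets Q = sets borel" "space Q = UNIV"
  using assms sets_eq_imp_space_eq[of Q borel] by (auto simp: prob_distribution_def)

lemma prob_distribution_measurable:
  assumes "prob_distribution Q" shows "borel_measurable Q = borel_measurable borel"
  using prob_distributionD(2)[OF assms] by (intro measurable_cong_sets) auto

lemma enn2ereal_eq_enn2real: "a \<noteq> \<top> \<Longrightarrow> enn2ereal a = ereal (enn2real a)"
  by (cases a) (auto simp: enn2ereal_ennreal)

lemma ereal_integral_real:
  assumes "integrable M (\<lambda>x. real_of_ereal (g x))" "AE x in M. g x \<noteq> -\<infinity>" "\<And>x. g x \<noteq> \<infinity>"
  shows "ereal_integral M g = ereal (\<integral>x. real_of_ereal (g x) \<partial>M)"
proof -
  let ?h = "\<lambda>x. real_of_ereal (g x)"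
  have fin: "e2ennreal (g x) = ennreal (?h x)" "e2ennreal (- g x) = ennreal (- ?h x)"
    if "g x \<noteq> -\<infinity>" for x
    using that assms(3)[of x] by (cases "g x"; simp)+
  have p: "(\<integral>\<^sup>+ x. e2ennreal (g x) \<partial>M) = (\<integral>\<^sup>+ x. ennreal (?h x) \<partial>M)"
    by (intro nn_integral_cong_AE eventually_mono[OF assms(2)] fin)
  have m: "(\<integral>\<^sup>+ x. e2ennreal (- g x) \<partial>M) = (\<integral>\<^sup>+ x. ennreal (- ?h x) \<partial>M)"
    by (intro nn_integral_cong_AE eventually_mono[OF assms(2)] fin)
  have "(\<integral>\<^sup>+ x. ennreal (?h x) \<partial>M) \<noteq> \<top>" "(\<integral>\<^sup>+ x. ennreal (- ?h x) \<partial>M) \<noteq> \<top>"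
    using assms(1) by (auto simp: real_integrable_def)
  then show ?thesis
    unfolding ereal_integral_def p m real_lebesgue_integral_def[OF assms(1)]
    by (simp add: enn2ereal_eq_enn2real)
qed

text \<open>For a function bounded above, only the negative part can have an infinite integral.\<close>

lemma ereal_integral_not_minf:
  assumes meas: "g \<in> borel_measurable M" and M: "prob_space M" and le: "\<And>x. g x \<le> ereal K"
    and ne: "ereal_integral M g \<noteq> -\<infinity>"
  shows "integrable M (\<lambda>x. real_of_ereal (g x))" "AE x in M. g x \<noteq> -\<infinity>"
proof -
  interpret prob_space M by fact
  note meas [measurable]
  have "(\<integral>\<^sup>+ x. e2ennreal (g x) \<partial>M) \<le> (\<integral>\<^sup>+ x. ennreal K \<partial>M)"
    using le by (intro nn_integral_mono) (metis e2ennreal_ereal e2ennreal_mono)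
  then have p: "(\<integral>\<^sup>+ x. e2ennreal (g x) \<partial>M) < \<top>"
    by (simp add: emeasure_space_1 le_less_trans)
  have m: "(\<integral>\<^sup>+ x. e2ennreal (- g x) \<partial>M) < \<top>"
  proof (rule ccontr)
    assume "\<not> ?thesis"
    then have "(\<integral>\<^sup>+ x. e2ennreal (- g x) \<partial>M) = \<top>" using less_top by blast
    then have "ereal_integral M g = -\<infinity>" using p unfolding ereal_integral_def
      by (cases "\<integral>\<^sup>+ x. e2ennreal (g x) \<partial>M") (auto simp: top_ennreal.rep_eq)
    then show False using ne by simp
  qed
  have "AE x in M. e2ennreal (- g x) \<noteq> \<infinity>"
    using m by (intro nn_integral_PInf_AE) auto
  then show ae: "AE x in M. g x \<noteq> -\<infinity>"
    by eventually_elim auto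
  have "(\<integral>\<^sup>+ x. ennreal (norm (real_of_ereal (g x))) \<partial>M) \<le>
      (\<integral>\<^sup>+ x. e2ennreal (g x) + e2ennreal (- g x) \<partial>M)"
  proof (rule nn_integral_mono)
    fix x show "ennreal (norm (real_of_ereal (g x))) \<le> e2ennreal (g x) + e2ennreal (- g x)"
      by (cases "g x"; cases "0 \<le> real_of_ereal (g x)") (auto simp: ennreal_neg)
  qed
  also have "\<dots> < \<top>" using p m by (subst nn_integral_add) auto
  finally show "integrable M (\<lambda>x. real_of_ereal (g x))"
    by (intro integrableI_bounded) auto
qed

lemma ereal_integral_le:
  assumes "prob_space M" "\<And>x. g x \<le> ereal K"
  shows "ereal_integral M g \<le> ereal (max 0 K)"
proof -
  interpret prob_space M by fact
  have "(\<integral>\<^sup>+ x. e2ennreal (g x) \<partial>M) \<le> (\<integral>\<^sup>+ x. ennreal (max 0 K) \<partial>M)"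
  proof (rule nn_integral_mono)
    fix x
    have "g x \<le> ereal (max 0 K)" using assms(2)[of x] by (rule order_trans) simp
    then show "e2ennreal (g x) \<le> ennreal (max 0 K)" using e2ennreal_mono e2ennreal_ereal by metis
  qed
  then have "(\<integral>\<^sup>+ x. e2ennreal (g x) \<partial>M) \<le> ennreal (max 0 K)"
    by (simp add: emeasure_space_1)
  then have "enn2ereal (\<integral>\<^sup>+ x. e2ennreal (g x) \<partial>M) \<le> ereal (max 0 K)"
    unfolding less_eq_ennreal.rep_eq by (subst (asm) enn2ereal_ennreal) simp_all
  moreover have "ereal_integral M g \<le> enn2ereal (\<integral>\<^sup>+ x. e2ennreal (g x) \<partial>M)"
    unfolding ereal_integral_def by (rule ereal_diff_le_self) simp
  ultimately show ?thesis by (rule order_trans[rotated])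
qed

lemma L_fun_proper:
  assumes "prob_distribution Q" "proper Q phi"
  shows "L_fun phi Q = ereal (Lval Q phi)"
proof -
  have "ereal_integral Q phi = ereal (mean Q phi)"
    unfolding mean_def using assms Phi_classD(1)
    by (intro ereal_integral_real) (auto simp: proper_def)
  moreover have "enn2ereal (mass phi) = ereal (enn2real (mass phi))"
    using assms(2) unfolding proper_def by (intro enn2ereal_eq_enn2real) auto
  ultimately show ?thesis unfolding L_fun_def Lval_def mass_def one_ereal_def by simp
qed

lemma proper_iff:
  assumes "prob_distribution Q" "phi \<in> Phi_class"
  shows "proper Q phi \<longleftrightarrow> L_fun phi Q \<noteq> -\<infinity>"
proof
  assume "proper Q phi"
  then show "L_fun phi Q \<noteq> -\<infinity>" using L_fun_proper[OF assms(1)] by auto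
next
  assume ne: "L_fun phi Q \<noteq> -\<infinity>"
  obtain K where K: "\<And>x. phi x \<le> ereal K" using Phi_class_bounded_above[OF assms(2)] by auto
  have ub: "ereal_integral Q phi \<le> ereal (max 0 K)"
    using prob_distributionD(1)[OF assms(1)] K by (rule ereal_integral_le)
  have "ereal_integral Q phi \<noteq> -\<infinity>"
  proof
    assume "ereal_integral Q phi = -\<infinity>"
    then have "L_fun phi Q = -\<infinity>" unfolding L_fun_def
      by (cases "enn2ereal (\<integral>\<^sup>+ x. ennreal (exp_ereal (phi x)) \<partial>lborel)")
        (auto simp: one_ereal_def)
    with ne show False by simp
  qed
  moreover have "mass phi < \<top>"
  proof (rule ccontr)
    assume "\<not> ?thesis"
    then have "mass phi = \<top>" using less_top by blast
    then have "enn2ereal (mass phi) = \<infinity>" by (simp add: top_ennreal.rep_eq)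
    then have "L_fun phi Q = -\<infinity>" using ub unfolding L_fun_def mass_def
      by (cases "ereal_integral Q phi") (auto simp: one_ereal_def simp del: ereal_max)
    with ne show False by simp
  qed
  moreover have "phi \<in> borel_measurable Q"
    using Phi_class_measurable[OF assms(2)] by (simp add: prob_distribution_measurable[OF assms(1)])
  ultimately show "proper Q phi" unfolding proper_def
    using ereal_integral_not_minf[OF _ prob_distributionD(1)[OF assms(1)] K] assms(2) by simp
qed

lemma L_sup_ge:
  assumes "prob_distribution Q" "proper Q phi"
  shows "ereal (Lval Q phi) \<le> L_sup Q"
  unfolding L_fun_proper[OF assms, symmetric] L_sup_def
  using assms(2) by (intro SUP_upper) (simp add: proper_def)

lemma L_sup_le:
  assumes "prob_distribution Q" "\<And>phi. proper Q phi \<Longrightarrow> ereal (Lval Q phi) \<le> K"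
  shows "L_sup Q \<le> K"
  unfolding L_sup_def
proof (rule SUP_least)
  fix phi :: "'a \<Rightarrow> ereal" assume "phi \<in> Phi_class"
  show "L_fun phi Q \<le> K"
  proof (cases "proper Q phi")
    case True
    then show ?thesis using L_fun_proper[OF assms(1)] assms(2) by simp
  next
    case False
    then have "L_fun phi Q = -\<infinity>" using proper_iff[OF assms(1) \<open>phi \<in> Phi_class\<close>] by simp
    then show ?thesis by simp
  qed
qed

lemma L_sup_approx:
  assumes "prob_distribution Q" "ereal K < L_sup Q"
  obtains phi where "proper Q phi" "K < Lval Q phi"
proof (rule ccontr)
  assume "\<not> thesis"
  then have "\<And>phi. proper Q phi \<Longrightarrow> Lval Q phi \<le> K" using that by force
  then have "L_sup Q \<le> ereal K" by (intro L_sup_le[OF assms(1)]) auto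
  with assms(2) show False by simp
qed

section \<open>A priori bounds for near-maximizers\<close>

text \<open>Nondegeneracy in a form that survives small changes of the distribution.\<close>

definition spread :: "'a::euclidean_space measure \<Rightarrow> 'a \<Rightarrow> real \<Rightarrow> real \<Rightarrow> bool" where
  "spread Q c rho eta \<longleftrightarrow> 0 < rho \<and> 0 < eta \<and>
    (\<forall>u. norm u = 1 \<longrightarrow> eta \<le> measure Q {x. rho < u \<bullet> (x - c)})"

text \<open>A cone above the function and a floor on a ball: the bounds under which all later estimates are uniform.\<close>

definition tame :: "'a::euclidean_space \<Rightarrow> real \<Rightarrow> real \<Rightarrow> real \<Rightarrow> real \<Rightarrow> ('a \<Rightarrow> ereal) \<Rightarrow> bool" where
  "tame c rho m a b phi \<longleftrightarrow> phi \<in> Phi_class \<and> 0 < rho \<and> 0 < b \<and>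
    (\<forall>x. phi x \<le> ereal (a - b * norm (x - c))) \<and> (\<forall>x\<in>cball c rho. ereal m \<le> phi x)"

lemma separate_from_ball:
  fixes K :: "'a::euclidean_space set"
  assumes "closed K" "convex K" "K \<noteq> {}" "z \<in> cball c rho" "z \<notin> K"
  obtains u where "norm u = 1" "\<And>x. x \<in> K \<Longrightarrow> u \<bullet> (x - c) \<le> rho"
proof -
  obtain a b where ab: "a \<bullet> z < b" "\<And>x. x \<in> K \<Longrightarrow> b < a \<bullet> x"
    using separating_hyperplane_closed_point[OF assms(2,1,5)] by auto
  have "a \<noteq> 0" using ab assms(3) by force
  define u where "u = (- 1 / norm a) *\<^sub>R a"
  have "norm u = 1" using \<open>a \<noteq> 0\<close> by (simp add: u_def)
  moreover have "u \<bullet> (x - c) \<le> rho" if "x \<in> K" for x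
  proof -
    have "a \<bullet> z < a \<bullet> x" using ab that by (meson less_trans)
    then have "u \<bullet> x \<le> u \<bullet> z" using \<open>a \<noteq> 0\<close> by (simp add: u_def field_simps)
    then have "u \<bullet> (x - c) \<le> u \<bullet> (z - c)" by (simp add: inner_diff_right)
    also have "\<dots> \<le> norm u * norm (z - c)" by (rule norm_cauchy_schwarz)
    also have "\<dots> \<le> rho" using assms(4) \<open>norm u = 1\<close> by (simp add: dist_norm norm_minus_commute)
    finally show ?thesis .
  qed
  ultimately show thesis by (rule that)
qed

lemma spread_le_1:
  fixes Q :: "'a::euclidean_space measure"
  assumes "prob_distribution Q" "spread Q c rho eta" shows "eta \<le> 1"
proof -
  interpret prob_space Q using prob_distributionD(1)[OF assms(1)] .
  obtain u :: 'a where "norm u = 1" using vector_choose_size[of 1] by auto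
  then show ?thesis using assms(2) prob_le_1 unfolding spread_def by (meson order_trans)
qed

lemma mean_le:
  assumes "prob_distribution Q" "proper Q phi" "\<And>x. phi x \<le> ereal M"
  shows "mean Q phi \<le> M"
proof -
  interpret prob_space Q using prob_distributionD(1)[OF assms(1)] .
  have "mean Q phi \<le> (\<integral>x. M \<partial>Q)" unfolding mean_def
  proof (rule integral_mono_AE)
    show "AE x in Q. real_of_ereal (phi x) \<le> M"
      using assms(2) unfolding proper_def
    proof (elim conjE, elim eventually_mono)
      fix x assume "phi x \<noteq> -\<infinity>"
      then show "real_of_ereal (phi x) \<le> M" using assms(3)[of x] by (cases "phi x") auto
    qed
  qed (use assms(2) in \<open>auto simp: proper_def\<close>)
  then show ?thesis by (simp add: prob_space)
qed

text \<open>If the superlevel set at height \<open>t\<close> missed a point of the ball, a hyperplane through that point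
  would cut off a half-space on which the function is below \<open>t\<close> and whose mass is at least \<open>eta\<close>, so the mean would
  be at most \<open>M - (M - t) * eta\<close>. The height is chosen to make this number one less than the mean.\<close>

lemma superlevel_contains_ball:
  assumes Q: "prob_distribution Q" and spread: "spread Q c rho eta" and phi: "proper Q phi"
    and M: "\<And>x. phi x \<le> ereal M" and x: "x \<in> cball c rho"
  shows "ereal (M - (M - mean Q phi + 1) / eta) \<le> phi x"
proof (rule ccontr)
  assume neg: "\<not> ?thesis"
  interpret prob_space Q using prob_distributionD(1)[OF Q] .
  note [simp] = prob_distributionD(3)[OF Q]
  have eta: "0 < eta" "eta \<le> 1" using spread spread_le_1[OF Q spread] by (auto simp: spread_def)
  have Phi: "phi \<in> Phi_class" using phi by (simp add: proper_def)
  have le: "mean Q phi \<le> M" using Q phi M by (rule mean_le)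
  define t where "t = M - (M - mean Q phi + 1) / eta"
  define K where "K = {x. ereal t \<le> phi x}"
  have t: "t \<le> mean Q phi - 1"
  proof -
    have "M - mean Q phi + 1 \<le> (M - mean Q phi + 1) / eta"
      using mult_left_mono[of eta 1 "M - mean Q phi + 1"] eta le by (simp add: pos_le_divide_eq)
    then show ?thesis by (simp add: t_def)
  qed
  have "K \<noteq> {}"
  proof
    assume "K = {}"
    then have "phi x \<le> ereal t" for x unfolding K_def by (metis empty_Collect_eq linear)
    then have "mean Q phi \<le> t" by (rule mean_le[OF Q phi])
    with t show False by simp
  qed
  moreover have "closed K" "convex K" unfolding K_def
    using closed_superlevel convex_superlevel Phi_classD[OF Phi] by auto
  moreover have "x \<notin> K" using neg by (simp add: K_def t_def)
  ultimately obtain u where u: "norm u = 1" "\<And>x. x \<in> K \<Longrightarrow> u \<bullet> (x - c) \<le> rho"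
    using separate_from_ball x by metis
  define H where "H = {x. rho < u \<bullet> (x - c)}"
  have "open H" unfolding H_def by (intro open_Collect_less continuous_intros)
  then have H: "H \<in> sets Q" by (simp add: prob_distributionD(2)[OF Q])
  have "eta \<le> measure Q H" using spread u(1) unfolding spread_def H_def by auto
  have int: "integrable Q (\<lambda>x. (t - M) * indicator H x)"
    using H by (intro integrable_mult_right integrable_real_indicator) (auto simp: less_top[symmetric])
  have "mean Q phi \<le> (\<integral>x. M + (t - M) * indicator H x \<partial>Q)" unfolding mean_def
  proof (rule integral_mono_AE)
    show "AE x in Q. real_of_ereal (phi x) \<le> M + (t - M) * indicator H x"
      using phi unfolding proper_def
    proof (elim conjE, elim eventually_mono)
      fix y assume "phi y \<noteq> -\<infinity>"
      moreover have "y \<notin> K" if "y \<in> H" using u(2)[of y] that by (auto simp: H_def)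
      ultimately show "real_of_ereal (phi y) \<le> M + (t - M) * indicator H y"
        using M[of y] unfolding K_def by (cases "phi y") (auto simp: indicator_def)
    qed
  qed (use phi int in \<open>auto simp: proper_def\<close>)
  also have "\<dots> = M + (t - M) * measure Q H"
    using int prob_space by (subst Bochner_Integration.integral_add) auto
  also have "\<dots> \<le> M + (t - M) * eta"
    using \<open>eta \<le> measure Q H\<close> t le by (intro add_left_mono mult_left_mono_neg) auto
  also have "\<dots> = mean Q phi - 1" using eta by (simp add: t_def field_simps)
  finally show False by simp
qed

text \<open>The basic geometric step: the ball with centre \<open>c + l *\<^sub>R (x - c)\<close> and radius \<open>(1 - l) * rho\<close> consists
  of convex combinations of \<open>x\<close> and points of the ball on which \<open>m\<close> is a lower bound.\<close>

lemma cone_lower_bound: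
  fixes phi :: "'a::euclidean_space \<Rightarrow> ereal"
  assumes conc: "ereal_concave phi" and s: "ereal s \<le> phi x" and m: "\<forall>y\<in>cball c rho. ereal m \<le> phi y"
    and l: "0 \<le> l" "l < 1" and z: "dist z (c + l *\<^sub>R (x - c)) \<le> (1 - l) * rho"
  shows "ereal (l * s + (1 - l) * m) \<le> phi z"
proof -
  define y where "y = c + (1 / (1 - l)) *\<^sub>R (z - (c + l *\<^sub>R (x - c)))"
  have "norm (z - (c + l *\<^sub>R (x - c))) / (1 - l) \<le> rho"
    using z l by (simp add: dist_norm field_simps)
  then have "y \<in> cball c rho" using l by (simp add: y_def dist_norm)
  then have "ereal ((1 - l) * m + l * s) \<le> phi ((1 - l) *\<^sub>R y + l *\<^sub>R x)"
    using ereal_concaveD[OF conc, of m y s x l] m s l by auto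
  moreover have "(1 - l) *\<^sub>R y = (1 - l) *\<^sub>R c + (z - (c + l *\<^sub>R (x - c)))"
    using l by (simp add: y_def scaleR_add_right)
  then have "(1 - l) *\<^sub>R y + l *\<^sub>R x = z"
    by (simp add: algebra_simps)
  ultimately show ?thesis by (simp add: add.commute)
qed

lemma mass_ge:
  assumes "A \<in> sets borel" "\<And>x. x \<in> A \<Longrightarrow> ereal s \<le> phi x" "\<And>x. phi x \<noteq> \<infinity>"
  shows "ennreal (exp s) * emeasure lborel A \<le> mass phi"
proof -
  have "ennreal (exp s) * emeasure lborel A = (\<integral>\<^sup>+x. ennreal (exp s) * indicator A x \<partial>lborel)"
    using assms(1) by (simp add: nn_integral_cmult_indicator)
  also have "\<dots> \<le> mass phi" unfolding mass_def
  proof (rule nn_integral_mono)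
    fix x show "ennreal (exp s) * indicator A x \<le> ennreal (exp_ereal (phi x))"
      using exp_ereal_mono[of "ereal s" "phi x"] assms(2)[of x] assms(3)[of x]
      by (cases "x \<in> A") (auto intro!: ennreal_leI)
  qed
  finally show ?thesis .
qed

lemma mass_ge_ball:
  fixes phi :: "'a::euclidean_space \<Rightarrow> ereal"
  assumes "\<And>x. x \<in> ball p r \<Longrightarrow> ereal s \<le> phi x" "\<And>x. phi x \<noteq> \<infinity>" "0 \<le> r"
  shows "ennreal (exp s * (unit_ball_vol DIM('a) * r ^ DIM('a))) \<le> mass phi"
proof -
  have "ennreal (exp s) * emeasure lborel (ball p r) \<le> mass phi"
    using assms by (intro mass_ge) auto
  then show ?thesis using assms(3) by (simp add: emeasure_ball ennreal_mult)
qed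

lemma exp_power_bound:
  assumes "0 < A"
  obtains B :: real where "\<And>M. c \<le> M \<Longrightarrow> exp (M - 2) * A \<le> (M - c + 1) ^ d \<Longrightarrow> M \<le> B"
proof -
  \<comment> \<open>Rewrites the inequality in terms of \<open>M - c + 1\<close>, whose power is outgrown by its exponential.\<close>
  define A' where "A' = A * exp (c - 3)"
  have "A' > 0" using assms by (simp add: A'_def)
  have "\<forall>\<^sub>F x in at_top. x ^ d / exp x < A'"
    using tendsto_power_div_exp_0 \<open>A' > 0\<close> by (rule order_tendstoD)
  then obtain B where B: "\<And>x. B \<le> x \<Longrightarrow> x ^ d / exp x < A'"
    by (auto simp: eventually_at_top_linorder)
  show thesis
  proof (rule that)
    fix M :: real assume le: "c \<le> M" "exp (M - 2) * A \<le> (M - c + 1) ^ d"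
    have "exp (M - 2) * A = exp (M - c + 1) * A'"
      by (simp add: A'_def exp_add[symmetric] algebra_simps)
    then have "A' \<le> (M - c + 1) ^ d / exp (M - c + 1)" using le by (simp add: field_simps)
    then have "M - c + 1 < B" using B[of "M - c + 1"] by force
    then show "M \<le> B + c" by simp
  qed
qed

text \<open>The segment from \<open>c\<close> to a far point of the superlevel set carries many disjoint balls of radius \<open>rho/2\<close>
  inside that set, and their total volume is bounded because the mass is.\<close>

lemma superlevel_radius:
  fixes c :: "'a::euclidean_space"
  assumes "0 < rho"
  obtains R where "0 < R"
    "\<And>phi x. ereal_concave phi \<Longrightarrow> (\<And>y. phi y \<noteq> \<infinity>) \<Longrightarrow> \<forall>y\<in>cball c rho. ereal m \<le> phi y \<Longrightarrow> mass phi \<le> 1 \<Longrightarrow>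
      ereal (m - 1) \<le> phi x \<Longrightarrow> norm (x - c) < R"
proof -
  define v where "v = exp (m - 1) * (unit_ball_vol DIM('a) * (rho/2) ^ DIM('a))"
  have "v > 0" using assms by (simp add: v_def)
  obtain N :: nat where N: "1 < real N * v" using reals_Archimedean3[OF \<open>v > 0\<close>] by auto
  have "N > 0" using N by (cases N) auto
  show thesis
  proof (rule that)
    \<comment> \<open>Half the segment must hold \<open>N\<close> centres at spacing \<open>rho\<close>; on that half the ball of radius \<open>rho/2\<close> still fits the cone.\<close>
    show "0 < 2 * real N * rho" using \<open>N > 0\<close> assms by simp
    fix phi :: "'a \<Rightarrow> ereal" and x
    assume phi: "ereal_concave phi" "\<And>y. phi y \<noteq> \<infinity>" "\<forall>y\<in>cball c rho. ereal m \<le> phi y" "mass phi \<le> 1"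
      and x: "ereal (m - 1) \<le> phi x"
    show "norm (x - c) < 2 * real N * rho"
    proof (rule ccontr)
      assume neg: "\<not> ?thesis"
      define D where "D = norm (x - c)"
      have "2 * real N * rho \<le> D" "0 < 2 * real N * rho"
        using neg assms \<open>N > 0\<close> by (auto simp: D_def not_less)
      then have D: "2 * real N * rho \<le> D" "0 < D" by linarith+
      define B where "B j = ball (c + (real j * rho / D) *\<^sub>R (x - c)) (rho/2)" for j :: nat
      have ge: "ereal (m - 1) \<le> phi z" if "j < N" "z \<in> B j" for j z
      proof -
        define l where "l = real j * rho / D"
        have "2 * (real j * rho) \<le> 2 * (real N * rho)" using that assms by simp
        then have "2 * (real j * rho) \<le> D" using D by simp
        then have l: "0 \<le> l" "l \<le> 1/2" using D assms by (auto simp: l_def field_simps)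
        have "dist z (c + l *\<^sub>R (x - c)) \<le> rho/2" using that by (simp add: B_def l_def dist_commute)
        also have "\<dots> \<le> (1 - l) * rho" using l assms by (simp add: field_simps)
        finally have "ereal (l * (m - 1) + (1 - l) * m) \<le> phi z"
          using cone_lower_bound[OF phi(1) x phi(3), of l z] l by auto
        moreover have "m - 1 \<le> l * (m - 1) + (1 - l) * m" using l by (simp add: algebra_simps)
        ultimately show ?thesis by (meson ereal_less_eq(3) order_trans)
      qed
      have disj: "disjoint_family_on B {..<N}"
      proof (unfold disjoint_family_on_def, intro ballI impI)
        fix i j :: nat assume "i \<noteq> j"
        have "dist (c + (real i * rho / D) *\<^sub>R (x - c)) (c + (real j * rho / D) *\<^sub>R (x - c))
            = \<bar>real i * rho / D - real j * rho / D\<bar> * D"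
          by (simp add: dist_norm D_def scaleR_diff_left[symmetric])
        also have "\<dots> = \<bar>(real i - real j) * rho\<bar>" using D
          by (simp add: abs_mult[symmetric] field_simps del: abs_mult)
        also have "\<dots> \<ge> rho"
        proof -
          have "1 \<le> \<bar>real i - real j\<bar>" using \<open>i \<noteq> j\<close> by linarith
          then show ?thesis using assms by (simp add: abs_mult)
        qed
        finally show "B i \<inter> B j = {}" unfolding B_def by (intro disjoint_ballI) auto
      qed
      have "ennreal (real N * v) = ennreal (exp (m - 1)) * (\<Sum>j<N. emeasure lborel (B j))"
        using assms by (simp add: B_def emeasure_ball v_def ennreal_mult'[symmetric] ennreal_of_nat_eq_real_of_nat mult_ac
            flip: ennreal_mult)
      also have "(\<Sum>j<N. emeasure lborel (B j)) = emeasure lborel (\<Union>j<N. B j)"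
        by (intro sum_emeasure disj) (auto simp: B_def)
      also have "ennreal (exp (m - 1)) * \<dots> \<le> mass phi"
        using ge phi(2) by (intro mass_ge) (auto simp: B_def)
      also have "\<dots> \<le> ennreal 1" using phi(4) by simp
      finally show False using N by (subst (asm) ennreal_le_iff) auto
    qed
  qed
qed

text \<open>Let \<open>M\<close> be the supremum of the function. Shrinking the ball of \<open>superlevel_contains_ball\<close> towards a
  near-maximum point by a factor of order \<open>1/M\<close> yields a ball on which the function is at least \<open>M - 2\<close>. Its
  volume is only polynomially small in \<open>M\<close>, so mass at most one bounds \<open>M\<close>. The floor on the ball follows,
  then the radius of the superlevel set at \<open>m - 1\<close>, and concavity along rays gives the cone.\<close>

lemma a_priori_bounds:
  fixes c :: "'a::euclidean_space"
  assumes "0 < rho" "0 < eta"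
  obtains m a b where
    "\<And>Q phi. prob_distribution Q \<Longrightarrow> spread Q c rho eta \<Longrightarrow> proper Q phi \<Longrightarrow> mass phi \<le> 1 \<Longrightarrow> c0 \<le> mean Q phi \<Longrightarrow>
      tame c rho m a b phi"
proof -
  define V where "V = unit_ball_vol DIM('a) * rho ^ DIM('a)"
  have V: "0 < eta ^ DIM('a) * V" using assms by (simp add: V_def)
  obtain B where B: "\<And>M. c0 \<le> M \<Longrightarrow> exp (M - 2) * (eta ^ DIM('a) * V) \<le> (M - c0 + 1) ^ DIM('a) \<Longrightarrow> M \<le> B"
    using exp_power_bound[OF V] by metis
  define m where "m = c0 - (B - c0 + 1) / eta"
  obtain R where R: "0 < R"
    "\<And>phi x. ereal_concave phi \<Longrightarrow> (\<And>y. phi y \<noteq> \<infinity>) \<Longrightarrow> \<forall>y\<in>cball c rho. ereal m \<le> phi y \<Longrightarrow> mass phi \<le> 1 \<Longrightarrow>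
      ereal (m - 1) \<le> phi x \<Longrightarrow> norm (x - c) < R"
    using superlevel_radius[OF assms(1)] by metis
  show thesis
  proof (rule that[of m "B + 1" "1 / R"])
    fix Q phi assume Q: "prob_distribution Q" and spread: "spread Q c rho eta" and phi: "proper Q phi"
      and mass: "mass phi \<le> 1" and c0: "c0 \<le> mean Q phi"
    have Phi: "phi \<in> Phi_class" using phi by (simp add: proper_def)
    note conc = Phi_classD(2)[OF Phi] and fin = Phi_classD(1)[OF Phi]
    have eta: "0 < eta" "eta \<le> 1" using assms(2) spread_le_1[OF Q spread] by auto
    obtain M0 where M0: "\<And>x. phi x \<le> ereal M0" using Phi_class_bounded_above[OF Phi] by auto
    define S where "S = {s. \<exists>x. ereal s \<le> phi x}"
    have S: "S \<noteq> {}" "bdd_above S"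
    proof -
      have "ereal (M0 - (M0 - mean Q phi + 1) / eta) \<le> phi c"
        using superlevel_contains_ball[OF Q spread phi M0] assms by auto
      then show "S \<noteq> {}" by (auto simp: S_def)
      show "bdd_above S" unfolding S_def
        using M0 by (intro bdd_aboveI[of _ M0]) (auto, meson ereal_less_eq(3) order_trans)
    qed
    define M where "M = Sup S"
    have M: "phi x \<le> ereal M" for x
    proof (cases "phi x")
      case (real r)
      then have "r \<in> S" by (auto simp: S_def intro: exI[of _ x])
      then show ?thesis using real cSup_upper[OF _ S(2)] by (simp add: M_def)
    qed (use fin in auto)
    obtain s where "s \<in> S" "M - 1 < s"
      using less_cSupD[OF S(1), of "M - 1"] unfolding M_def by auto
    then obtain x0 where x0: "M - 1 < s" "ereal s \<le> phi x0" unfolding S_def by auto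
    then have x0: "ereal (M - 1) \<le> phi x0"
      by (meson ereal_less_eq(3) less_imp_le order_trans)
    have "c0 \<le> M" using mean_le[OF Q phi M] c0 by simp
    define T where "T = M - c0 + 1"
    have T: "1 \<le> T" using \<open>c0 \<le> M\<close> by (simp add: T_def)
    have low: "ereal (M - T / eta) \<le> phi x" if "x \<in> cball c rho" for x
    proof -
      have "M - T / eta \<le> M - (M - mean Q phi + 1) / eta"
        using c0 eta by (simp add: T_def divide_right_mono)
      then show ?thesis using superlevel_contains_ball[OF Q spread phi M that]
        by (meson ereal_less_eq(3) order_trans)
    qed
    \<comment> \<open>At the factor \<open>eta / T\<close> the drop \<open>T / eta\<close> from \<open>M\<close> to the floor is scaled to one.\<close>
    define sigma where "sigma = eta / T"
    have sigma: "0 < sigma" "sigma \<le> 1" using T eta by (auto simp: sigma_def field_simps)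
    define l where "l = 1 - sigma"
    have "ereal (M - 2) \<le> phi z" if "z \<in> ball (c + l *\<^sub>R (x0 - c)) (sigma * rho)" for z
    proof -
      have "ereal (l * (M - 1) + (1 - l) * (M - T / eta)) \<le> phi z"
        by (rule cone_lower_bound[OF conc x0, of c rho])
          (use low sigma that in \<open>auto simp: l_def dist_commute\<close>)
      moreover have "l * (M - 1) + (1 - l) * (M - T / eta) = M - 2 + sigma"
        using T eta by (simp add: l_def sigma_def field_simps)
      ultimately show ?thesis using sigma by (smt (verit) ereal_less_eq(3) order_trans)
    qed
    then have "ennreal (exp (M - 2) * (unit_ball_vol DIM('a) * (sigma * rho) ^ DIM('a))) \<le> mass phi"
      using fin assms sigma by (intro mass_ge_ball) auto
    also have "\<dots> \<le> ennreal 1" using mass by simp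
    finally have "exp (M - 2) * (unit_ball_vol DIM('a) * (sigma * rho) ^ DIM('a)) \<le> 1"
      by (subst (asm) ennreal_le_iff) auto
    then have "exp (M - 2) * (eta ^ DIM('a) * V) \<le> (M - c0 + 1) ^ DIM('a)"
      using T unfolding sigma_def T_def[symmetric] V_def
      by (simp add: power_mult_distrib power_divide field_simps)
    then have "M \<le> B" using B \<open>c0 \<le> M\<close> by blast
    have m: "\<forall>x\<in>cball c rho. ereal m \<le> phi x"
    proof
      fix x assume "x \<in> cball c rho"
      have "T / eta \<le> (B - c0 + 1) / eta" using \<open>M \<le> B\<close> eta by (simp add: T_def divide_right_mono)
      then have "m \<le> M - T / eta" using \<open>c0 \<le> M\<close> by (simp add: m_def)
      then show "ereal m \<le> phi x" using low[OF \<open>x \<in> cball c rho\<close>] by (meson ereal_less_eq(3) order_trans)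
    qed
    have "ereal m \<le> ereal M" using m M[of c] assms by (metis centre_in_cball less_imp_le order_trans)
    have "phi x \<le> ereal (B + 1 - 1 / R * norm (x - c))" for x
    proof (cases "norm (x - c) < R")
      case True
      then have "norm (x - c) / R \<le> 1" using R(1) by simp
      then have "M \<le> B + 1 - 1 / R * norm (x - c)" using \<open>M \<le> B\<close> by simp
      then show ?thesis using M[of x] by (meson ereal_less_eq(3) order_trans)
    next
      case False
      define D where "D = norm (x - c)"
      have D: "R \<le> D" "0 < D" using False R(1) by (auto simp: D_def)
      \<comment> \<open>The point of the ray at distance \<open>R\<close>: a drop of one over length \<open>R\<close> continues outwards.\<close>
      define z where "z = (1 - R / D) *\<^sub>R c + (R / D) *\<^sub>R x"
      have "z - c = (R / D) *\<^sub>R (x - c)" by (simp add: z_def algebra_simps)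
      then have "norm (z - c) = R" using D R(1) by (simp add: D_def[symmetric])
      then have z: "\<not> ereal (m - 1) \<le> phi z" using R(2)[OF conc fin m mass, of z] by auto
      have "phi x \<le> ereal (m - D / R)"
      proof (rule ccontr)
        assume "\<not> ?thesis"
        then have "ereal (m - D / R) \<le> phi x" by simp
        moreover have "ereal m \<le> phi c" using m assms by auto
        ultimately have "ereal ((1 - R / D) * m + R / D * (m - D / R)) \<le> phi z" unfolding z_def
          using D R(1) by (intro ereal_concaveD[OF conc]) auto
        moreover have "(1 - R / D) * m + R / D * (m - D / R) = m - 1"
          using D R(1) by (simp add: field_simps)
        ultimately show False using z by simp
      qed
      also have "\<dots> \<le> ereal (B + 1 - 1 / R * norm (x - c))"
        using \<open>ereal m \<le> ereal M\<close> \<open>M \<le> B\<close> by (simp add: D_def)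
      finally show ?thesis .
    qed
    then show "tame c rho m (B + 1) (1 / R) phi"
      unfolding tame_def using Phi assms R(1) m by auto
  qed
qed

section \<open>Lipschitz majorants\<close>

lemma nn_integral_homothety:
  fixes f :: "'a::euclidean_space \<Rightarrow> ennreal"
  assumes [measurable]: "f \<in> borel_measurable borel" and l: "0 < l"
  shows "(\<integral>\<^sup>+x. f (c + l *\<^sub>R (x - c)) \<partial>lborel) = ennreal (1 / l ^ DIM('a)) * (\<integral>\<^sup>+x. f x \<partial>lborel)"
proof -
  have "(\<integral>\<^sup>+x. f x \<partial>lborel) =
      (\<integral>\<^sup>+x. f x \<partial>density (distr lborel borel (\<lambda>x. (c - l *\<^sub>R c) + l *\<^sub>R x)) (\<lambda>_. ennreal (\<bar>l\<bar> ^ DIM('a))))"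
    using l lborel_affine[of l "c - l *\<^sub>R c"] by simp
  also have "\<dots> = ennreal (l ^ DIM('a)) * (\<integral>\<^sup>+x. f ((c - l *\<^sub>R c) + l *\<^sub>R x) \<partial>lborel)"
    using l by (simp add: nn_integral_density nn_integral_distr nn_integral_cmult)
  also have "(\<lambda>x. f ((c - l *\<^sub>R c) + l *\<^sub>R x)) = (\<lambda>x. f (c + l *\<^sub>R (x - c)))"
    by (simp add: algebra_simps)
  finally show ?thesis
    using l by (simp add: mult.assoc[symmetric] ennreal_mult'[symmetric])
qed

text \<open>Compare with the function that is constant on unit shells; the volume of a ball grows polynomially.\<close>

lemma exp_norm_integral_finite:
  fixes c :: "'a::euclidean_space"
  assumes b: "0 < b"
  shows "(\<integral>\<^sup>+x. ennreal (exp (- b * norm (x - c))) \<partial>lborel) < \<top>"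
proof -
  define d where "d = DIM('a)"
  define v where "v = unit_ball_vol (real d)"
  have v: "0 \<le> v" by (simp add: v_def)
  define F where "F n x = ennreal (exp (- b * real n)) * indicator (ball c (real n + 1)) x" for n :: nat and x
  have "(\<integral>\<^sup>+x. ennreal (exp (- b * norm (x - c))) \<partial>lborel) \<le> (\<integral>\<^sup>+x. (\<Sum>n. F n x) \<partial>lborel)"
  proof (rule nn_integral_mono)
    fix x :: 'a
    define n where "n = nat \<lfloor>norm (x - c)\<rfloor>"
    have n: "real n \<le> norm (x - c)" "norm (x - c) < real n + 1" by (auto simp: n_def)
    have "ennreal (exp (- b * norm (x - c))) \<le> F n x"
      using n b by (auto simp: F_def dist_norm norm_minus_commute intro!: ennreal_leI)
    also have "F n x \<le> (\<Sum>n. F n x)"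
      using sum_le_suminf[of "\<lambda>n. F n x" "{n}"] by simp
    finally show "ennreal (exp (- b * norm (x - c))) \<le> (\<Sum>n. F n x)" .
  qed
  also have "\<dots> = (\<Sum>n. \<integral>\<^sup>+x. F n x \<partial>lborel)"
    by (intro nn_integral_suminf) (unfold F_def,
      intro borel_measurable_times_ennreal borel_measurable_const borel_measurable_indicator, simp)
  also have "\<dots> = (\<Sum>n. ennreal (exp (- b * real n) * (v * (real n + 1) ^ d)))"
  proof (rule suminf_cong)
    fix n
    have "(\<integral>\<^sup>+x. F n x \<partial>lborel) = ennreal (exp (- b * real n)) * emeasure lborel (ball c (real n + 1))"
      unfolding F_def by (simp add: nn_integral_cmult_indicator)
    also have "\<dots> = ennreal (exp (- b * real n) * (v * (real n + 1) ^ d))"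
      by (simp add: emeasure_ball ennreal_mult v_def d_def)
    finally show "(\<integral>\<^sup>+x. F n x \<partial>lborel) = ennreal (exp (- b * real n) * (v * (real n + 1) ^ d))" .
  qed
  also have "\<dots> < \<top>"
  proof -
    have lim: "filterlim (\<lambda>n. b / 2 * (real n + 1)) at_top sequentially"
      using filterlim_tendsto_pos_mult_at_top[OF tendsto_const _
          filterlim_compose[OF filterlim_real_sequentially filterlim_Suc], of "b / 2"] b
      by (simp add: add.commute)
    have "\<forall>\<^sub>F y in at_top. y ^ d / exp y < (1::real)"
      using tendsto_power_div_exp_0 by (rule order_tendstoD) simp
    then have "\<forall>\<^sub>F n in sequentially. (b / 2 * (real n + 1)) ^ d / exp (b / 2 * (real n + 1)) < 1"
      using lim unfolding filterlim_iff by blast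
    then have "\<forall>\<^sub>F n in sequentially. norm (exp (- b * real n) * (v * (real n + 1) ^ d)) \<le>
        v * (2 / b) ^ d * exp (b / 2) * exp (- (b / 2)) ^ n"
    proof eventually_elim
      case (elim n)
      have "(real n + 1) ^ d = (2 / b) ^ d * (b / 2 * (real n + 1)) ^ d"
      proof -
        have "2 / b * (b / 2 * (real n + 1)) = real n + 1" using b by simp
        then show ?thesis by (metis power_mult_distrib)
      qed
      also have "\<dots> \<le> (2 / b) ^ d * exp (b / 2 * (real n + 1))"
        using elim b by (intro mult_left_mono) auto
      finally have "v * (real n + 1) ^ d \<le> v * ((2 / b) ^ d * exp (b / 2 * (real n + 1)))"
        using v by (rule mult_left_mono)
      then have "exp (- b * real n) * (v * (real n + 1) ^ d) \<le>
          exp (- b * real n) * (v * ((2 / b) ^ d * exp (b / 2 * (real n + 1))))"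
        by (rule mult_left_mono) simp
      also have "\<dots> = v * (2 / b) ^ d * (exp (- b * real n) * exp (b / 2 * (real n + 1)))"
        by simp
      also have "exp (- b * real n) * exp (b / 2 * (real n + 1)) = exp (b / 2) * exp (- (b / 2)) ^ n"
      proof -
        have "- b * real n + b / 2 * (real n + 1) = b / 2 + real n * (- (b / 2))"
          by (simp add: field_simps)
        then show ?thesis by (simp only: exp_add[symmetric] exp_of_nat_mult[symmetric])
      qed
      finally show ?case using v by (simp add: mult.assoc)
    qed
    moreover have "summable (\<lambda>n. v * (2 / b) ^ d * exp (b / 2) * exp (- (b / 2)) ^ n)"
      using b by (intro summable_mult summable_geometric) simp
    ultimately have "summable (\<lambda>n. exp (- b * real n) * (v * (real n + 1) ^ d))"
      by (rule summable_comparison_test_ev)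
    then show ?thesis using v by (subst less_top[symmetric], intro ennreal_suminf_neq_top) auto
  qed
  finally show ?thesis .
qed

lemma coercive_of_envelope:
  fixes c :: "'a::euclidean_space"
  assumes b: "0 < b" and le: "\<And>x. phi x \<le> ereal (a - b * norm (x - c))"
  shows "coercive phi"
  unfolding coercive_def tendsto_MInfty
proof
  fix r :: real
  show "\<forall>\<^sub>F x in at_infinity. phi x < ereal r"
    unfolding eventually_at_infinity
  proof (intro exI allI impI)
    fix x :: 'a assume x: "norm c + (\<bar>a - r\<bar> + 1) / b \<le> norm x"
    have "(\<bar>a - r\<bar> + 1) / b \<le> norm (x - c)" using x norm_triangle_ineq2[of x c] by linarith
    then have "\<bar>a - r\<bar> + 1 \<le> b * norm (x - c)" using b by (simp add: field_simps)
    then have "ereal (a - b * norm (x - c)) < ereal r" by simp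
    with le[of x] show "phi x < ereal r" by (rule le_less_trans)
  qed
qed

lemma real_concave_in_Phi:
  fixes g :: "'a::euclidean_space \<Rightarrow> real"
  assumes cont: "continuous_on UNIV g" and b: "0 < b" and le: "\<And>x. g x \<le> a - b * norm (x - c)"
    and conc: "\<And>x y t. 0 < t \<Longrightarrow> t < 1 \<Longrightarrow> (1 - t) * g x + t * g y \<le> g ((1 - t) *\<^sub>R x + t *\<^sub>R y)"
  shows "(\<lambda>x. ereal (g x)) \<in> Phi_class"
proof -
  have "ereal_concave (\<lambda>x. ereal (g x))"
    unfolding ereal_concave_def using conc by simp
  moreover have "upper_semicont (\<lambda>x. ereal (g x))"
    unfolding upper_semicont_def
  proof
    fix x
    have "((\<lambda>x. ereal (g x)) \<longlongrightarrow> ereal (g x)) (at x)"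
      using cont by (intro tendsto_ereal) (simp add: continuous_on_eq_continuous_at isCont_def)
    then have "Limsup (at x) (\<lambda>x. ereal (g x)) = ereal (g x)"
      by (intro lim_imp_Limsup) auto
    then show "Limsup (at x) (\<lambda>x. ereal (g x)) \<le> ereal (g x)" by simp
  qed
  moreover have "coercive (\<lambda>x. ereal (g x))"
    using le by (intro coercive_of_envelope[OF b, of _ a c]) simp
  ultimately show ?thesis by (simp add: Phi_class_def)
qed

text \<open>The smallest \<open>k\<close>-Lipschitz majorant (a sup-convolution), as a supremum over the hypograph so that it is real.\<close>

definition lipmaj :: "real \<Rightarrow> ('a::euclidean_space \<Rightarrow> ereal) \<Rightarrow> 'a \<Rightarrow> real" where
  "lipmaj k phi x = Sup {s - k * norm (x - y) |s y. ereal s \<le> phi y}"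

context
  fixes c :: "'a::euclidean_space" and rho m a b k :: real and phi :: "'a \<Rightarrow> ereal"
  assumes tame: "tame c rho m a b phi" and k: "b \<le> k"
begin

lemma tame_threshold_le:
  assumes "ereal s \<le> phi y" shows "s - k * norm (x - y) \<le> a - b * norm (x - c) - (k - b) * norm (x - y)"
proof -
  have "ereal s \<le> ereal (a - b * norm (y - c))"
    using assms tame unfolding tame_def by (meson order_trans)
  moreover have "b * norm (x - c) \<le> b * (norm (x - y) + norm (y - c))"
    using tame norm_triangle_ineq[of "x - y" "y - c"] unfolding tame_def by (intro mult_left_mono) auto
  ultimately show ?thesis by (simp add: algebra_simps)
qed

lemma lipmaj_upper:
  assumes "ereal s \<le> phi y" shows "s - k * norm (x - y) \<le> lipmaj k phi x"
  unfolding lipmaj_def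
proof (rule cSup_upper)
  show "bdd_above {s - k * norm (x - y) |s y. ereal s \<le> phi y}"
  proof (rule bdd_aboveI)
    fix z assume "z \<in> {s - k * norm (x - y) |s y. ereal s \<le> phi y}"
    then obtain s y where z: "z = s - k * norm (x - y)" "ereal s \<le> phi y" by auto
    have "0 \<le> (k - b) * norm (x - y)" using k by simp
    then show "z \<le> a - b * norm (x - c)" using tame_threshold_le[OF z(2), of x] z(1) by linarith
  qed
qed (use assms in blast)

lemma lipmaj_least:
  assumes "\<And>s y. ereal s \<le> phi y \<Longrightarrow> s - k * norm (x - y) \<le> B" shows "lipmaj k phi x \<le> B"
  unfolding lipmaj_def
proof (rule cSup_least)
  have "ereal m \<le> phi c" using tame unfolding tame_def by auto
  then show "{s - k * norm (x - y) |s y. ereal s \<le> phi y} \<noteq> {}" by blast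
qed (use assms in blast)

lemma lipmaj_ge: "phi x \<le> ereal (lipmaj k phi x)"
proof (cases "phi x")
  case (real r)
  then show ?thesis using lipmaj_upper[of r x x] by simp
next
  case PInf
  then show ?thesis using tame Phi_classD(1)[of phi x] by (simp add: tame_def)
qed simp

lemma lipmaj_le: "lipmaj k phi x \<le> a - b * norm (x - c)"
proof (rule lipmaj_least)
  fix s y assume "ereal s \<le> phi y"
  moreover have "0 \<le> (k - b) * norm (x - y)" using k by simp
  ultimately show "s - k * norm (x - y) \<le> a - b * norm (x - c)"
    using tame_threshold_le[of s y x] by linarith
qed

lemma lipmaj_lipschitz: "k-lipschitz_on UNIV (lipmaj k phi)"
proof (rule lipschitz_onI)
  show k0: "0 \<le> k" using tame k by (simp add: tame_def)
  have le: "lipmaj k phi x \<le> lipmaj k phi y + k * norm (x - y)" for x y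
  proof (rule lipmaj_least)
    fix s z assume "ereal s \<le> phi z"
    then have "s - k * norm (y - z) \<le> lipmaj k phi y" by (rule lipmaj_upper)
    moreover have "k * norm (y - z) \<le> k * (norm (x - y) + norm (x - z))"
      using k0 norm_triangle_ineq4[of "x - z" "x - y"] by (intro mult_left_mono) auto
    ultimately show "s - k * norm (x - z) \<le> lipmaj k phi y + k * norm (x - y)"
      by (simp add: algebra_simps)
  qed
  show "dist (lipmaj k phi x) (lipmaj k phi y) \<le> k * dist x y" for x y
    using le[of x y] le[of y x] by (simp add: dist_norm norm_minus_commute)
qed

text \<open>Points of the hypograph may be combined convexly; the two suprema are then taken one after the other.\<close>

lemma lipmaj_concave:
  assumes t: "0 < t" "t < 1"
  shows "(1 - t) * lipmaj k phi x + t * lipmaj k phi y \<le> lipmaj k phi ((1 - t) *\<^sub>R x + t *\<^sub>R y)"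
proof -
  let ?z = "(1 - t) *\<^sub>R x + t *\<^sub>R y"
  have k0: "0 \<le> k" using tame k by (simp add: tame_def)
  have conc: "ereal_concave phi" using tame Phi_classD by (auto simp: tame_def)
  have 1: "(1 - t) * (s - k * norm (x - p)) + t * (r - k * norm (y - q)) \<le> lipmaj k phi ?z"
    if "ereal s \<le> phi p" "ereal r \<le> phi q" for s p r q
  proof -
    let ?w = "(1 - t) *\<^sub>R p + t *\<^sub>R q"
    have "ereal ((1 - t) * s + t * r) \<le> phi ?w"
      using that t by (intro ereal_concaveD[OF conc]) auto
    then have "(1 - t) * s + t * r - k * norm (?z - ?w) \<le> lipmaj k phi ?z" by (rule lipmaj_upper)
    moreover have "norm (?z - ?w) \<le> (1 - t) * norm (x - p) + t * norm (y - q)"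
    proof -
      have "?z - ?w = (1 - t) *\<^sub>R (x - p) + t *\<^sub>R (y - q)" by (simp add: algebra_simps)
      then show ?thesis using norm_triangle_ineq[of "(1 - t) *\<^sub>R (x - p)" "t *\<^sub>R (y - q)"] t by simp
    qed
    then have "k * norm (?z - ?w) \<le> k * ((1 - t) * norm (x - p) + t * norm (y - q))"
      using k0 by (rule mult_left_mono)
    ultimately show ?thesis by (simp add: algebra_simps)
  qed
  have 2: "(1 - t) * (s - k * norm (x - p)) + t * lipmaj k phi y \<le> lipmaj k phi ?z"
    if sp: "ereal s \<le> phi p" for s p
  proof -
    have "lipmaj k phi y \<le> (lipmaj k phi ?z - (1 - t) * (s - k * norm (x - p))) / t"
    proof (rule lipmaj_least)
      fix r q assume "ereal r \<le> phi q"
      from 1[OF sp this] t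
      show "r - k * norm (y - q) \<le> (lipmaj k phi ?z - (1 - t) * (s - k * norm (x - p))) / t"
        by (subst pos_le_divide_eq) (auto simp: algebra_simps)
    qed
    then show ?thesis using t by (subst (asm) pos_le_divide_eq) (auto simp: algebra_simps)
  qed
  have "lipmaj k phi x \<le> (lipmaj k phi ?z - t * lipmaj k phi y) / (1 - t)"
  proof (rule lipmaj_least)
    fix s p assume "ereal s \<le> phi p"
    from 2[OF this] t
    show "s - k * norm (x - p) \<le> (lipmaj k phi ?z - t * lipmaj k phi y) / (1 - t)"
      by (subst pos_le_divide_eq) (auto simp: algebra_simps)
  qed
  then show ?thesis using t by (subst (asm) pos_le_divide_eq) (auto simp: algebra_simps)
qed

lemma lipmaj_tame: "tame c rho m a b (\<lambda>x. ereal (lipmaj k phi x))"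
proof -
  have "continuous_on UNIV (lipmaj k phi)"
    using lipmaj_lipschitz by (rule lipschitz_on_continuous_on)
  moreover have "0 < b" using tame by (simp add: tame_def)
  ultimately have "(\<lambda>x. ereal (lipmaj k phi x)) \<in> Phi_class"
    using lipmaj_le lipmaj_concave by (intro real_concave_in_Phi[of _ b a c]) auto
  moreover have "ereal m \<le> ereal (lipmaj k phi x)" if "x \<in> cball c rho" for x
    using tame that lipmaj_ge[of x] unfolding tame_def by (meson order_trans)
  ultimately show ?thesis using tame lipmaj_le unfolding tame_def by auto
qed

text \<open>A competitor \<open>y\<close> in the supremum is either within \<open>(1 - l) * rho\<close> of \<open>x\<close>, and then concavity bounds its
  height by the value at the contracted point \<open>c + l *\<^sub>R (x - c)\<close>, or it pays a slope penalty of
  at least \<open>(k - b) * ((1 - l) * rho)\<close> beyond the cone.\<close>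

lemma exp_lipmaj_le:
  assumes l: "0 < l" "l < 1"
  shows "exp (lipmaj k phi x) \<le> exp ((1 / l - 1) * (a - m)) * exp_ereal (phi (c + l *\<^sub>R (x - c))) +
    exp (a - (k - b) * ((1 - l) * rho)) * exp (- b * norm (x - c))" (is "_ \<le> ?A + ?B")
proof -
  have nn: "0 \<le> ?A" "0 < ?B" by auto
  then have pos: "0 < ?A + ?B" by linarith
  let ?p = "c + l *\<^sub>R (x - c)"
  have "lipmaj k phi x \<le> ln (?A + ?B)"
  proof (rule lipmaj_least)
    fix s y assume s: "ereal s \<le> phi y"
    have "exp (s - k * norm (x - y)) \<le> ?A + ?B"
    proof (cases "norm (x - y) \<le> (1 - l) * rho")
      case True
      have conc: "ereal_concave phi" using tame Phi_classD by (auto simp: tame_def)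
      have "dist ?p (c + l *\<^sub>R (y - c)) = norm (l *\<^sub>R (x - y))"
        by (simp add: dist_norm algebra_simps)
      also have "\<dots> \<le> 1 * norm (x - y)" using l by (simp add: mult_left_le_one_le)
      also have "\<dots> \<le> (1 - l) * rho" using True by simp
      finally have "ereal (l * s + (1 - l) * m) \<le> phi ?p"
        using tame l by (intro cone_lower_bound[OF conc s]) (auto simp: tame_def)
      moreover have "phi ?p \<le> ereal (a - b * norm (?p - c))" using tame unfolding tame_def by blast
      ultimately obtain q where q: "phi ?p = ereal q" "l * s + (1 - l) * m \<le> q" "q \<le> a - b * norm (?p - c)"
        by (cases "phi ?p") auto
      moreover have "0 \<le> b * norm (?p - c)" using tame by (simp add: tame_def)
      ultimately have "q \<le> a" by linarith
      have "s \<le> (q - (1 - l) * m) / l" using q(2) l by (simp add: field_simps)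
      also have "\<dots> = q + (1 / l - 1) * (q - m)" using l by (simp add: field_simps)
      also have "\<dots> \<le> q + (1 / l - 1) * (a - m)" using \<open>q \<le> a\<close> l
        by (intro add_left_mono mult_left_mono) auto
      finally have "exp s \<le> exp ((1 / l - 1) * (a - m)) * exp q"
        by (simp add: exp_add[symmetric] add.commute)
      moreover have "0 \<le> k * norm (x - y)" using tame k by (simp add: tame_def)
      then have "exp (s - k * norm (x - y)) \<le> exp s" by simp
      ultimately have "exp (s - k * norm (x - y)) \<le> ?A"
        unfolding q(1) exp_ereal_simps by linarith
      then show ?thesis using nn by linarith
    next
      case False
      then have "(k - b) * ((1 - l) * rho) \<le> (k - b) * norm (x - y)"
        using k by (intro mult_left_mono) auto
      then have "s - k * norm (x - y) \<le> a - (k - b) * ((1 - l) * rho) + - b * norm (x - c)"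
        using tame_threshold_le[OF s, of x] by simp
      then have "exp (s - k * norm (x - y)) \<le> ?B" by (simp add: exp_add[symmetric])
      then show ?thesis using nn by linarith
    qed
    then show "s - k * norm (x - y) \<le> ln (?A + ?B)"
      unfolding ln_ge_iff[OF pos] .
  qed
  then show ?thesis unfolding ln_ge_iff[OF pos] .
qed

lemma mass_lipmaj_le:
  assumes l: "0 < l" "l < 1"
  shows "mass (\<lambda>x. ereal (lipmaj k phi x)) \<le>
    ennreal (exp ((1 / l - 1) * (a - m)) * (1 / l ^ DIM('a))) * mass phi +
    ennreal (exp (a - (k - b) * ((1 - l) * rho))) * (\<integral>\<^sup>+x. ennreal (exp (- b * norm (x - c))) \<partial>lborel)"
proof -
  have [measurable]: "phi \<in> borel_measurable borel"
    using tame Phi_class_measurable by (auto simp: tame_def)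
  have "mass (\<lambda>x. ereal (lipmaj k phi x)) \<le>
    (\<integral>\<^sup>+x. ennreal (exp ((1 / l - 1) * (a - m))) * ennreal (exp_ereal (phi (c + l *\<^sub>R (x - c)))) +
      ennreal (exp (a - (k - b) * ((1 - l) * rho))) * ennreal (exp (- b * norm (x - c))) \<partial>lborel)"
    unfolding mass_def using exp_lipmaj_le[OF l]
    by (intro nn_integral_mono) (simp flip: ennreal_mult ennreal_plus)
  also have "\<dots> = ennreal (exp ((1 / l - 1) * (a - m))) * (\<integral>\<^sup>+x. ennreal (exp_ereal (phi (c + l *\<^sub>R (x - c)))) \<partial>lborel) +
      ennreal (exp (a - (k - b) * ((1 - l) * rho))) * (\<integral>\<^sup>+x. ennreal (exp (- b * norm (x - c))) \<partial>lborel)"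
    by (subst nn_integral_add) (auto simp: nn_integral_cmult)
  also have "(\<integral>\<^sup>+x. ennreal (exp_ereal (phi (c + l *\<^sub>R (x - c)))) \<partial>lborel) = ennreal (1 / l ^ DIM('a)) * mass phi"
    unfolding mass_def using l by (subst nn_integral_homothety[where f = "\<lambda>x. ennreal (exp_ereal (phi x))"]) auto
  also have "ennreal (exp ((1 / l - 1) * (a - m))) * (ennreal (1 / l ^ DIM('a)) * mass phi) =
      ennreal (exp ((1 / l - 1) * (a - m)) * (1 / l ^ DIM('a))) * mass phi"
    using l by (subst ennreal_mult) (simp_all add: mult.assoc)
  finally show ?thesis .
qed

end

definition dist1 :: "('a::euclidean_space \<Rightarrow> ereal) \<Rightarrow> ('a \<Rightarrow> ereal) \<Rightarrow> ennreal" where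
  "dist1 phi theta = (\<integral>\<^sup>+x. ennreal \<bar>exp_ereal (phi x) - exp_ereal (theta x)\<bar> \<partial>lborel)"

lemma dist1_majorant:
  assumes [measurable]: "phi \<in> borel_measurable borel" "theta \<in> borel_measurable borel"
    and le: "\<And>x. phi x \<le> theta x" "\<And>x. theta x \<noteq> \<infinity>" and fin: "mass phi < \<top>" and m: "mass theta \<le> mass phi + e"
  shows "dist1 theta phi \<le> e"
proof -
  have "mass phi + dist1 theta phi = mass theta"
    unfolding mass_def dist1_def using exp_ereal_mono[OF le]
    by (subst nn_integral_add[symmetric]) (auto intro!: nn_integral_cong simp flip: ennreal_plus)
  then have "mass phi + dist1 theta phi \<le> mass phi + e" using m by simp
  then show ?thesis using fin by (auto simp: ennreal_add_left_cancel_le)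
qed

text \<open>First \<open>l\<close> is taken close to one, which makes the first factor in \<open>mass_lipmaj_le\<close> close to one, and then \<open>k\<close> large.\<close>

lemma lipmaj_uniform:
  fixes c :: "'a::euclidean_space"
  assumes eps: "0 < eps"
  obtains k where "b \<le> k"
    "\<And>phi. tame c rho m a b phi \<Longrightarrow> mass phi \<le> 1 \<Longrightarrow> mass (\<lambda>x. ereal (lipmaj k phi x)) \<le> mass phi + ennreal eps"
    "\<And>phi. tame c rho m a b phi \<Longrightarrow> mass phi \<le> 1 \<Longrightarrow> dist1 (\<lambda>x. ereal (lipmaj k phi x)) phi \<le> ennreal eps"
proof (cases "0 < b \<and> 0 < rho")
  case False
  then show ?thesis using that[of b] by (auto simp: tame_def)
next
  case True
  then have b: "0 < b" "0 < rho" by auto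
  define I where "I = enn2real (\<integral>\<^sup>+x. ennreal (exp (- b * norm (x - c))) \<partial>lborel)"
  have I: "(\<integral>\<^sup>+x. ennreal (exp (- b * norm (x - c))) \<partial>lborel) = ennreal I" "0 \<le> I"
    unfolding I_def using exp_norm_integral_finite[OF b(1), of c] by auto
  have "((\<lambda>l. exp ((1 / l - 1) * (a - m)) * (1 / l ^ DIM('a))) \<longlongrightarrow> exp ((1 / 1 - 1) * (a - m)) * (1 / 1 ^ DIM('a))) (at_left (1::real))"
    by (intro tendsto_intros) auto
  then have "\<forall>\<^sub>F l in at_left (1::real). exp ((1 / l - 1) * (a - m)) * (1 / l ^ DIM('a)) < 1 + eps / 2"
    by (rule order_tendstoD) (use eps in auto)
  moreover have "\<forall>\<^sub>F l in at_left (1::real). l \<in> {0<..<1}"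
    by (rule eventually_at_left_real) simp
  ultimately have "\<forall>\<^sub>F l in at_left (1::real). exp ((1 / l - 1) * (a - m)) * (1 / l ^ DIM('a)) < 1 + eps / 2 \<and> l \<in> {0<..<1}"
    by eventually_elim auto
  then obtain l where l: "exp ((1 / l - 1) * (a - m)) * (1 / l ^ DIM('a)) < 1 + eps / 2" "0 < l" "l < 1"
    using eventually_happens'[OF trivial_limit_at_left_real] by fastforce
  define D where "D = (1 - l) * rho"
  have D: "0 < D" using l b by (simp add: D_def)
  \<comment> \<open>Chosen so that the exponent \<open>a - (k - b) * D\<close> is at most \<open>ln (eps / 2 / (I + 1))\<close>.\<close>
  define k where "k = b + (\<bar>a\<bar> + \<bar>ln (eps / 2 / (I + 1))\<bar>) / D"
  have k: "b \<le> k" using D by (simp add: k_def)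
  have "(k - b) * D = \<bar>a\<bar> + \<bar>ln (eps / 2 / (I + 1))\<bar>" using D by (simp add: k_def)
  then have "exp (a - (k - b) * D) \<le> exp (ln (eps / 2 / (I + 1)))" by simp
  also have "\<dots> = eps / 2 / (I + 1)" using eps I by simp
  finally have "exp (a - (k - b) * D) * I \<le> eps / 2 / (I + 1) * I" using I by (intro mult_right_mono) auto
  also have "\<dots> \<le> eps / 2" using eps I by (simp add: field_simps)
  finally have kI: "exp (a - (k - b) * D) * I \<le> eps / 2" .
  have mass_le: "mass (\<lambda>x. ereal (lipmaj k phi x)) \<le> mass phi + ennreal eps"
    if t: "tame c rho m a b phi" and m1: "mass phi \<le> 1" for phi
  proof -
    obtain M where M: "mass phi = ennreal M" "0 \<le> M" "M \<le> 1"
      using m1 by (cases "mass phi") (auto simp: top_unique)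
    have "mass (\<lambda>x. ereal (lipmaj k phi x)) \<le>
        ennreal (exp ((1 / l - 1) * (a - m)) * (1 / l ^ DIM('a))) * ennreal M + ennreal (exp (a - (k - b) * D)) * ennreal I"
      using mass_lipmaj_le[OF t k l(2,3)] unfolding D_def I(1) M(1) .
    also have "\<dots> = ennreal (exp ((1 / l - 1) * (a - m)) * (1 / l ^ DIM('a)) * M + exp (a - (k - b) * D) * I)"
      using M I l by (simp flip: ennreal_mult ennreal_plus)
    also have "\<dots> \<le> ennreal (M + eps)"
    proof (rule ennreal_leI)
      have "exp ((1 / l - 1) * (a - m)) * (1 / l ^ DIM('a)) * M \<le> (1 + eps / 2) * M"
        using l M by (intro mult_right_mono) auto
      also have "\<dots> \<le> M + eps / 2" using M eps by (simp add: algebra_simps mult_left_le)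
      finally show "exp ((1 / l - 1) * (a - m)) * (1 / l ^ DIM('a)) * M + exp (a - (k - b) * D) * I \<le> M + eps"
        using kI by simp
    qed
    finally show ?thesis using M eps by simp
  qed
  moreover have "dist1 (\<lambda>x. ereal (lipmaj k phi x)) phi \<le> ennreal eps"
    if t: "tame c rho m a b phi" and m1: "mass phi \<le> 1" for phi
  proof (rule dist1_majorant)
    show "phi \<in> borel_measurable borel" "(\<lambda>x. ereal (lipmaj k phi x)) \<in> borel_measurable borel"
      using t lipmaj_tame[OF t k] Phi_class_measurable by (auto simp: tame_def)
    show "phi x \<le> ereal (lipmaj k phi x)" for x using t k by (rule lipmaj_ge)
    show "mass phi < \<top>" using m1 le_less_trans by fastforce
  qed (use mass_le t m1 in auto)
  ultimately show ?thesis using that[OF k] by blast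
qed

section \<open>Distances and spread of distributions\<close>

text \<open>The part of the Kantorovich duality that the proof needs: closeness as seen by Lipschitz functions.\<close>

definition lip_close :: "'a::euclidean_space measure \<Rightarrow> 'a measure \<Rightarrow> real \<Rightarrow> bool" where
  "lip_close Q Q' e \<longleftrightarrow>
    (\<forall>k g. 0 \<le> k \<longrightarrow> k-lipschitz_on UNIV g \<longrightarrow> \<bar>(\<integral>x. g x \<partial>Q) - (\<integral>x. g x \<partial>Q')\<bar> \<le> k * e)"

lemma lip_close_refl: "0 \<le> e \<Longrightarrow> lip_close Q Q e"
  by (simp add: lip_close_def)

lemma lip_close_sym: "lip_close Q Q' e \<Longrightarrow> lip_close Q' Q e"
  by (simp add: lip_close_def abs_minus_commute)

lemma Q1_classD:
  assumes "Q \<in> Q1_class"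
  shows "prob_distribution Q" "integrable Q norm"
  using assms by (auto simp: Q1_class_def)

lemma lipschitz_measurable:
  fixes g :: "'a::euclidean_space \<Rightarrow> real"
  assumes "k-lipschitz_on UNIV g" shows "g \<in> borel_measurable borel"
  using lipschitz_on_continuous_on[OF assms] by (rule borel_measurable_continuous_onI)

lemma lipschitz_integrable:
  fixes g :: "'a::euclidean_space \<Rightarrow> real"
  assumes Q: "Q \<in> Q1_class" and g: "k-lipschitz_on UNIV g"
  shows "integrable Q g"
proof -
  interpret prob_space Q using Q1_classD(1)[OF Q] by (rule prob_distributionD)
  show ?thesis
  proof (rule Bochner_Integration.integrable_bound)
    show "integrable Q (\<lambda>x. \<bar>g 0\<bar> + k * norm x)" using Q1_classD(2)[OF Q] by simp
    show "g \<in> borel_measurable Q"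
      using lipschitz_measurable[OF g] by (simp add: prob_distribution_measurable[OF Q1_classD(1)[OF Q]])
    show "AE x in Q. norm (g x) \<le> norm (\<bar>g 0\<bar> + k * norm x)"
    proof (rule AE_I2)
      fix x
      have "\<bar>g x - g 0\<bar> \<le> k * norm x" using lipschitz_onD[OF g, of x 0] by (simp add: dist_norm)
      then show "norm (g x) \<le> norm (\<bar>g 0\<bar> + k * norm x)" by simp
    qed
  qed
qed

lemma mallows_lip_close:
  assumes Q: "Q \<in> Q1_class" "Q' \<in> Q1_class" and lt: "mallows_dist Q Q' < ennreal e"
  shows "lip_close Q Q' e"
  unfolding lip_close_def
proof (intro allI impI)
  fix k :: real and g :: "'a \<Rightarrow> real" assume k: "0 \<le> k" and g: "k-lipschitz_on UNIV g"
  obtain M :: "('a \<times> 'a) measure" and X X' where X: "X \<in> borel_measurable M" "X' \<in> borel_measurable M"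
    and d: "distr M borel X = Q" "distr M borel X' = Q'"
    and lt: "(\<integral>\<^sup>+ w. ennreal (norm (X w - X' w)) \<partial>M) < ennreal e"
    using lt unfolding mallows_dist_def Inf_less_iff by auto
  have e: "0 < e" using lt by (metis ennreal_eq_0_iff not_le not_less_zero)
  note [measurable] = X lipschitz_measurable[OF g]
  have gi: "integrable M (\<lambda>w. g (X w))" "integrable M (\<lambda>w. g (X' w))"
    using lipschitz_integrable[OF Q(1) g] lipschitz_integrable[OF Q(2) g]
    unfolding d[symmetric] by (simp_all add: integrable_distr_eq)
  have i: "(\<integral>x. g x \<partial>Q) = (\<integral>w. g (X w) \<partial>M)" "(\<integral>x. g x \<partial>Q') = (\<integral>w. g (X' w) \<partial>M)"
    unfolding d[symmetric] by (simp_all add: integral_distr)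
  have "(\<integral>x. g x \<partial>Q) - (\<integral>x. g x \<partial>Q') = (\<integral>w. g (X w) - g (X' w) \<partial>M)"
    unfolding i using gi by simp
  then have "\<bar>(\<integral>x. g x \<partial>Q) - (\<integral>x. g x \<partial>Q')\<bar> \<le> (\<integral>w. \<bar>g (X w) - g (X' w)\<bar> \<partial>M)"
    using integral_abs_bound by metis
  then have "ennreal \<bar>(\<integral>x. g x \<partial>Q) - (\<integral>x. g x \<partial>Q')\<bar> \<le> ennreal (\<integral>w. \<bar>g (X w) - g (X' w)\<bar> \<partial>M)"
    by (rule ennreal_leI)
  also have "\<dots> = (\<integral>\<^sup>+w. ennreal \<bar>g (X w) - g (X' w)\<bar> \<partial>M)"
    using gi by (intro nn_integral_eq_integral[symmetric]) auto
  also have "\<dots> \<le> (\<integral>\<^sup>+w. ennreal k * ennreal (norm (X w - X' w)) \<partial>M)"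
  proof (rule nn_integral_mono)
    fix w show "ennreal \<bar>g (X w) - g (X' w)\<bar> \<le> ennreal k * ennreal (norm (X w - X' w))"
      using lipschitz_onD[OF g, of "X w" "X' w"] k by (simp add: dist_norm flip: ennreal_mult)
  qed
  also have "\<dots> = ennreal k * (\<integral>\<^sup>+w. ennreal (norm (X w - X' w)) \<partial>M)"
    by (rule nn_integral_cmult) measurable
  also have "\<dots> \<le> ennreal k * ennreal e" using lt by (intro mult_left_mono) auto
  also have "\<dots> = ennreal (k * e)" using k e by (simp add: ennreal_mult)
  finally show "\<bar>(\<integral>x. g x \<partial>Q) - (\<integral>x. g x \<partial>Q')\<bar> \<le> k * e"
    using k e by (subst (asm) ennreal_le_iff) auto
qed

text \<open>A half-space of mass zero would confine the convex support to its complement.\<close>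

lemma Qo_class_halfspaces:
  fixes Q :: "'a::euclidean_space measure"
  assumes "Q \<in> Qo_class"
  obtains c r where "0 < r" "\<And>u. norm u = 1 \<Longrightarrow> 0 < measure Q {x. r < u \<bullet> (x - c)}"
proof -
  have Q: "prob_distribution Q" and "interior (csupp Q) \<noteq> {}" using assms by (auto simp: Qo_class_def)
  interpret prob_space Q using Q by (rule prob_distributionD)
  note [simp] = prob_distributionD(2,3)[OF Q]
  obtain c e where e: "0 < e" "cball c e \<subseteq> csupp Q"
    using \<open>interior (csupp Q) \<noteq> {}\<close> by (metis ex_in_conv mem_interior_cball)
  show thesis
  proof (rule that[of "e/2" c])
    fix u :: 'a assume u: "norm u = 1"
    define H where "H = {x. e/2 < u \<bullet> (x - c)}"
    have "open H" unfolding H_def by (intro open_Collect_less continuous_intros)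
    have "measure Q H \<noteq> 0"
    proof
      assume "measure Q H = 0"
      then have "measure Q (- H) = 1"
        using prob_compl[of H] \<open>open H\<close> by (simp add: Compl_eq_Diff_UNIV)
      moreover have "closed (- H)" using \<open>open H\<close> by auto
      moreover have "- H = {x. u \<bullet> x \<le> e/2 + u \<bullet> c}" by (auto simp: H_def inner_diff_right not_less)
      then have "convex (- H)" by (simp add: convex_halfspace_le)
      ultimately have "csupp Q \<subseteq> - H" unfolding csupp_def by blast
      moreover have "c + e *\<^sub>R u \<in> cball c e" using u e by (simp add: dist_norm)
      ultimately have "c + e *\<^sub>R u \<in> - H" using e by blast
      moreover have "u \<bullet> u = 1" using u by (simp add: norm_eq_1)
      ultimately show False using e by (simp add: H_def)
    qed
    then show "0 < measure Q {x. e/2 < u \<bullet> (x - c)}" by (simp add: H_def zero_less_measure_iff)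
  qed (use e in simp)
qed

text \<open>The half-space indicators are replaced by Lipschitz ramps \<open>g u\<close>. Their integrals depend
  continuously on the direction \<open>u\<close>, hence are bounded below on the unit sphere, and change little when
  the distribution does.\<close>

lemma spread_stable:
  fixes Q :: "'a::euclidean_space measure"
  assumes Q: "Q \<in> Q1_class" "Q \<in> Qo_class"
  obtains c rho eta delta where "0 < delta" "0 < rho" "0 < eta"
    "\<And>Q'. Q' \<in> Q1_class \<Longrightarrow> lip_close Q Q' delta \<Longrightarrow> spread Q' c rho eta"
proof -
  obtain c r where r: "0 < r" and pos: "\<And>u. norm u = 1 \<Longrightarrow> 0 < measure Q {x. r < u \<bullet> (x - c)}"
    using Qo_class_halfspaces[OF Q(2)] by metis
  define g where "g u x = max 0 (min 1 ((u \<bullet> (x - c) - r/2) / (r/2)))" for u x :: 'a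
  have g01: "0 \<le> g u x" "g u x \<le> 1" for u x by (auto simp: g_def)
  have clip: "\<bar>max 0 (min 1 (p::real)) - max 0 (min 1 q)\<bar> \<le> \<bar>p - q\<bar>" for p q by linarith
  have lip: "(2/r)-lipschitz_on UNIV (g u)" if "norm u = 1" for u
  proof (rule lipschitz_onI)
    fix x y
    have "dist (g u x) (g u y) \<le> \<bar>(u \<bullet> (x - c) - r/2) / (r/2) - (u \<bullet> (y - c) - r/2) / (r/2)\<bar>"
      unfolding g_def dist_real_def by (rule clip)
    also have "(u \<bullet> (x - c) - r/2) / (r/2) - (u \<bullet> (y - c) - r/2) / (r/2) = 2 / r * (u \<bullet> (x - y))"
      using r by (simp add: inner_diff_right field_simps)
    also have "\<bar>2 / r * (u \<bullet> (x - y))\<bar> \<le> 2 / r * dist x y"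
      using Cauchy_Schwarz_ineq2[of u "x - y"] that r
      by (simp add: abs_mult dist_norm divide_right_mono)
    finally show "dist (g u x) (g u y) \<le> 2 / r * dist x y" .
  qed (use r in simp)
  have gi: "integrable Q (g u)" if "norm u = 1" for u
    using lip[OF that] by (rule lipschitz_integrable[OF Q(1)])
  interpret prob_space Q using Q1_classD(1)[OF Q(1)] by (rule prob_distributionD)
  note [simp] = prob_distributionD(2,3)[OF Q1_classD(1)[OF Q(1)]]
  define G where "G u = (\<integral>x. g u x \<partial>Q)" for u
  have ni: "integrable Q (\<lambda>x. norm (x - c))"
    by (rule lipschitz_integrable[OF Q(1), of 1])
      (auto intro!: lipschitz_onI simp: dist_norm, smt (verit) diff_add_cancel norm_triangle_ineq3 add_diff_cancel_right diff_diff_eq2)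
  have "continuous_on (sphere 0 1) G"
  proof (rule lipschitz_on_continuous_on)
    show "(2 / r * (\<integral>x. norm (x - c) \<partial>Q))-lipschitz_on (sphere 0 1) G"
    proof (rule lipschitz_onI)
      fix u v :: 'a assume "u \<in> sphere 0 1" "v \<in> sphere 0 1"
      then have uv: "norm u = 1" "norm v = 1" by auto
      have "dist (G u) (G v) = \<bar>\<integral>x. g u x - g v x \<partial>Q\<bar>"
        using gi uv by (simp add: G_def dist_real_def)
      also have "\<dots> \<le> (\<integral>x. \<bar>g u x - g v x\<bar> \<partial>Q)" by (rule integral_abs_bound)
      also have "\<dots> \<le> (\<integral>x. 2 / r * dist u v * norm (x - c) \<partial>Q)"
      proof (rule integral_mono)
        fix x
        have "\<bar>g u x - g v x\<bar> \<le> \<bar>(u \<bullet> (x - c) - r/2) / (r/2) - (v \<bullet> (x - c) - r/2) / (r/2)\<bar>"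
          unfolding g_def by (rule clip)
        also have "(u \<bullet> (x - c) - r/2) / (r/2) - (v \<bullet> (x - c) - r/2) / (r/2) = 2 / r * ((u - v) \<bullet> (x - c))"
          using r by (simp add: inner_diff_left field_simps)
        also have "\<bar>2 / r * ((u - v) \<bullet> (x - c))\<bar> \<le> 2 / r * (dist u v * norm (x - c))"
          using Cauchy_Schwarz_ineq2[of "u - v" "x - c"] r
          by (simp add: abs_mult dist_norm divide_right_mono)
        finally show "\<bar>g u x - g v x\<bar> \<le> 2 / r * dist u v * norm (x - c)" by simp
      qed (use gi uv ni in auto)
      finally show "dist (G u) (G v) \<le> 2 / r * (\<integral>x. norm (x - c) \<partial>Q) * dist u v"
        by (simp add: mult_ac)
    qed (use r in simp)
  qed
  moreover have "sphere (0::'a) 1 \<noteq> {}" by simp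
  ultimately obtain u0 where u0: "norm u0 = 1" "\<And>u. norm u = 1 \<Longrightarrow> G u0 \<le> G u"
    using continuous_attains_inf[OF compact_sphere, of 0 1 G] by auto
  have "0 < G u0"
  proof -
    let ?H = "{x. r < u0 \<bullet> (x - c)}"
    have "open ?H" by (intro open_Collect_less continuous_intros)
    then have H: "?H \<in> sets Q" by simp
    have "measure Q ?H = (\<integral>x. indicator ?H x \<partial>Q)" using H by simp
    also have "\<dots> \<le> G u0" unfolding G_def
    proof (rule integral_mono)
      show "integrable Q (indicat_real ?H)" using H by (intro integrable_real_indicator) (auto simp: less_top[symmetric])
      fix x show "indicat_real ?H x \<le> g u0 x"
        using r g01[of u0 x] by (auto simp: indicator_def g_def field_simps)
    qed (use gi u0 in auto)
    finally show ?thesis using pos[OF u0(1)] by simp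
  qed
  show thesis
  proof (rule that[of "r * G u0 / 4" "r/2" "G u0 / 2" c])
    fix Q' :: "'a measure" assume Q': "Q' \<in> Q1_class" and cl: "lip_close Q Q' (r * G u0 / 4)"
    interpret Q': prob_space Q' using Q1_classD(1)[OF Q'] by (rule prob_distributionD)
    note [simp] = prob_distributionD(2,3)[OF Q1_classD(1)[OF Q']]
    have "G u0 / 2 \<le> measure Q' {x. r/2 < u \<bullet> (x - c)}" if u: "norm u = 1" for u
    proof -
      let ?H = "{x. r/2 < u \<bullet> (x - c)}"
      have "open ?H" by (intro open_Collect_less continuous_intros)
      then have H: "?H \<in> sets Q'" by simp
      have "\<bar>G u - (\<integral>x. g u x \<partial>Q')\<bar> \<le> 2 / r * (r * G u0 / 4)"
        using cl[unfolded lip_close_def, rule_format, OF _ lip[OF u]] r unfolding G_def by simp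
      also have "\<dots> = G u0 / 2" using r by simp
      finally have "G u0 / 2 \<le> (\<integral>x. g u x \<partial>Q')" using u0(2)[OF u] by linarith
      also have "\<dots> \<le> (\<integral>x. indicator ?H x \<partial>Q')"
      proof (rule integral_mono)
        show "integrable Q' (indicat_real ?H)" using H by (intro integrable_real_indicator) (auto simp: less_top[symmetric])
        show "integrable Q' (g u)" using lip[OF u] by (rule lipschitz_integrable[OF Q'])
        fix x show "g u x \<le> indicat_real ?H x"
          using r g01[of u x] by (auto simp: indicator_def g_def field_simps)
      qed
      finally show ?thesis using H by simp
    qed
    then show "spread Q' c (r/2) (G u0 / 2)" using r \<open>0 < G u0\<close> by (simp add: spread_def)
  qed (use r \<open>0 < G u0\<close> in auto)
qed

lemma spread_Qo_class:
  assumes Q: "prob_distribution Q" and spread: "spread Q c rho eta"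
  shows "Q \<in> Qo_class"
proof -
  interpret prob_space Q using Q by (rule prob_distributionD)
  note [simp] = prob_distributionD(2,3)[OF Q]
  have "cball c rho \<subseteq> csupp Q"
    unfolding csupp_def
  proof (intro subsetI InterI, unfold mem_Collect_eq, elim conjE)
    fix z C assume z: "z \<in> cball c rho" and C: "closed C" "convex C" "measure Q C = 1"
    show "z \<in> C"
    proof (rule ccontr)
      assume "z \<notin> C"
      moreover have "C \<noteq> {}" using C(3) by auto
      ultimately obtain u where u: "norm u = 1" "\<And>x. x \<in> C \<Longrightarrow> u \<bullet> (x - c) \<le> rho"
        using separate_from_ball[OF C(1,2) _ z] by metis
      have "measure Q {x. rho < u \<bullet> (x - c)} \<le> measure Q (- C)"
      proof (rule finite_measure_mono)
        show "{x. rho < u \<bullet> (x - c)} \<subseteq> - C" using u(2) by (auto simp: not_less[symmetric])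
      qed (use C(1) in auto)
      also have "\<dots> = 0" using prob_compl[of C] C by (simp add: Compl_eq_Diff_UNIV)
      finally show False using spread u(1) unfolding spread_def by force
    qed
  qed
  then have "ball c rho \<subseteq> interior (csupp Q)"
    by (meson ball_subset_cball interior_maximal open_ball order_trans)
  moreover have "0 < rho" using spread by (simp add: spread_def)
  ultimately have "interior (csupp Q) \<noteq> {}" by (metis centre_in_ball empty_iff subsetD)
  then show ?thesis using Q by (simp add: Qo_class_def)
qed

text \<open>By the Lindelof property the convex support itself has full mass, and a convex set without interior lies in a hyperplane.\<close>

lemma not_Qo_class_hyperplane:
  fixes Q :: "'a::euclidean_space measure"
  assumes Q: "prob_distribution Q" and "Q \<notin> Qo_class"
  obtains u s where "u \<noteq> 0" "AE x in Q. u \<bullet> x = s"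
proof -
  interpret prob_space Q using Q by (rule prob_distributionD)
  note [simp] = prob_distributionD(2,3)[OF Q]
  have int: "interior (csupp Q) = {}" using assms by (simp add: Qo_class_def)
  define F where "F = {- C |C. closed C \<and> convex C \<and> measure Q C = 1}"
  have "\<And>S. S \<in> F \<Longrightarrow> open S" by (auto simp: F_def)
  then obtain F' where F': "F' \<subseteq> F" "countable F'" "\<Union>F' = \<Union>F" using Lindelof by metis
  have "convex (csupp Q)" unfolding csupp_def by (rule convex_Inter) auto
  then obtain u s where u: "u \<noteq> 0" "csupp Q \<subseteq> {x. u \<bullet> x = s}"
    using empty_interior_subset_hyperplane int by metis
  have "AE x in Q. \<forall>S\<in>F'. x \<notin> S"
  proof (rule AE_ball_countable'[OF _ F'(2)])
    fix S assume "S \<in> F'"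
    then obtain C where C: "S = - C" "closed C" "measure Q C = 1" using F'(1) by (auto simp: F_def)
    then have "AE x in Q. x \<in> C" using prob_eq_1[of C] by simp
    then show "AE x in Q. x \<notin> S" using C by simp
  qed
  then have "AE x in Q. u \<bullet> x = s"
  proof eventually_elim
    case (elim x)
    then have "x \<notin> \<Union>F" using F'(3) by auto
    then have "x \<in> csupp Q" unfolding csupp_def F_def by auto
    then show ?case using u by auto
  qed
  with u(1) show thesis by (rule that)
qed

section \<open>Near-maximizers are close to each other\<close>

lemma Phi_class_shift:
  fixes t :: real
  assumes phi: "phi \<in> Phi_class"
  shows "(\<lambda>x. phi x + ereal t) \<in> Phi_class"
proof -
  have ge: "ereal s < phi x + ereal t \<longleftrightarrow> ereal (s - t) < phi x" for s x
    by (cases "phi x") auto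
  have lt: "phi x + ereal t < s \<longleftrightarrow> phi x < s - ereal t" for s x
    by (cases "phi x"; cases s) auto
  have fin: "phi x + ereal t \<noteq> \<infinity>" for x using Phi_classD(1)[OF phi, of x] by simp
  moreover have "ereal_concave (\<lambda>x. phi x + ereal t)"
  proof (rule ereal_concaveI[OF fin])
    fix x y s r and l :: real
    assume "ereal s < phi x + ereal t" "ereal r < phi y + ereal t" and l: "0 < l" "l < 1"
    then have "ereal ((1 - l) * (s - t) + l * (r - t)) \<le> phi ((1 - l) *\<^sub>R x + l *\<^sub>R y)"
      unfolding ge by (intro ereal_concaveD[OF Phi_classD(2)[OF phi]]) auto
    moreover have "(1 - l) * (s - t) + l * (r - t) = (1 - l) * s + l * r - t"
      by (simp add: algebra_simps)
    ultimately show "ereal ((1 - l) * s + l * r) \<le> phi ((1 - l) *\<^sub>R x + l *\<^sub>R y) + ereal t"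
      by (cases "phi ((1 - l) *\<^sub>R x + l *\<^sub>R y)") auto
  qed
  moreover have "upper_semicont (\<lambda>x. phi x + ereal t)"
    using Phi_classD(3)[OF phi] unfolding upper_semicont_iff lt by blast
  moreover have "coercive (\<lambda>x. phi x + ereal t)"
    using Phi_classD(4)[OF phi] unfolding coercive_def tendsto_MInfty lt by simp
  ultimately show ?thesis by (simp add: Phi_class_def)
qed

text \<open>Adding a constant, the functional is largest when the mass is one, by \<open>ln M \<le> M - 1\<close>.\<close>

lemma normalize:
  assumes Q: "prob_distribution Q" and phi: "proper Q phi" and pos: "mass phi \<noteq> 0"
  obtains phi' where "proper Q phi'" "mass phi' = 1" "Lval Q phi \<le> Lval Q phi'" "mass phi \<noteq> 1 \<Longrightarrow> Lval Q phi < Lval Q phi'"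
proof -
  interpret prob_space Q using Q by (rule prob_distributionD)
  have Phi: "phi \<in> Phi_class" using phi by (simp add: proper_def)
  note [measurable] = Phi_class_measurable[OF Phi]
  obtain M where M: "mass phi = ennreal M" "0 < M"
    using phi pos unfolding proper_def by (cases "mass phi") (auto simp: less_le)
  define phi' where "phi' x = phi x + ereal (- ln M)" for x
  have Phi': "phi' \<in> Phi_class" unfolding phi'_def by (rule Phi_class_shift[OF Phi])
  have exp': "exp_ereal (phi' x) = exp_ereal (phi x) / M" for x
    using M Phi_classD(1)[OF Phi, of x] by (cases "phi x") (auto simp: phi'_def exp_diff)
  have mass': "mass phi' = 1"
  proof -
    have "mass phi' = (\<integral>\<^sup>+x. ennreal (1 / M) * ennreal (exp_ereal (phi x)) \<partial>lborel)"
      unfolding mass_def exp' using M(2) by (simp flip: ennreal_mult)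
    also have "\<dots> = ennreal (1 / M) * mass phi" unfolding mass_def by (rule nn_integral_cmult) measurable
    also have "\<dots> = 1" using M by (simp flip: ennreal_mult)
    finally show ?thesis .
  qed
  have ae: "AE x in Q. real_of_ereal (phi' x) = real_of_ereal (phi x) - ln M"
    using phi unfolding proper_def
  proof (elim conjE, elim eventually_mono)
    fix x assume "phi x \<noteq> -\<infinity>"
    then show "real_of_ereal (phi' x) = real_of_ereal (phi x) - ln M"
      using Phi_classD(1)[OF Phi, of x] by (cases "phi x") (auto simp: phi'_def)
  qed
  have meas: "(\<lambda>x. real_of_ereal (phi' x)) \<in> borel_measurable Q"
    using Phi_class_measurable[OF Phi'] by (simp add: prob_distribution_measurable[OF Q])
  have int: "integrable Q (\<lambda>x. real_of_ereal (phi x) - ln M)" using phi by (simp add: proper_def)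
  have "integrable Q (\<lambda>x. real_of_ereal (phi' x))"
    using integrable_cong_AE[OF meas _ ae] int by auto
  moreover have "AE x in Q. phi' x \<noteq> -\<infinity>"
    using phi unfolding proper_def phi'_def by (elim conjE, elim eventually_mono) auto
  ultimately have proper': "proper Q phi'" using Phi' mass' by (simp add: proper_def)
  have "mean Q phi' = (\<integral>x. real_of_ereal (phi x) - ln M \<partial>Q)"
    unfolding mean_def using meas int ae by (intro integral_cong_AE) auto
  also have "\<dots> = mean Q phi - ln M" using phi by (simp add: proper_def mean_def prob_space)
  finally have L': "Lval Q phi' = mean Q phi - ln M" by (simp add: Lval_def mass')
  have L: "Lval Q phi = mean Q phi - M + 1" using M by (simp add: Lval_def)
  show thesis
  proof (rule that[OF proper' mass'])
    show "Lval Q phi \<le> Lval Q phi'" using ln_le_minus_one[OF M(2)] L L' by simp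
    show "Lval Q phi < Lval Q phi'" if "mass phi \<noteq> 1"
    proof -
      have "M \<noteq> 1" using that M(1) by auto
      then have "ln M \<noteq> M - 1" using ln_eq_minus_one[OF M(2)] by auto
      then show ?thesis using ln_le_minus_one[OF M(2)] L L' by simp
    qed
  qed
qed

lemma lipschitz_proper:
  assumes Q: "Q \<in> Q1_class" and "tame c rho m a b (\<lambda>x. ereal (g x))" "k-lipschitz_on UNIV g"
    and "mass (\<lambda>x. ereal (g x)) < \<top>"
  shows "proper Q (\<lambda>x. ereal (g x))"
  using assms lipschitz_integrable[OF Q] by (auto simp: proper_def tame_def)

text \<open>Passing to the majorant raises the integral, and being Lipschitz it lets the distribution be exchanged.\<close>

lemma tame_proper_lipmaj:
  assumes Q: "Q \<in> Q1_class" "Q' \<in> Q1_class" and cl: "lip_close Q Q' e"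
    and t: "tame c rho m a b phi" and k: "b \<le> k" and phi: "proper Q phi"
    and mass: "mass (\<lambda>x. ereal (lipmaj k phi x)) \<le> mass phi + ennreal eps" and eps: "0 \<le> eps"
  shows "proper Q' (\<lambda>x. ereal (lipmaj k phi x))"
    "Lval Q phi - k * e - eps \<le> Lval Q' (\<lambda>x. ereal (lipmaj k phi x))"
proof -
  let ?g = "lipmaj k phi"
  have fin: "mass phi < \<top>" using phi by (simp add: proper_def)
  then have fin': "mass (\<lambda>x. ereal (?g x)) < \<top>"
    using mass by (auto intro: le_less_trans)
  show "proper Q' (\<lambda>x. ereal (?g x))"
    using Q(2) lipmaj_tame[OF t k] lipmaj_lipschitz[OF t k] fin' by (rule lipschitz_proper)
  have k0: "0 \<le> k" using t k by (simp add: tame_def)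
  have "mean Q phi \<le> (\<integral>x. ?g x \<partial>Q)" unfolding mean_def
  proof (rule integral_mono_AE)
    show "integrable Q ?g" using lipmaj_lipschitz[OF t k] by (rule lipschitz_integrable[OF Q(1)])
    show "AE x in Q. real_of_ereal (phi x) \<le> ?g x"
      using phi unfolding proper_def
    proof (elim conjE, elim eventually_mono)
      fix x assume "phi x \<noteq> -\<infinity>"
      then show "real_of_ereal (phi x) \<le> ?g x" using lipmaj_ge[OF t k, of x] by (cases "phi x") auto
    qed
  qed (use phi in \<open>simp add: proper_def\<close>)
  also have "\<dots> \<le> (\<integral>x. ?g x \<partial>Q') + k * e"
    using cl lipmaj_lipschitz[OF t k] k0 unfolding lip_close_def by (smt (verit))
  finally have "mean Q phi \<le> mean Q' (\<lambda>x. ereal (?g x)) + k * e" by (simp add: mean_def)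
  moreover have "enn2real (mass (\<lambda>x. ereal (?g x))) \<le> enn2real (mass phi) + eps"
  proof -
    have "enn2real (mass (\<lambda>x. ereal (?g x))) \<le> enn2real (mass phi + ennreal eps)"
      using mass fin by (intro enn2real_mono) auto
    also have "\<dots> = enn2real (mass phi) + eps" using fin eps by (subst enn2real_plus) auto
    finally show ?thesis .
  qed
  ultimately show "Lval Q phi - k * e - eps \<le> Lval Q' (\<lambda>x. ereal (?g x))"
    by (simp add: Lval_def)
qed

text \<open>The midpoint of \<open>g\<close> and \<open>h\<close> cannot beat the supremum, which bounds the squared Hellinger distance of
  their exponentials by \<open>2 * t\<close>. Young's inequality with parameter \<open>delta\<close> passes to the \<open>L\<^sup>1\<close> distance.
  Restricting to Lipschitz functions makes every integral finite and the midpoint admissible.\<close>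

lemma dist1_hellinger:
  fixes g h :: "'a::euclidean_space \<Rightarrow> real"
  assumes Q: "Q \<in> Q1_class"
    and g: "tame c rho m a b (\<lambda>x. ereal (g x))" "k-lipschitz_on UNIV g" "mass (\<lambda>x. ereal (g x)) \<le> 2"
    and h: "tame c rho m a b (\<lambda>x. ereal (h x))" "k-lipschitz_on UNIV h" "mass (\<lambda>x. ereal (h x)) \<le> 2"
    and K: "L_sup Q \<le> ereal K" and near: "K - t \<le> Lval Q (\<lambda>x. ereal (g x))" "K - t \<le> Lval Q (\<lambda>x. ereal (h x))"
    and delta: "0 < delta"
  shows "dist1 (\<lambda>x. ereal (g x)) (\<lambda>x. ereal (h x)) \<le> ennreal (t / delta + 4 * delta)"
proof -
  have Qp: "prob_distribution Q" using Q by (rule Q1_classD)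
  note [measurable] = lipschitz_measurable[OF g(2)] lipschitz_measurable[OF h(2)]
  define mu where "mu x = (g x + h x) / 2" for x
  define H where "H x = (exp (g x / 2) - exp (h x / 2))\<^sup>2" for x
  have [measurable]: "H \<in> borel_measurable borel" "mu \<in> borel_measurable borel"
    unfolding H_def mu_def by measurable
  have int: "integrable lborel (\<lambda>x. exp (g x))" "integrable lborel (\<lambda>x. exp (h x))"
    using g(3) h(3) by (auto intro!: integrableI_bounded simp: mass_def intro: le_less_trans)
  have H0: "0 \<le> H x" for x by (simp add: H_def)
  have intH: "integrable lborel H"
  proof (rule Bochner_Integration.integrable_bound)
    show "integrable lborel (\<lambda>x. exp (g x) + exp (h x))" using int by simp
    show "AE x in lborel. norm (H x) \<le> norm (exp (g x) + exp (h x))"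
    proof (rule AE_I2)
      fix x
      have "exp (g x) = (exp (g x / 2))\<^sup>2" "exp (h x) = (exp (h x / 2))\<^sup>2"
        by (simp_all flip: exp_double)
      then have "H x \<le> exp (g x) + exp (h x)" by (simp add: H_def power2_diff)
      moreover have "0 \<le> H x" by (simp add: H_def)
      ultimately show "norm (H x) \<le> norm (exp (g x) + exp (h x))" by simp
    qed
  qed simp
  have expmu: "exp (mu x) = (exp (g x) + exp (h x) - H x) / 2" for x
  proof -
    have "exp (g x) = (exp (g x / 2))\<^sup>2" "exp (h x) = (exp (h x / 2))\<^sup>2"
      by (simp_all flip: exp_double)
    moreover have "exp (mu x) = exp (g x / 2) * exp (h x / 2)"
      by (simp add: mu_def add_divide_distrib flip: exp_add)
    ultimately show ?thesis by (simp add: H_def power2_diff)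
  qed
  have intmu: "integrable lborel (\<lambda>x. exp (mu x))" unfolding expmu using int intH by simp
  have mass_eq: "enn2real (mass (\<lambda>x. ereal (f x))) = (\<integral>x. exp (f x) \<partial>lborel)" "mass (\<lambda>x. ereal (f x)) < \<top>"
    if "integrable lborel (\<lambda>x. exp (f x))" for f :: "'a \<Rightarrow> real"
    using that by (auto simp: mass_def nn_integral_eq_integral)
  have gp: "proper Q (\<lambda>x. ereal (g x))" using Q g(1,2) mass_eq(2)[OF int(1)] by (rule lipschitz_proper)
  have hp: "proper Q (\<lambda>x. ereal (h x))" using Q h(1,2) mass_eq(2)[OF int(2)] by (rule lipschitz_proper)
  have mup: "proper Q (\<lambda>x. ereal (mu x))"
  proof -
    have "(\<lambda>x. ereal (mu x)) \<in> Phi_class"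
    proof (rule real_concave_in_Phi)
      show "continuous_on UNIV mu" unfolding mu_def
        using lipschitz_on_continuous_on[OF g(2)] lipschitz_on_continuous_on[OF h(2)]
        by (intro continuous_intros) auto
      show "0 < b" using g(1) by (simp add: tame_def)
      show "mu x \<le> a - b * norm (x - c)" for x
      proof -
        have "g x \<le> a - b * norm (x - c)" "h x \<le> a - b * norm (x - c)"
          using g(1) h(1) by (auto simp: tame_def)
        then show ?thesis by (simp add: mu_def)
      qed
      fix x y :: 'a and l :: real assume l: "0 < l" "l < 1"
      have conc: "(1 - l) * f x + l * f y \<le> f ((1 - l) *\<^sub>R x + l *\<^sub>R y)"
        if "tame c rho m a b (\<lambda>x. ereal (f x))" for f
      proof -
        have "ereal_concave (\<lambda>x. ereal (f x))" using that Phi_classD by (auto simp: tame_def)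
        then show ?thesis using ereal_concaveD[of "\<lambda>x. ereal (f x)" "f x" x "f y" y l] l by simp
      qed
      from conc[OF g(1)] conc[OF h(1)]
      show "(1 - l) * mu x + l * mu y \<le> mu ((1 - l) *\<^sub>R x + l *\<^sub>R y)"
        by (simp add: mu_def field_simps)
    qed
    then show ?thesis
      using gp hp mass_eq(2)[OF intmu] by (simp add: proper_def mu_def)
  qed
  have "ereal (Lval Q (\<lambda>x. ereal (mu x))) \<le> ereal K"
    using L_sup_ge[OF Qp mup] K by (rule order_trans)
  then have LK: "Lval Q (\<lambda>x. ereal (mu x)) \<le> K" by simp
  have "mean Q (\<lambda>x. ereal (mu x)) = (mean Q (\<lambda>x. ereal (g x)) + mean Q (\<lambda>x. ereal (h x))) / 2"
    using gp hp by (simp add: mean_def mu_def proper_def)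
  moreover have "(\<integral>x. exp (mu x) \<partial>lborel) = ((\<integral>x. exp (g x) \<partial>lborel) + (\<integral>x. exp (h x) \<partial>lborel) - (\<integral>x. H x \<partial>lborel)) / 2"
    unfolding expmu using int intH by simp
  ultimately have "2 * Lval Q (\<lambda>x. ereal (mu x)) =
      Lval Q (\<lambda>x. ereal (g x)) + Lval Q (\<lambda>x. ereal (h x)) + (\<integral>x. H x \<partial>lborel)"
    unfolding Lval_def mass_eq(1)[OF intmu] mass_eq(1)[OF int(1)] mass_eq(1)[OF int(2)]
    by (simp add: field_simps)
  then have Hle: "(\<integral>x. H x \<partial>lborel) \<le> 2 * t" using LK near by linarith
  have mle: "(\<integral>x. exp (g x) \<partial>lborel) \<le> 2" "(\<integral>x. exp (h x) \<partial>lborel) \<le> 2"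
    using g(3) h(3) mass_eq(1)[OF int(1)] mass_eq(1)[OF int(2)]
    by (metis enn2real_leI enn2real_mono enn2real_numeral ennreal_numeral_less_top infinity_ennreal_def)+
  have young: "(A - delta * B)\<^sup>2 / (2 * delta) = A\<^sup>2 / (2 * delta) + delta / 2 * B\<^sup>2 - A * B" for A B
    using delta by (simp add: power2_eq_square field_simps)
  have pt: "\<bar>exp (g x) - exp (h x)\<bar> \<le> H x / (2 * delta) + delta * (exp (g x) + exp (h x))" for x
  proof -
    define p q where "p = exp (g x / 2)" and "q = exp (h x / 2)"
    have pq: "0 < p" "0 < q" "exp (g x) = p\<^sup>2" "exp (h x) = q\<^sup>2"
      by (simp_all add: p_def q_def flip: exp_double)
    have "\<bar>p\<^sup>2 - q\<^sup>2\<bar> = \<bar>p - q\<bar> * (p + q)"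
      using pq by (simp add: power2_eq_square square_diff_square_factored abs_mult mult.commute)
    also have "\<dots> \<le> \<bar>p - q\<bar>\<^sup>2 / (2 * delta) + delta / 2 * (p + q)\<^sup>2"
    proof -
      have "0 \<le> (\<bar>p - q\<bar> - delta * (p + q))\<^sup>2 / (2 * delta)" using delta by simp
      also have "\<dots> = \<bar>p - q\<bar>\<^sup>2 / (2 * delta) + delta / 2 * (p + q)\<^sup>2 - \<bar>p - q\<bar> * (p + q)"
        using young[of "\<bar>p - q\<bar>" "p + q"] .
      finally show ?thesis by simp
    qed
    also have "(p + q)\<^sup>2 \<le> 2 * (p\<^sup>2 + q\<^sup>2)"
      using sum_squares_bound[of p q] by (simp add: power2_sum)
    then have "delta / 2 * (p + q)\<^sup>2 \<le> delta * (p\<^sup>2 + q\<^sup>2)"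
      using mult_left_mono[of "(p + q)\<^sup>2" "2 * (p\<^sup>2 + q\<^sup>2)" "delta / 2"] delta by simp
    finally show ?thesis using pq by (simp add: H_def p_def q_def)
  qed
  have "dist1 (\<lambda>x. ereal (g x)) (\<lambda>x. ereal (h x)) = (\<integral>\<^sup>+x. ennreal \<bar>exp (g x) - exp (h x)\<bar> \<partial>lborel)"
    by (simp add: dist1_def)
  also have "\<dots> \<le> (\<integral>\<^sup>+x. ennreal (H x / (2 * delta) + delta * (exp (g x) + exp (h x))) \<partial>lborel)"
    using pt by (intro nn_integral_mono ennreal_leI)
  also have "\<dots> = ennreal (\<integral>x. H x / (2 * delta) + delta * (exp (g x) + exp (h x)) \<partial>lborel)"
    using int intH delta H0 by (intro nn_integral_eq_integral) auto
  also have "(\<integral>x. H x / (2 * delta) + delta * (exp (g x) + exp (h x)) \<partial>lborel) =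
      (\<integral>x. H x \<partial>lborel) / (2 * delta) + delta * ((\<integral>x. exp (g x) \<partial>lborel) + (\<integral>x. exp (h x) \<partial>lborel))"
    using int intH by simp
  also have "ennreal \<dots> \<le> ennreal (t / delta + 4 * delta)"
  proof (rule ennreal_leI)
    have "(\<integral>x. H x \<partial>lborel) / (2 * delta) \<le> 2 * t / (2 * delta)" using Hle delta by (intro divide_right_mono) auto
    moreover have "delta * ((\<integral>x. exp (g x) \<partial>lborel) + (\<integral>x. exp (h x) \<partial>lborel)) \<le> delta * 4"
      using mle delta by (intro mult_left_mono) auto
    ultimately show "(\<integral>x. H x \<partial>lborel) / (2 * delta) + delta * ((\<integral>x. exp (g x) \<partial>lborel) + (\<integral>x. exp (h x) \<partial>lborel)) \<le> t / delta + 4 * delta"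
      by simp
  qed
  finally show ?thesis .
qed

lemma dist1_sym: "dist1 phi theta = dist1 theta phi"
  by (simp add: dist1_def abs_minus_commute)

lemma dist1_triangle:
  assumes [measurable]: "phi \<in> borel_measurable borel" "theta \<in> borel_measurable borel" "zeta \<in> borel_measurable borel"
  shows "dist1 phi zeta \<le> dist1 phi theta + dist1 theta zeta"
  unfolding dist1_def
  by (subst nn_integral_add[symmetric])
    (auto intro!: nn_integral_mono ennreal_leI simp flip: ennreal_plus)

definition near_max :: "'a::euclidean_space measure \<Rightarrow> real \<Rightarrow> real \<Rightarrow> ('a \<Rightarrow> ereal) \<Rightarrow> bool" where
  "near_max Q K delta phi \<longleftrightarrow> proper Q phi \<and> mass phi \<le> 1 \<and> K - delta \<le> Lval Q phi"

text \<open>The two functions may belong to different distributions: both are replaced by Lipschitz majorants,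
  which are near-maximizers for the same distribution and near the originals in mean.\<close>

lemma near_maximizers_close:
  fixes c :: "'a::euclidean_space"
  assumes eps: "0 < eps"
  obtains delta where "0 < delta"
    "\<And>Q Q' K phi theta. Q \<in> Q1_class \<Longrightarrow> Q' \<in> Q1_class \<Longrightarrow> lip_close Q' Q delta \<Longrightarrow> L_sup Q \<le> ereal K \<Longrightarrow>
      tame c rho m a b phi \<Longrightarrow> near_max Q K delta phi \<Longrightarrow>
      tame c rho m a b theta \<Longrightarrow> near_max Q' K delta theta \<Longrightarrow>
      dist1 phi theta \<le> ennreal eps"
proof -
  \<comment> \<open>The majorants cost \<open>eps1\<close> each, together at most half of \<open>eps\<close>; the second bound leaves them within \<open>eps\<^sup>2 / 64\<close> of \<open>K\<close>.\<close>
  define eps1 where "eps1 = min 1 (min (eps / 4) (eps\<^sup>2 / 128))"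
  have eps1: "0 < eps1" "eps1 \<le> 1" "eps1 \<le> eps / 4" "eps1 \<le> eps\<^sup>2 / 128" using eps by (auto simp: eps1_def)
  obtain k where k: "b \<le> k"
    "\<And>phi. tame c rho m a b phi \<Longrightarrow> mass phi \<le> 1 \<Longrightarrow> mass (\<lambda>x. ereal (lipmaj k phi x)) \<le> mass phi + ennreal eps1"
    "\<And>phi. tame c rho m a b phi \<Longrightarrow> mass phi \<le> 1 \<Longrightarrow> dist1 (\<lambda>x. ereal (lipmaj k phi x)) phi \<le> ennreal eps1"
    using lipmaj_uniform[OF eps1(1), of b c rho m a] by metis
  define w where "w = 1 + \<bar>k\<bar>"
  have w: "0 < w" by (simp add: w_def)
  define delta where "delta = eps\<^sup>2 / (128 * w)"
  have delta: "0 < delta" "w * delta = eps\<^sup>2 / 128" using eps w by (auto simp: delta_def)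
  show thesis
  proof (rule that[OF delta(1)])
    fix Q Q' K phi theta
    assume Q: "Q \<in> Q1_class" and Q': "Q' \<in> Q1_class" and cl: "lip_close Q' Q delta" and K: "L_sup Q \<le> ereal K"
      and "tame c rho m a b phi" "near_max Q K delta phi" "tame c rho m a b theta" "near_max Q' K delta theta"
    then have phi: "tame c rho m a b phi" "mass phi \<le> 1" "proper Q phi" "K - delta \<le> Lval Q phi"
      and theta: "tame c rho m a b theta" "mass theta \<le> 1" "proper Q' theta" "K - delta \<le> Lval Q' theta"
      by (auto simp: near_max_def)
    let ?p = "\<lambda>x. ereal (lipmaj k phi x)" and ?t = "\<lambda>x. ereal (lipmaj k theta x)"
    have k0: "0 \<le> k" using phi(1) k(1) by (simp add: tame_def)
    have tt: "tame c rho m a b ?p" "tame c rho m a b ?t" 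
      using lipmaj_tame[OF phi(1) k(1)] lipmaj_tame[OF theta(1) k(1)] .
    have mm: "mass ?p \<le> 2" "mass ?t \<le> 2"
    proof -
      have "mass f + ennreal eps1 \<le> 2" if "mass f \<le> 1" for f :: "'a \<Rightarrow> ereal"
      proof -
        have "mass f + ennreal eps1 \<le> 1 + ennreal 1" using that eps1 by (intro add_mono ennreal_leI) auto
        then show ?thesis by simp
      qed
      then show "mass ?p \<le> 2" "mass ?t \<le> 2" using k(2) phi theta order_trans by blast+
    qed
    define t where "t = eps\<^sup>2 / 64"
    have "0 \<le> k * delta" using k0 delta by simp
    have dk: "delta + k * delta = eps\<^sup>2 / 128" using delta(2) k0 by (simp add: w_def algebra_simps)
    have "Lval Q phi - k * 0 - eps1 \<le> Lval Q ?p"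
      using tame_proper_lipmaj(2)[OF Q Q lip_close_refl[OF order_refl] phi(1) k(1) phi(3) k(2)[OF phi(1,2)]] eps1 by simp
    then have n1: "K - t \<le> Lval Q ?p"
      using phi(4) eps1 dk \<open>0 \<le> k * delta\<close> by (simp add: t_def)
    have "Lval Q' theta - k * delta - eps1 \<le> Lval Q ?t"
      using tame_proper_lipmaj(2)[OF Q' Q cl theta(1) k(1) theta(3) k(2)[OF theta(1,2)]] eps1 by simp
    then have n2: "K - t \<le> Lval Q ?t"
      using theta(4) eps1 dk by (simp add: t_def)
    have meas: "f \<in> borel_measurable borel" if "tame c rho m a b f" for f
      using that Phi_class_measurable by (auto simp: tame_def)
    \<comment> \<open>The parameter \<open>eps / 16\<close> balances the two terms: each becomes \<open>eps / 4\<close>.\<close>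
    have "dist1 ?p ?t \<le> ennreal (t / (eps / 16) + 4 * (eps / 16))"
      by (rule dist1_hellinger[OF Q tt(1) lipmaj_lipschitz[OF phi(1) k(1)] mm(1)
            tt(2) lipmaj_lipschitz[OF theta(1) k(1)] mm(2) K n1 n2]) (use eps in simp)
    also have "t / (eps / 16) + 4 * (eps / 16) = eps / 2" using eps by (simp add: t_def power2_eq_square)
    finally have mid: "dist1 ?p ?t \<le> ennreal (eps / 2)" .
    have "dist1 phi theta \<le> dist1 phi ?p + dist1 ?p theta"
      using meas phi(1) theta(1) tt by (intro dist1_triangle) auto
    also have "\<dots> \<le> dist1 phi ?p + (dist1 ?p ?t + dist1 ?t theta)"
      using meas phi(1) theta(1) tt by (intro add_left_mono dist1_triangle) auto
    also have "\<dots> \<le> ennreal eps1 + (ennreal (eps / 2) + ennreal eps1)"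
      using mid k(3)[OF phi(1,2)] k(3)[OF theta(1,2)] by (intro add_mono) (auto simp: dist1_sym[of phi])
    also have "\<dots> = ennreal (eps1 + (eps / 2 + eps1))" using eps eps1 by (simp flip: ennreal_plus)
    also have "\<dots> \<le> ennreal eps" using eps1 by (intro ennreal_leI) simp
    finally show "dist1 phi theta \<le> ennreal eps" .
  qed
qed

section \<open>From convergence in mean to pointwise convergence\<close>

lemma dist1_ge_ball:
  fixes phi theta :: "'a::euclidean_space \<Rightarrow> ereal"
  assumes le: "\<And>z. z \<in> ball p r \<Longrightarrow> ereal s \<le> phi z" "\<And>z. z \<in> ball p r \<Longrightarrow> theta z \<le> ereal s'"
    and fin: "\<And>z. phi z \<noteq> \<infinity>" and r: "0 \<le> r" and s: "s' \<le> s"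
  shows "ennreal ((exp s - exp s') * (unit_ball_vol DIM('a) * r ^ DIM('a))) \<le> dist1 phi theta"
proof -
  have "ennreal ((exp s - exp s') * (unit_ball_vol DIM('a) * r ^ DIM('a))) =
      ennreal (exp s - exp s') * emeasure lborel (ball p r)"
    using r s by (simp add: emeasure_ball ennreal_mult)
  also have "\<dots> = (\<integral>\<^sup>+x. ennreal (exp s - exp s') * indicator (ball p r) x \<partial>lborel)"
    by (simp add: nn_integral_cmult_indicator)
  also have "\<dots> \<le> dist1 phi theta" unfolding dist1_def
  proof (rule nn_integral_mono)
    fix x show "ennreal (exp s - exp s') * indicator (ball p r) x \<le> ennreal \<bar>exp_ereal (phi x) - exp_ereal (theta x)\<bar>"
    proof (cases "x \<in> ball p r")
      case True
      have "exp s \<le> exp_ereal (phi x)" "exp_ereal (theta x) \<le> exp s'"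
        using exp_ereal_mono[OF le(1)[OF True] fin] exp_ereal_mono[OF le(2)[OF True]] by auto
      then show ?thesis using True s by (auto intro!: ennreal_leI)
    qed simp
  qed
  finally show ?thesis .
qed

text \<open>By \<open>cone_lower_bound\<close> a value \<open>s\<close> at one point forces almost the same value on a whole ball close to it,
  so a function that stays below \<open>s'\<close> there is at a definite \<open>L\<^sup>1\<close> distance.\<close>

lemma nearby_point_transfer:
  fixes x c :: "'a::euclidean_space"
  assumes s: "s' < s" and r: "0 < r" and rho: "0 < rho"
  obtains delta r0 where "0 < delta" "0 < r0"
    "\<And>phi theta x'. tame c rho m a b phi \<Longrightarrow> tame c rho m a b theta \<Longrightarrow> dist1 phi theta \<le> ennreal delta \<Longrightarrow>
      x' \<in> ball x r0 \<Longrightarrow> ereal s \<le> phi x' \<Longrightarrow> \<exists>z\<in>ball x r. ereal s' \<le> theta z"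
proof -
  define s1 where "s1 = (s + s') / 2"
  have s1: "s' < s1" "s1 < s" using s by (auto simp: s1_def)
  have "((\<lambda>l. l * s + (1 - l) * m) \<longlongrightarrow> 1 * s + (1 - 1) * m) (at_left (1::real))"
    by (intro tendsto_intros)
  then have "\<forall>\<^sub>F l in at_left (1::real). s1 < l * s + (1 - l) * m"
    by (rule order_tendstoD) (use s1 in auto)
  moreover have "((\<lambda>l. (1 - l) * (norm (x - c) + rho)) \<longlongrightarrow> (1 - 1) * (norm (x - c) + rho)) (at_left (1::real))"
    by (intro tendsto_intros)
  then have "\<forall>\<^sub>F l in at_left (1::real). (1 - l) * (norm (x - c) + rho) < r"
    by (rule order_tendstoD) (use r in auto)
  moreover have "\<forall>\<^sub>F l in at_left (1::real). l \<in> {0<..<1}"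
    by (rule eventually_at_left_real) simp
  ultimately have "\<forall>\<^sub>F l in at_left (1::real). s1 < l * s + (1 - l) * m \<and>
      (1 - l) * (norm (x - c) + rho) < r \<and> l \<in> {0<..<1}"
    by eventually_elim auto
  then obtain l where l: "s1 < l * s + (1 - l) * m" "(1 - l) * (norm (x - c) + rho) < r" "0 < l" "l < 1"
    using eventually_happens'[OF trivial_limit_at_left_real] by fastforce
  define p where "p = c + l *\<^sub>R (x - c)"
  define r1 where "r1 = (1 - l) * rho / 2"
  have r1: "0 < r1" using l rho by (simp add: r1_def)
  define delta where "delta = (exp s1 - exp s') * (unit_ball_vol DIM('a) * r1 ^ DIM('a)) / 2"
  have delta: "0 < delta" using s1 r1 by (simp add: delta_def)
  have sub: "ball p r1 \<subseteq> ball x r"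
  proof
    fix z assume "z \<in> ball p r1"
    then have "dist p z < (1 - l) * rho" using r1 by (simp add: r1_def)
    moreover have "dist x p = (1 - l) * norm (x - c)"
    proof -
      have "x - p = (1 - l) *\<^sub>R (x - c)" by (simp add: p_def algebra_simps)
      then show ?thesis using l by (simp add: dist_norm)
    qed
    ultimately have "dist x z < (1 - l) * (norm (x - c) + rho)"
      using dist_triangle[of x z p] by (simp add: algebra_simps)
    then show "z \<in> ball x r" using l(2) by simp
  qed
  show thesis
  proof (rule that[OF delta r1])
    fix phi theta x' assume t: "tame c rho m a b phi" "tame c rho m a b theta" and d: "dist1 phi theta \<le> ennreal delta"
      and x': "x' \<in> ball x r1" "ereal s \<le> phi x'"
    have Phi: "phi \<in> Phi_class" "theta \<in> Phi_class" using t by (auto simp: tame_def)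
    show "\<exists>z\<in>ball x r. ereal s' \<le> theta z"
    proof (rule ccontr)
      assume "\<not> ?thesis"
      then have "ennreal ((exp s1 - exp s') * (unit_ball_vol DIM('a) * r1 ^ DIM('a))) \<le> dist1 phi theta"
      proof (intro dist1_ge_ball[of p])
        fix z assume z: "z \<in> ball p r1"
        show "theta z \<le> ereal s'" using z sub \<open>\<not> (\<exists>z\<in>ball x r. ereal s' \<le> theta z)\<close>
          by (meson less_imp_le not_le subsetD)
        have "dist p (c + l *\<^sub>R (x' - c)) = l * dist x x'"
          using l by (simp add: p_def dist_norm scaleR_diff_right[symmetric])
        also have "\<dots> \<le> dist x x'" using l by (simp add: mult_left_le_one_le)
        also have "\<dots> < r1" using x'(1) by simp
        finally have "dist z (c + l *\<^sub>R (x' - c)) \<le> (1 - l) * rho"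
          using z dist_triangle[of z "c + l *\<^sub>R (x' - c)" p] by (simp add: r1_def dist_commute)
        then have "ereal (l * s + (1 - l) * m) \<le> phi z"
          using t(1) l by (intro cone_lower_bound[OF Phi_classD(2)[OF Phi(1)] x'(2)]) (auto simp: tame_def)
        then show "ereal s1 \<le> phi z" using l(1) by (meson ereal_less_eq(3) less_imp_le order_trans)
      qed (use Phi_classD(1)[OF Phi(1)] r1 s1 in auto)
      also have "(exp s1 - exp s') * (unit_ball_vol DIM('a) * r1 ^ DIM('a)) = 2 * delta" by (simp add: delta_def)
      also note d
      finally show False using delta by (simp add: ennreal_le_iff2)
    qed
  qed
qed

text \<open>Values \<open>phi n (x n) \<ge> s\<close> would force \<open>theta\<close> to reach \<open>s' < s\<close> arbitrarily close to \<open>y\<close>, which upper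
  semicontinuity excludes when \<open>theta y < s'\<close>.\<close>

lemma limsup_of_dist1_limit:
  fixes c :: "'a::euclidean_space"
  assumes t: "\<forall>\<^sub>F n in sequentially. tame c rho m a b (phi n)" and t': "tame c rho m a b theta"
    and lim: "(\<lambda>n. dist1 (phi n) theta) \<longlonglongrightarrow> 0" and x: "x \<longlonglongrightarrow> y" and s: "theta y < ereal s"
  shows "\<forall>\<^sub>F n in sequentially. phi n (x n) < ereal s"
proof -
  obtain s' where s': "theta y < ereal s'" "s' < s"
    using ereal_dense2[OF s] by auto
  obtain d where d: "0 < d" "\<And>z. dist z y < d \<Longrightarrow> theta z < ereal s'"
    using t' s'(1) Phi_classD(3) unfolding tame_def upper_semicont_iff by metis
  obtain delta r0 where delta: "0 < delta" "0 < r0"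
    "\<And>phi theta x'. tame c rho m a b phi \<Longrightarrow> tame c rho m a b theta \<Longrightarrow> dist1 phi theta \<le> ennreal delta \<Longrightarrow>
      x' \<in> ball y r0 \<Longrightarrow> ereal s \<le> phi x' \<Longrightarrow> \<exists>z\<in>ball y d. ereal s' \<le> theta z"
    using nearby_point_transfer[OF s'(2) d(1), of rho c m a b y] t' unfolding tame_def by metis
  have "\<forall>\<^sub>F n in sequentially. dist1 (phi n) theta < ennreal delta"
    using lim by (rule order_tendstoD) (use delta in auto)
  moreover have "\<forall>\<^sub>F n in sequentially. dist (x n) y < r0" using x delta(2) by (rule tendstoD)
  ultimately show ?thesis using t
  proof eventually_elim
    case (elim n)
    show ?case
    proof (rule ccontr)
      assume "\<not> ?thesis"
      then have "\<exists>z\<in>ball y d. ereal s' \<le> theta z"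
        using elim by (intro delta(3)[OF elim(3) t', of "x n"]) (auto simp: dist_commute)
      then show False using d(2) by (force simp: dist_commute)
    qed
  qed
qed

lemma dist1_zero_imp_eq:
  assumes t: "tame c rho m a b phi" "tame c rho m a b theta" and z: "dist1 phi theta = 0"
  shows "phi = theta"
proof -
  have le: "f x \<le> g x" if "tame c rho m a b f" "tame c rho m a b g" "dist1 f g = 0" for f g x
  proof (rule dense_ge)
    fix s assume s: "g x < s"
    show "f x \<le> s"
    proof (cases s)
      case (real r)
      then have "\<forall>\<^sub>F n in sequentially. f x < ereal r"
        using limsup_of_dist1_limit[of c rho m a b "\<lambda>_. f" g "\<lambda>_. x" x r] that s by simp
      then show ?thesis using real by simp
    qed (use s in auto)
  qed
  show ?thesis using le[OF t z] le[OF t(2,1)] z by (intro ext antisym) (auto simp: dist1_sym)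
qed

text \<open>Finite concave functions are continuous on open sets.\<close>

lemma concave_lower_near:
  fixes phi :: "'a::euclidean_space \<Rightarrow> ereal"
  assumes Phi: "phi \<in> Phi_class" and y: "y \<in> interior {x. phi x \<noteq> -\<infinity>}" and s: "ereal s < phi y"
  obtains e where "0 < e" "\<And>z. z \<in> ball y e \<Longrightarrow> ereal s < phi z"
proof -
  define S where "S = interior {x. phi x \<noteq> -\<infinity>}"
  define f where "f x = - real_of_ereal (phi x)" for x
  have conv: "convex {x. phi x \<noteq> -\<infinity>}"
  proof (rule convexI)
    fix x z u v assume xz: "x \<in> {x. phi x \<noteq> -\<infinity>}" "z \<in> {x. phi x \<noteq> -\<infinity>}" and uv: "(0::real) \<le> u" "0 \<le> v" "u + v = 1"
    obtain p q where "phi x = ereal p" "phi z = ereal q"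
      using xz Phi_classD(1)[OF Phi, of x] Phi_classD(1)[OF Phi, of z] by (cases "phi x"; cases "phi z") auto
    then have "ereal ((1 - v) * p + v * q) \<le> phi ((1 - v) *\<^sub>R x + v *\<^sub>R z)"
      using uv by (intro ereal_concaveD[OF Phi_classD(2)[OF Phi]]) auto
    moreover have "u = 1 - v" using uv by simp
    ultimately show "u *\<^sub>R x + v *\<^sub>R z \<in> {x. phi x \<noteq> -\<infinity>}" by auto
  qed
  have eq: "phi x = ereal (- f x)" if "x \<in> S" for x
  proof -
    have "phi x \<noteq> -\<infinity>" using that interior_subset unfolding S_def by blast
    then show ?thesis using Phi_classD(1)[OF Phi, of x] by (cases "phi x") (auto simp: f_def)
  qed
  have "convex S" unfolding S_def using conv by (rule convex_interior)
  have "convex_on S f"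
  proof (rule convex_onI[OF _ \<open>convex S\<close>])
    fix t :: real and x z assume t: "0 < t" "t < 1" and xz: "x \<in> S" "z \<in> S"
    have "ereal ((1 - t) * - f x + t * - f z) \<le> phi ((1 - t) *\<^sub>R x + t *\<^sub>R z)"
      using t eq xz by (intro ereal_concaveD[OF Phi_classD(2)[OF Phi]]) auto
    moreover have "(1 - t) *\<^sub>R x + t *\<^sub>R z \<in> S" using xz t by (intro convexD[OF \<open>convex S\<close>]) auto
    ultimately show "f ((1 - t) *\<^sub>R x + t *\<^sub>R z) \<le> (1 - t) * f x + t * f z"
      using eq by simp
  qed
  then have "continuous_on S f" by (intro convex_on_continuous) (simp add: S_def)
  then have "isCont f y" using y by (simp add: S_def continuous_on_eq_continuous_at)
  then have "(f \<longlongrightarrow> f y) (nhds y)" by (simp add: isCont_def tendsto_at_iff_tendsto_nhds)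
  moreover have "f y < - s" using s eq[of y] y by (simp add: S_def)
  ultimately have "\<forall>\<^sub>F z in nhds y. f z < - s" by (rule order_tendstoD)
  moreover have "\<forall>\<^sub>F z in nhds y. z \<in> S"
    using y unfolding S_def by (intro eventually_nhds_in_open) auto
  ultimately have "\<forall>\<^sub>F z in nhds y. ereal s < phi z"
    by eventually_elim (simp add: eq)
  then obtain e where e: "0 < e" "\<And>z. dist z y < e \<Longrightarrow> ereal s < phi z"
    unfolding eventually_nhds_metric by auto
  show thesis using e by (intro that[of e]) (auto simp: dist_commute)
qed

text \<open>If \<open>phi n\<close> is below \<open>s\<close> at \<open>x n\<close>, it is below \<open>s\<close> on a half-space through \<open>x n\<close>, which contains a ball of
  fixed size close to \<open>y\<close>, where the limit function exceeds \<open>s1 > s\<close>.\<close>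

lemma liminf_of_dist1_limit:
  fixes phi :: "nat \<Rightarrow> 'a::euclidean_space \<Rightarrow> ereal"
  assumes t: "\<forall>\<^sub>F n in sequentially. phi n \<in> Phi_class" and t': "theta \<in> Phi_class"
    and lim: "(\<lambda>n. dist1 (phi n) theta) \<longlonglongrightarrow> 0" and x: "x \<longlonglongrightarrow> y"
    and y: "y \<in> interior {x. theta x \<noteq> -\<infinity>}" and s: "ereal s < theta y"
  shows "\<forall>\<^sub>F n in sequentially. ereal s \<le> phi n (x n)"
proof -
  obtain s1 where s1: "s < s1" "ereal s1 < theta y"
    using ereal_dense2[OF s] by auto
  obtain e where e: "0 < e" "\<And>z. z \<in> ball y e \<Longrightarrow> ereal s1 < theta z"
    using concave_lower_near[OF t' y s1(2)] by metis
  define r where "r = e / 2"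
  have r: "0 < r" using e by (simp add: r_def)
  define delta where "delta = (exp s1 - exp s) * (unit_ball_vol DIM('a) * (r/2) ^ DIM('a))"
  have delta: "0 < delta" using s1 r by (simp add: delta_def)
  have "\<forall>\<^sub>F n in sequentially. dist1 (phi n) theta < ennreal delta"
    using lim by (rule order_tendstoD) (use delta in auto)
  moreover have "\<forall>\<^sub>F n in sequentially. dist (x n) y < r" using x r by (rule tendstoD)
  ultimately show ?thesis using t
  proof eventually_elim
    case (elim n)
    show ?case
    proof (rule ccontr)
      assume neg: "\<not> ?thesis"
      define K where "K = {z. ereal s \<le> phi n z}"
      have K: "closed K" "convex K" "x n \<notin> K"
        unfolding K_def using closed_superlevel convex_superlevel Phi_classD[OF elim(3)] neg by auto
      obtain u where u: "norm u = 1" "\<And>z. z \<in> K \<Longrightarrow> u \<bullet> (z - x n) \<le> 0"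
      proof (cases "K = {}")
        case True
        obtain u :: 'a where "norm u = 1" using vector_choose_size[of 1] by auto
        then show thesis using that True by auto
      next
        case False
        then show thesis using separate_from_ball[OF K(1,2) False _ K(3), of "x n" 0] that by auto
      qed
      define p where "p = x n + (r/2) *\<^sub>R u"
      have "ennreal delta \<le> dist1 theta (phi n)" unfolding delta_def
      proof (rule dist1_ge_ball[of p])
        fix z assume z: "z \<in> ball p (r/2)"
        have "dist p (x n) = r/2" using u r by (simp add: p_def dist_norm)
        then have "dist y z < e"
          using z elim(2) dist_triangle[of y z "x n"] dist_triangle[of "x n" z p]
          by (simp add: r_def dist_commute)
        then show "ereal s1 \<le> theta z" using e(2)[of z] by simp
        have "u \<bullet> u = 1" using u(1) by (simp add: norm_eq_1)
        have "\<bar>u \<bullet> (z - p)\<bar> < r/2"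
          using Cauchy_Schwarz_ineq2[of u "z - p"] z u(1) by (simp add: dist_norm norm_minus_commute)
        moreover have "u \<bullet> (z - x n) = u \<bullet> (z - p) + r/2"
          using \<open>u \<bullet> u = 1\<close> by (simp add: p_def inner_diff_right inner_add_right)
        ultimately have "0 < u \<bullet> (z - x n)" by linarith
        then have "z \<notin> K" using u(2)[of z] by auto
        then show "phi n z \<le> ereal s" by (simp add: K_def)
      qed (use Phi_classD(1)[OF t'] r s1 in auto)
      then show False using elim(1) by (simp add: dist1_sym not_less[symmetric])
    qed
  qed
qed

section \<open>Limits of sequences that are Cauchy in mean\<close>

text \<open>The joint upper limit for \<open>n\<close> tending to infinity and \<open>y\<close> tending to \<open>x\<close>, the smallest candidate that is upper semicontinuous.\<close>

definition limit_hull :: "(nat \<Rightarrow> 'a::metric_space \<Rightarrow> ereal) \<Rightarrow> 'a \<Rightarrow> ereal" where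
  "limit_hull phi x = (INF N. SUP n\<in>{N..}. SUP y\<in>ball x (1 / (real N + 1)). phi n y)"

lemma limit_hull_lessD:
  assumes "limit_hull phi x < s"
  obtains N where "\<And>n y. N \<le> n \<Longrightarrow> dist x y < 1 / (real N + 1) \<Longrightarrow> phi n y < s"
    "\<And>y. dist x y < 1 / (2 * real N + 2) \<Longrightarrow> limit_hull phi y < s"
proof -
  obtain N where N: "(SUP n\<in>{N..}. SUP y\<in>ball x (1 / (real N + 1)). phi n y) < s"
    using assms unfolding limit_hull_def INF_less_iff by auto
  show thesis
  proof (rule that[of N])
    fix n y assume "N \<le> n" "dist x y < 1 / (real N + 1)"
    then have "phi n y \<le> (SUP n\<in>{N..}. SUP y\<in>ball x (1 / (real N + 1)). phi n y)"
      by (intro SUP_upper2[of n] SUP_upper) auto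
    then show "phi n y < s" using N by (rule le_less_trans)
  next
    fix y assume y: "dist x y < 1 / (2 * real N + 2)"
    have "limit_hull phi y \<le> (SUP n\<in>{2 * N + 1..}. SUP z\<in>ball y (1 / (real (2 * N + 1) + 1)). phi n z)"
      unfolding limit_hull_def by (intro INF_lower) simp
    also have "\<dots> \<le> (SUP n\<in>{N..}. SUP y\<in>ball x (1 / (real N + 1)). phi n y)"
    proof (intro SUP_subset_mono)
      show "ball y (1 / (real (2 * N + 1) + 1)) \<subseteq> ball x (1 / (real N + 1))"
      proof
        fix z assume "z \<in> ball y (1 / (real (2 * N + 1) + 1))"
        then have "dist y z < 1 / (2 * real N + 2)" by (simp add: add.commute)
        then have "dist x z < 1 / (2 * real N + 2) + 1 / (2 * real N + 2)"
          using y dist_triangle[of x z y] by linarith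
        also have "\<dots> = 1 / (real N + 1)" by (simp add: field_simps)
        finally show "z \<in> ball x (1 / (real N + 1))" by simp
      qed
    qed auto
    finally show "limit_hull phi y < s" using N by (rule le_less_trans)
  qed
qed

lemma less_limit_hullD:
  assumes "s < limit_hull phi x"
  obtains n y where "N \<le> n" "dist x y < 1 / (real N + 1)" "s < phi n y"
proof -
  have "s < (SUP n\<in>{N..}. SUP y\<in>ball x (1 / (real N + 1)). phi n y)"
    using assms unfolding limit_hull_def by (rule less_le_trans) (rule INF_lower, simp)
  then show thesis using that unfolding less_SUP_iff by auto
qed

lemma limit_hull_geI:
  assumes "\<And>N. \<exists>n\<ge>N. \<exists>y. dist x y < 1 / (real N + 1) \<and> s \<le> phi n y"
  shows "s \<le> limit_hull phi x"
  unfolding limit_hull_def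
proof (rule INF_greatest)
  fix N
  obtain n y where "N \<le> n" "dist x y < 1 / (real N + 1)" "s \<le> phi n y" using assms by blast
  then show "s \<le> (SUP n\<in>{N..}. SUP y\<in>ball x (1 / (real N + 1)). phi n y)"
    by (intro SUP_upper2[of n] SUP_upper2[of y]) auto
qed

lemma limit_hull_limsup:
  assumes "limit_hull phi x < s" shows "\<forall>\<^sub>F n in sequentially. phi n x < s"
proof (rule limit_hull_lessD[OF assms])
  fix N assume "\<And>n y. N \<le> n \<Longrightarrow> dist x y < 1 / (real N + 1) \<Longrightarrow> phi n y < s"
  from this[of _ x] show ?thesis unfolding eventually_sequentially by auto
qed

context
  fixes phi :: "nat \<Rightarrow> 'a::euclidean_space \<Rightarrow> ereal" and c rho m a b
  assumes tame: "\<And>n. tame c rho m a b (phi n)"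
    and Cauchy: "\<And>eps. 0 < eps \<Longrightarrow> \<exists>N. \<forall>i\<ge>N. \<forall>j\<ge>N. dist1 (phi i) (phi j) \<le> ennreal eps"
begin

text \<open>An upper limit says something about infinitely many indices only. The Cauchy property transfers
  such values to all late indices, which is what makes the hull concave.\<close>

lemma limit_hull_persistent:
  assumes s: "ereal s < limit_hull phi x" and r: "0 < r"
  shows "\<forall>\<^sub>F n in sequentially. \<exists>z\<in>ball x r. ereal s \<le> phi n z"
proof -
  obtain s1 where s1: "s < s1" "ereal s1 < limit_hull phi x" using ereal_dense2[OF s] by auto
  have "0 < rho" using tame by (auto simp: tame_def)
  obtain delta r0 where delta: "0 < delta" "0 < r0"
    "\<And>f g x'. tame c rho m a b f \<Longrightarrow> tame c rho m a b g \<Longrightarrow> dist1 f g \<le> ennreal delta \<Longrightarrow>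
      x' \<in> ball x r0 \<Longrightarrow> ereal s1 \<le> f x' \<Longrightarrow> \<exists>z\<in>ball x r. ereal s \<le> g z"
    using nearby_point_transfer[OF s1(1) r \<open>0 < rho\<close>, of c m a b x] by metis
  obtain N0 where N0: "\<And>i j. N0 \<le> i \<Longrightarrow> N0 \<le> j \<Longrightarrow> dist1 (phi i) (phi j) \<le> ennreal delta"
    using Cauchy[OF delta(1)] by blast
  obtain N1 where N1: "1 / (real N1 + 1) < r0"
    using reals_Archimedean[OF delta(2)] by (auto simp: inverse_eq_divide add.commute)
  define N where "N = max N0 N1"
  have "1 / (real N + 1) \<le> 1 / (real N1 + 1)" by (intro divide_left_mono) (auto simp: N_def)
  then have N: "1 / (real N + 1) < r0" using N1 by simp
  obtain n x' where n: "N \<le> n" "dist x x' < 1 / (real N + 1)" "ereal s1 < phi n x'"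
    using less_limit_hullD[OF s1(2)] by metis
  have "\<exists>z\<in>ball x r. ereal s \<le> phi j z" if "N \<le> j" for j
    using that n N N0 tame by (intro delta(3)[of "phi n" _ x']) (auto simp: N_def)
  then show ?thesis unfolding eventually_sequentially by blast
qed

text \<open>Concavity: by \<open>limit_hull_persistent\<close> the values at both end points are approached by one and the same late
  member of the sequence, which is concave.\<close>

lemma limit_hull_tame: "tame c rho m a b (limit_hull phi)"
proof -
  have b: "0 < b" and rho: "0 < rho" using tame by (auto simp: tame_def)
  have le: "limit_hull phi x \<le> ereal (a - b * norm (x - c))" for x
  proof (rule ccontr)
    assume "\<not> ?thesis"
    then obtain t where t: "a - b * norm (x - c) < t" "ereal t < limit_hull phi x"
      using ereal_dense2[of "ereal (a - b * norm (x - c))" "limit_hull phi x"] by (auto simp: not_le)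
    have "0 < (t - (a - b * norm (x - c))) / b" using t b by simp
    then obtain N where N: "1 / (real N + 1) < (t - (a - b * norm (x - c))) / b"
      using reals_Archimedean by (auto simp: inverse_eq_divide add.commute)
    obtain n y where y: "dist x y < 1 / (real N + 1)" "ereal t < phi n y"
      using less_limit_hullD[OF t(2), of N] by metis
    have "phi n y \<le> ereal (a - b * norm (y - c))" using tame by (auto simp: tame_def)
    then have "t < a - b * norm (y - c)" using y(2) by (metis less_ereal.simps(1) less_le_trans)
    moreover have "dist x y < (t - (a - b * norm (x - c))) / b" using y N by simp
    then have "b * dist x y < t - (a - b * norm (x - c))" using b by (simp add: pos_less_divide_eq mult.commute)
    moreover have "b * norm (x - c) \<le> b * (dist x y + norm (y - c))"
      using norm_triangle_ineq[of "x - y" "y - c"] b by (intro mult_left_mono) (auto simp: dist_norm)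
    ultimately show False by (simp add: algebra_simps)
  qed
  have fin: "limit_hull phi x \<noteq> \<infinity>" for x using le[of x] by auto
  have ge: "ereal m \<le> limit_hull phi x" if "x \<in> cball c rho" for x
  proof (rule limit_hull_geI)
    fix N :: nat
    have "ereal m \<le> phi N x" using tame that by (auto simp: tame_def)
    then show "\<exists>n\<ge>N. \<exists>y. dist x y < 1 / (real N + 1) \<and> ereal m \<le> phi n y"
      by (intro exI[of _ N] conjI exI[of _ x]) auto
  qed
  have "upper_semicont (limit_hull phi)"
    unfolding upper_semicont_iff
  proof (intro allI impI)
    fix x s assume "limit_hull phi x < s"
    then obtain N where "\<And>y. dist x y < 1 / (2 * real N + 2) \<Longrightarrow> limit_hull phi y < s"
      by (rule limit_hull_lessD) blast
    then show "\<exists>d>0. \<forall>y. dist y x < d \<longrightarrow> limit_hull phi y < s"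
      by (intro exI[of _ "1 / (2 * real N + 2)"]) (auto simp: dist_commute)
  qed
  moreover have "ereal_concave (limit_hull phi)"
  proof (rule ereal_concaveI[OF fin])
    fix x y s r and t :: real
    assume s: "ereal s < limit_hull phi x" and r: "ereal r < limit_hull phi y" and t: "0 < t" "t < 1"
    show "ereal ((1 - t) * s + t * r) \<le> limit_hull phi ((1 - t) *\<^sub>R x + t *\<^sub>R y)"
    proof (rule limit_hull_geI)
      fix N :: nat
      define e where "e = 1 / (real N + 1)"
      have e: "0 < e" by (simp add: e_def)
      have "\<forall>\<^sub>F n in sequentially. (\<exists>p\<in>ball x e. ereal s \<le> phi n p) \<and> (\<exists>q\<in>ball y e. ereal r \<le> phi n q) \<and> N \<le> n"
        using limit_hull_persistent[OF s e] limit_hull_persistent[OF r e] eventually_ge_at_top[of N]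
        by eventually_elim auto
      then obtain n where "(\<exists>p\<in>ball x e. ereal s \<le> phi n p) \<and> (\<exists>q\<in>ball y e. ereal r \<le> phi n q) \<and> N \<le> n"
        using eventually_happens'[OF sequentially_bot] by blast
      then obtain p q where n: "N \<le> n" and p: "dist x p < e" "ereal s \<le> phi n p"
        and q: "dist y q < e" "ereal r \<le> phi n q" by auto
      have "ereal ((1 - t) * s + t * r) \<le> phi n ((1 - t) *\<^sub>R p + t *\<^sub>R q)"
        using p q t tame by (intro ereal_concaveD Phi_classD(2)) (auto simp: tame_def)
      moreover have "dist ((1 - t) *\<^sub>R x + t *\<^sub>R y) ((1 - t) *\<^sub>R p + t *\<^sub>R q) < e"
      proof -
        have "((1 - t) *\<^sub>R x + t *\<^sub>R y) - ((1 - t) *\<^sub>R p + t *\<^sub>R q) = (1 - t) *\<^sub>R (x - p) + t *\<^sub>R (y - q)"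
          by (simp add: algebra_simps)
        then have "dist ((1 - t) *\<^sub>R x + t *\<^sub>R y) ((1 - t) *\<^sub>R p + t *\<^sub>R q) \<le> (1 - t) * dist x p + t * dist y q"
          using norm_triangle_ineq[of "(1 - t) *\<^sub>R (x - p)" "t *\<^sub>R (y - q)"] t by (simp add: dist_norm)
        also have "\<dots> < (1 - t) * e + t * e"
          using p q t by (intro add_strict_mono mult_strict_left_mono) auto
        finally show ?thesis by (simp add: algebra_simps)
      qed
      ultimately show "\<exists>n\<ge>N. \<exists>z. dist ((1 - t) *\<^sub>R x + t *\<^sub>R y) z < 1 / (real N + 1) \<and>
          ereal ((1 - t) * s + t * r) \<le> phi n z"
        using n unfolding e_def by blast
    qed
  qed
  moreover have "coercive (limit_hull phi)" using b le by (rule coercive_of_envelope)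
  ultimately show ?thesis using fin le ge b rho by (auto simp: tame_def Phi_class_def)
qed

text \<open>At \<open>x\<close> itself the sequence may stay below the hull, but concavity bounds it below at the slightly contracted
  point.\<close>

lemma exp_limit_hull_le_liminf:
  assumes l: "0 < l" "l < 1"
  shows "ennreal (exp ((1 - l) * (m - a)) * exp_ereal (limit_hull phi x)) \<le>
    liminf (\<lambda>n. ennreal (exp_ereal (phi n (c + l *\<^sub>R (x - c)))))"
proof (cases "limit_hull phi x")
  case (real p)
  have rho: "0 < rho" and b: "0 < b" using tame by (auto simp: tame_def)
  have "limit_hull phi x \<le> ereal (a - b * norm (x - c))" using limit_hull_tame by (simp add: tame_def)
  moreover have "0 \<le> b * norm (x - c)" using b by simp
  ultimately have "p \<le> a" using real by simp
  have "(1 - l) * (m - a) + p \<le> l * p + (1 - l) * m"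
    using mult_left_mono[OF \<open>p \<le> a\<close>, of "1 - l"] l by (simp add: algebra_simps)
  then have "exp ((1 - l) * (m - a)) * exp_ereal (limit_hull phi x) \<le> exp (l * p + (1 - l) * m)"
    by (simp add: real flip: exp_add)
  then have "ennreal (exp ((1 - l) * (m - a)) * exp_ereal (limit_hull phi x)) \<le> ennreal (exp (l * p + (1 - l) * m))"
    by (rule ennreal_leI)
  also have "\<dots> \<le> liminf (\<lambda>n. ennreal (exp_ereal (phi n (c + l *\<^sub>R (x - c)))))"
    unfolding le_Liminf_iff
  proof (intro allI impI)
    fix y assume y: "y < ennreal (exp (l * p + (1 - l) * m))"
    have "((\<lambda>s. ennreal (exp (l * s + (1 - l) * m))) \<longlongrightarrow> ennreal (exp (l * p + (1 - l) * m))) (at_left p)"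
      by (intro tendsto_intros)
    then have "\<forall>\<^sub>F s in at_left p. y < ennreal (exp (l * s + (1 - l) * m))"
      using y by (rule order_tendstoD)
    moreover have "\<forall>\<^sub>F s in at_left p. s < p"
      by (auto simp: eventually_at_filter)
    ultimately have "\<forall>\<^sub>F s in at_left p. y < ennreal (exp (l * s + (1 - l) * m)) \<and> s < p"
      by eventually_elim auto
    then obtain s where s: "y < ennreal (exp (l * s + (1 - l) * m))" "s < p"
      using eventually_happens'[OF trivial_limit_at_left_real] by fastforce
    have "ereal s < limit_hull phi x" "0 < (1 - l) * rho" using s real l rho by auto
    from limit_hull_persistent[OF this]
    show "\<forall>\<^sub>F n in sequentially. y < ennreal (exp_ereal (phi n (c + l *\<^sub>R (x - c))))"
    proof eventually_elim
      case (elim n)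
      then obtain z where z: "dist x z < (1 - l) * rho" "ereal s \<le> phi n z" by auto
      have Phi: "phi n \<in> Phi_class" using tame by (auto simp: tame_def)
      have "dist (c + l *\<^sub>R (x - c)) (c + l *\<^sub>R (z - c)) = l * dist x z"
        using l by (simp add: dist_norm scaleR_diff_right[symmetric])
      also have "\<dots> \<le> dist x z" using l by (simp add: mult_left_le_one_le)
      finally have "ereal (l * s + (1 - l) * m) \<le> phi n (c + l *\<^sub>R (x - c))"
        using z tame l by (intro cone_lower_bound[OF Phi_classD(2)[OF Phi] z(2)]) (auto simp: tame_def)
      then have "exp (l * s + (1 - l) * m) \<le> exp_ereal (phi n (c + l *\<^sub>R (x - c)))"
        using exp_ereal_mono Phi_classD(1)[OF Phi] by fastforce
      then show ?case using s(1) by (meson ennreal_leI less_le_trans)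
    qed
  qed
  finally show ?thesis .
next
  case PInf
  then show ?thesis using limit_hull_tame Phi_classD(1) unfolding tame_def by metis
qed simp

text \<open>Fatou for the contracted functions, then \<open>l\<close> tends to one.\<close>

lemma mass_limit_hull:
  assumes mass: "\<And>n. mass (phi n) \<le> 1"
  shows "mass (limit_hull phi) \<le> 1"
proof -
  let ?h = "\<lambda>l. exp ((1 - l) * (a - m)) * (1 / l ^ DIM('a))"
  have meas: "phi n \<in> borel_measurable borel" for n
    using tame Phi_class_measurable by (auto simp: tame_def)
  have measl: "limit_hull phi \<in> borel_measurable borel"
    using limit_hull_tame Phi_class_measurable by (auto simp: tame_def)
  have le: "mass (limit_hull phi) \<le> ennreal (?h l)" if l: "0 < l" "l < 1" for l
  proof -
    note [measurable] = meas measl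
    have "ennreal (exp ((1 - l) * (m - a))) * mass (limit_hull phi) =
        (\<integral>\<^sup>+x. ennreal (exp ((1 - l) * (m - a)) * exp_ereal (limit_hull phi x)) \<partial>lborel)"
      unfolding mass_def by (subst nn_integral_cmult[symmetric]) (auto simp: ennreal_mult)
    also have "\<dots> \<le> (\<integral>\<^sup>+x. liminf (\<lambda>n. ennreal (exp_ereal (phi n (c + l *\<^sub>R (x - c))))) \<partial>lborel)"
      using exp_limit_hull_le_liminf[OF l] by (intro nn_integral_mono)
    also have "\<dots> \<le> liminf (\<lambda>n. \<integral>\<^sup>+x. ennreal (exp_ereal (phi n (c + l *\<^sub>R (x - c)))) \<partial>lborel)"
      by (intro nn_integral_liminf) measurable
    also have "\<dots> \<le> ennreal (1 / l ^ DIM('a))"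
    proof (rule Liminf_le)
      show "\<forall>\<^sub>F n in sequentially. (\<integral>\<^sup>+x. ennreal (exp_ereal (phi n (c + l *\<^sub>R (x - c)))) \<partial>lborel) \<le> ennreal (1 / l ^ DIM('a))"
      proof (rule always_eventually, rule allI)
        fix n
        have "(\<integral>\<^sup>+x. ennreal (exp_ereal (phi n (c + l *\<^sub>R (x - c)))) \<partial>lborel) = ennreal (1 / l ^ DIM('a)) * mass (phi n)"
          unfolding mass_def using l by (subst nn_integral_homothety[where f = "\<lambda>x. ennreal (exp_ereal (phi n x))"]) auto
        also have "\<dots> \<le> ennreal (1 / l ^ DIM('a)) * 1" using mass by (intro mult_left_mono) auto
        finally show "(\<integral>\<^sup>+x. ennreal (exp_ereal (phi n (c + l *\<^sub>R (x - c)))) \<partial>lborel) \<le> ennreal (1 / l ^ DIM('a))" by simp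
      qed
    qed simp
    finally have "ennreal (exp ((1 - l) * (a - m))) * (ennreal (exp ((1 - l) * (m - a))) * mass (limit_hull phi)) \<le>
        ennreal (exp ((1 - l) * (a - m))) * ennreal (1 / l ^ DIM('a))"
      by (intro mult_left_mono) auto
    moreover have "ennreal (exp ((1 - l) * (a - m))) * ennreal (exp ((1 - l) * (m - a))) = 1"
    proof -
      have "(1 - l) * (a - m) + (1 - l) * (m - a) = 0" by (simp add: algebra_simps)
      then show ?thesis by (simp flip: ennreal_mult exp_add)
    qed
    ultimately have "mass (limit_hull phi) \<le> ennreal (exp ((1 - l) * (a - m))) * ennreal (1 / l ^ DIM('a))"
      by (simp add: mult.assoc[symmetric])
    then show ?thesis using l by (simp add: ennreal_mult del: times_divide_eq_right)
  qed
  have "((\<lambda>l. ennreal (?h l)) \<longlongrightarrow> ennreal (exp ((1 - 1) * (a - m)) * (1 / 1 ^ DIM('a)))) (at_left (1::real))"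
    by (intro tendsto_intros) auto
  moreover have "\<forall>\<^sub>F l in at_left (1::real). mass (limit_hull phi) \<le> ennreal (?h l)"
  proof -
    have "\<forall>\<^sub>F l in at_left (1::real). l \<in> {0<..<1}" by (rule eventually_at_left_real) simp
    then show ?thesis by eventually_elim (use le in auto)
  qed
  ultimately have "mass (limit_hull phi) \<le> ennreal (exp ((1 - 1) * (a - m)) * (1 / 1 ^ DIM('a)))"
    by (rule tendsto_lowerbound) simp
  then show ?thesis by simp
qed

end

section \<open>Existence and uniqueness of the maximizer\<close>

text \<open>A member of the class with finite functional for every distribution with finite first moment.\<close>

lemma neg_norm_admissible:
  fixes c :: "'a::euclidean_space"
  assumes "0 < rho"
  shows "tame c rho (- rho) 0 1 (\<lambda>x. ereal (- norm (x - c)))" "1-lipschitz_on UNIV (\<lambda>x. - norm (x - c))"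
    "mass (\<lambda>x. ereal (- norm (x - c))) < \<top>"
proof -
  show lip: "1-lipschitz_on UNIV (\<lambda>x. - norm (x - c))"
  proof (rule lipschitz_onI)
    fix x y show "dist (- norm (x - c)) (- norm (y - c)) \<le> 1 * dist x y"
      using norm_triangle_ineq3[of "x - c" "y - c"] by (simp add: dist_norm dist_real_def)
  qed simp
  have "(\<lambda>x. ereal (- norm (x - c))) \<in> Phi_class"
  proof (rule real_concave_in_Phi[of _ 1 0 c])
    fix x y :: 'a and t :: real assume t: "0 < t" "t < 1"
    have "(1 - t) *\<^sub>R x + t *\<^sub>R y - c = (1 - t) *\<^sub>R (x - c) + t *\<^sub>R (y - c)"
      by (simp add: algebra_simps)
    then show "(1 - t) * - norm (x - c) + t * - norm (y - c) \<le> - norm ((1 - t) *\<^sub>R x + t *\<^sub>R y - c)"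
      using norm_triangle_ineq[of "(1 - t) *\<^sub>R (x - c)" "t *\<^sub>R (y - c)"] t by simp
  qed (use lipschitz_on_continuous_on[OF lip] in auto)
  then show "tame c rho (- rho) 0 1 (\<lambda>x. ereal (- norm (x - c)))"
    using assms by (auto simp: tame_def dist_norm norm_minus_commute)
  show "mass (\<lambda>x. ereal (- norm (x - c))) < \<top>"
    using exp_norm_integral_finite[of 1 c] by (simp add: mass_def)
qed

lemma spread_mass_pos:
  assumes Q: "prob_distribution Q" and s: "spread Q c rho eta" and phi: "proper Q phi"
  shows "mass phi \<noteq> 0"
proof -
  have Phi: "phi \<in> Phi_class" using phi by (simp add: proper_def)
  obtain M where M: "\<And>x. phi x \<le> ereal M" using Phi_class_bounded_above[OF Phi] by auto
  have rho: "0 < rho" using s by (simp add: spread_def)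
  define t where "t = M - (M - mean Q phi + 1) / eta"
  have "ennreal (exp t * (unit_ball_vol DIM('a) * rho ^ DIM('a))) \<le> mass phi"
    using superlevel_contains_ball[OF Q s phi M] Phi_classD(1)[OF Phi] rho
    by (intro mass_ge_ball[of c]) (auto simp: t_def)
  moreover have "0 < exp t * (unit_ball_vol DIM('a) * rho ^ DIM('a))" using rho by simp
  ultimately show ?thesis by (auto simp del: zero_less_mult_iff simp: ennreal_eq_0_iff)
qed

lemma L_sup_finite:
  fixes Q :: "'a::euclidean_space measure"
  assumes Q: "Q \<in> Q1_class" and s: "spread Q c rho eta"
  obtains K where "L_sup Q = ereal K"
proof -
  have Qp: "prob_distribution Q" using Q by (rule Q1_classD)
  have pos: "0 < rho" "0 < eta" using s by (auto simp: spread_def)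
  have "proper Q (\<lambda>x. ereal (- norm (x - c)))"
    using Q neg_norm_admissible[OF pos(1)] by (rule lipschitz_proper)
  from L_sup_ge[OF Qp this] have lower: "L_sup Q \<noteq> -\<infinity>" by auto
  obtain m a b where ap: "\<And>Q phi. prob_distribution Q \<Longrightarrow> spread Q c rho eta \<Longrightarrow> proper Q phi \<Longrightarrow> mass phi \<le> 1 \<Longrightarrow>
      0 \<le> mean Q phi \<Longrightarrow> tame c rho m a b phi" using a_priori_bounds[OF pos] by metis
  have "L_sup Q \<le> ereal (max 0 a)"
  proof (rule L_sup_le[OF Qp])
    fix phi assume phi: "proper Q phi"
    obtain phi' where phi': "proper Q phi'" "mass phi' = 1" "Lval Q phi \<le> Lval Q phi'"
      using normalize[OF Qp phi spread_mass_pos[OF Qp s phi]] by metis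
    have L: "Lval Q phi' = mean Q phi'" by (simp add: Lval_def phi')
    have "mean Q phi' \<le> max 0 a"
    proof (cases "0 \<le> mean Q phi'")
      case True
      then have t: "tame c rho m a b phi'" using ap[OF Qp s phi'(1)] phi'(2) by simp
      have "mean Q phi' \<le> a"
      proof (rule mean_le[OF Qp phi'(1)])
        fix x
        have "phi' x \<le> ereal (a - b * norm (x - c))" "a - b * norm (x - c) \<le> a"
          using t by (auto simp: tame_def)
        then show "phi' x \<le> ereal a" by (meson ereal_less_eq(3) order_trans)
      qed
      then show ?thesis by simp
    qed simp
    then show "ereal (Lval Q phi) \<le> ereal (max 0 a)" using phi'(3) L by (simp add: max_def split: if_splits)
  qed
  then have "L_sup Q \<noteq> \<infinity>" by (auto simp: max_def split: if_splits)
  with lower show thesis using that by (cases "L_sup Q") auto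
qed

lemma near_maximizer_exists:
  assumes Q: "Q \<in> Q1_class" and s: "spread Q c rho eta" and K: "L_sup Q = ereal K" and eps: "0 < eps"
  obtains phi where "proper Q phi" "mass phi = 1" "K - eps \<le> Lval Q phi" "mean Q phi = Lval Q phi"
proof -
  have Qp: "prob_distribution Q" using Q by (rule Q1_classD)
  obtain phi where phi: "proper Q phi" "K - eps < Lval Q phi"
    using L_sup_approx[OF Qp, of "K - eps"] K eps by auto
  obtain phi' where "proper Q phi'" "mass phi' = 1" "Lval Q phi \<le> Lval Q phi'"
    using normalize[OF Qp phi(1) spread_mass_pos[OF Qp s phi(1)]] by metis
  then show thesis using phi(2) by (intro that[of phi']) (auto simp: Lval_def)
qed

lemma nn_integral_deficit:
  assumes Q: "prob_distribution Q" and phi: "proper Q phi" and le: "\<And>x. phi x \<le> ereal a"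
  shows "(\<integral>\<^sup>+x. e2ennreal (ereal a - phi x) \<partial>Q) = ennreal (a - mean Q phi)"
proof -
  interpret prob_space Q using Q by (rule prob_distributionD)
  have "(\<integral>\<^sup>+x. e2ennreal (ereal a - phi x) \<partial>Q) = (\<integral>\<^sup>+x. ennreal (a - real_of_ereal (phi x)) \<partial>Q)"
  proof (rule nn_integral_cong_AE)
    show "AE x in Q. e2ennreal (ereal a - phi x) = ennreal (a - real_of_ereal (phi x))"
      using phi unfolding proper_def
    proof (elim conjE, elim eventually_mono)
      fix x assume "phi x \<noteq> -\<infinity>"
      then show "e2ennreal (ereal a - phi x) = ennreal (a - real_of_ereal (phi x))"
        using le[of x] by (cases "phi x") auto
    qed
  qed
  also have "\<dots> = ennreal (\<integral>x. a - real_of_ereal (phi x) \<partial>Q)"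
  proof (rule nn_integral_eq_integral)
    show "AE x in Q. 0 \<le> a - real_of_ereal (phi x)"
      using phi unfolding proper_def
    proof (elim conjE, elim eventually_mono)
      fix x assume "phi x \<noteq> -\<infinity>"
      then show "0 \<le> a - real_of_ereal (phi x)" using le[of x] by (cases "phi x") auto
    qed
  qed (use phi in \<open>simp add: proper_def\<close>)
  also have "(\<integral>x. a - real_of_ereal (phi x) \<partial>Q) = a - mean Q phi"
    using phi by (simp add: proper_def mean_def prob_space)
  finally show ?thesis .
qed

text \<open>The deficit \<open>a - phi\<close> is nonnegative, so its integral makes sense, and Fatou applies to it, before \<open>phi\<close> is known to be integrable.\<close>

lemma proper_of_deficit:
  assumes Q: "prob_distribution Q" and Phi: "phi \<in> Phi_class" and le: "\<And>x. phi x \<le> ereal a"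
    and mass: "mass phi < \<top>" and def: "(\<integral>\<^sup>+x. e2ennreal (ereal a - phi x) \<partial>Q) \<le> ennreal D" and D: "0 \<le> D"
  shows "proper Q phi" "a - D \<le> mean Q phi"
proof -
  interpret prob_space Q using Q by (rule prob_distributionD)
  have [measurable]: "phi \<in> borel_measurable Q"
    using Phi_class_measurable[OF Phi] by (simp add: prob_distribution_measurable[OF Q])
  have "(\<integral>\<^sup>+x. e2ennreal (ereal a - phi x) \<partial>Q) \<noteq> \<infinity>" using def by (auto simp: top_unique)
  then have "AE x in Q. e2ennreal (ereal a - phi x) \<noteq> \<infinity>" by (intro nn_integral_PInf_AE) auto
  then have ae: "AE x in Q. phi x \<noteq> -\<infinity>" by eventually_elim auto
  then have ae': "AE x in Q. ennreal (norm (a - real_of_ereal (phi x))) = e2ennreal (ereal a - phi x)"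
  proof eventually_elim
    fix x assume "phi x \<noteq> -\<infinity>"
    then show "ennreal (norm (a - real_of_ereal (phi x))) = e2ennreal (ereal a - phi x)"
      using le[of x] by (cases "phi x") auto
  qed
  have "integrable Q (\<lambda>x. a - real_of_ereal (phi x))"
  proof (rule integrableI_bounded)
    show "(\<integral>\<^sup>+x. ennreal (norm (a - real_of_ereal (phi x))) \<partial>Q) < \<infinity>"
      unfolding nn_integral_cong_AE[OF ae'] using def by (auto intro: le_less_trans)
  qed measurable
  then have "integrable Q (\<lambda>x. a - (a - real_of_ereal (phi x)))" 
    by (rule Bochner_Integration.integrable_diff[OF integrable_const])
  then show pr: "proper Q phi" using Phi ae mass by (simp add: proper_def)
  have "ennreal (a - mean Q phi) \<le> ennreal D"
    using def unfolding nn_integral_deficit[OF Q pr le] .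
  then show "a - D \<le> mean Q phi" using D by (simp add: ennreal_le_iff2) linarith
qed

text \<open>A normalized maximizing sequence is tame and Cauchy in mean. Its limit hull has mass at most one, and since it
  dominates the upper limit of the sequence, Fatou bounds its deficit.\<close>

lemma maximizer_exists:
  fixes Q :: "'a::euclidean_space measure"
  assumes Q: "Q \<in> Q1_class" and s: "spread Q c rho eta" and K: "L_sup Q = ereal K"
  obtains \<psi> where "proper Q \<psi>" "Lval Q \<psi> = K"
proof -
  have Qp: "prob_distribution Q" using Q by (rule Q1_classD)
  have pos: "0 < rho" "0 < eta" using s by (auto simp: spread_def)
  obtain m a b where ap: "\<And>Q phi. prob_distribution Q \<Longrightarrow> spread Q c rho eta \<Longrightarrow> proper Q phi \<Longrightarrow> mass phi \<le> 1 \<Longrightarrow>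
      K - 1 \<le> mean Q phi \<Longrightarrow> tame c rho m a b phi" using a_priori_bounds[OF pos] by metis
  have "\<forall>n. \<exists>phi. proper Q phi \<and> mass phi = 1 \<and> K - 1 / (real n + 1) \<le> Lval Q phi \<and> mean Q phi = Lval Q phi"
  proof
    fix n show "\<exists>phi. proper Q phi \<and> mass phi = 1 \<and> K - 1 / (real n + 1) \<le> Lval Q phi \<and> mean Q phi = Lval Q phi"
      by (rule near_maximizer_exists[OF Q s K, of "1 / (real n + 1)"]) auto
  qed
  then obtain phi where phi: "\<And>n. proper Q (phi n)" "\<And>n. mass (phi n) = 1" "\<And>n. K - 1 / (real n + 1) \<le> Lval Q (phi n)"
    "\<And>n. mean Q (phi n) = Lval Q (phi n)" by metis
  have tame: "tame c rho m a b (phi n)" for n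
  proof (rule ap[OF Qp s phi(1)])
    have "1 / (real n + 1) \<le> 1" by simp
    then show "K - 1 \<le> mean Q (phi n)" using phi(3)[of n] phi(4)[of n] by linarith
  qed (simp add: phi(2))
  have Cauchy: "\<exists>N. \<forall>i\<ge>N. \<forall>j\<ge>N. dist1 (phi i) (phi j) \<le> ennreal eps" if "0 < eps" for eps
  proof -
    obtain delta where delta: "0 < delta"
      "\<And>Q Q' K phi theta. Q \<in> Q1_class \<Longrightarrow> Q' \<in> Q1_class \<Longrightarrow> lip_close Q' Q delta \<Longrightarrow> L_sup Q \<le> ereal K \<Longrightarrow>
        tame c rho m a b phi \<Longrightarrow> near_max Q K delta phi \<Longrightarrow>
        tame c rho m a b theta \<Longrightarrow> near_max Q' K delta theta \<Longrightarrow>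
        dist1 phi theta \<le> ennreal eps"
      using near_maximizers_close[OF \<open>0 < eps\<close>, of c rho m a b] by metis
    obtain N where N: "1 / (real N + 1) < delta"
      using reals_Archimedean[OF delta(1)] by (auto simp: inverse_eq_divide add.commute)
    have near: "K - delta \<le> Lval Q (phi i)" if "N \<le> i" for i
    proof -
      have "1 / (real i + 1) \<le> 1 / (real N + 1)" using that by (intro divide_left_mono) auto
      then show ?thesis using phi(3)[of i] N by linarith
    qed
    have "dist1 (phi i) (phi j) \<le> ennreal eps" if "N \<le> i" "N \<le> j" for i j
      using delta(1) K near that tame phi(1,2) by (intro delta(2)[OF Q Q lip_close_refl]) (auto simp: near_max_def)
    then show ?thesis by blast
  qed
  define \<psi> where "\<psi> = limit_hull phi"
  have t\<psi>: "tame c rho m a b \<psi>" unfolding \<psi>_def using tame Cauchy by (rule limit_hull_tame)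
  have m\<psi>: "mass \<psi> \<le> 1" unfolding \<psi>_def using tame Cauchy phi(2) by (intro mass_limit_hull) auto
  have Phi: "\<psi> \<in> Phi_class" using t\<psi> by (simp add: tame_def)
  have le: "f x \<le> ereal a" if t: "tame c rho m a b f" for f x
  proof -
    have "f x \<le> ereal (a - b * norm (x - c))" "a - b * norm (x - c) \<le> a" using t by (auto simp: tame_def)
    then show ?thesis by (meson ereal_less_eq(3) order_trans)
  qed
  have [measurable]: "phi n \<in> borel_measurable Q" for n
    using tame Phi_class_measurable by (auto simp: tame_def prob_distribution_measurable[OF Qp])
  have aK: "0 \<le> a - K"
  proof (rule ccontr)
    assume "\<not> ?thesis"
    then obtain n where "1 / (real n + 1) < K - a"
      using reals_Archimedean[of "K - a"] by (auto simp: inverse_eq_divide add.commute)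
    moreover have "mean Q (phi n) \<le> a" using le[OF tame] by (intro mean_le[OF Qp phi(1)])
    ultimately show False using phi(3)[of n] phi(4)[of n] by linarith
  qed
  have "(\<integral>\<^sup>+x. e2ennreal (ereal a - \<psi> x) \<partial>Q) \<le> (\<integral>\<^sup>+x. liminf (\<lambda>n. e2ennreal (ereal a - phi n x)) \<partial>Q)"
  proof (rule nn_integral_mono)
    fix x
    show "e2ennreal (ereal a - \<psi> x) \<le> liminf (\<lambda>n. e2ennreal (ereal a - phi n x))"
      unfolding le_Liminf_iff
    proof (intro allI impI)
      fix y assume y: "y < e2ennreal (ereal a - \<psi> x)"
      then obtain q where q: "y = ennreal q" "0 \<le> q" by (cases y) auto
      have "\<psi> x < ereal (a - q)"
        using y q le[OF t\<psi>, of x] by (cases "\<psi> x") (auto simp: ennreal_less_iff)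
      then have "\<forall>\<^sub>F n in sequentially. phi n x < ereal (a - q)"
        unfolding \<psi>_def by (rule limit_hull_limsup)
      then show "\<forall>\<^sub>F n in sequentially. y < e2ennreal (ereal a - phi n x)"
      proof eventually_elim
        case (elim n)
        then show ?case using q by (cases "phi n x") (auto simp: ennreal_less_iff)
      qed
    qed
  qed
  also have "\<dots> \<le> liminf (\<lambda>n. \<integral>\<^sup>+x. e2ennreal (ereal a - phi n x) \<partial>Q)"
    by (intro nn_integral_liminf) measurable
  also have "\<dots> = liminf (\<lambda>n. ennreal (a - mean Q (phi n)))"
    using nn_integral_deficit[OF Qp phi(1) le[OF tame]] by simp
  also have "\<dots> \<le> liminf (\<lambda>n. ennreal (a - K + 1 / (real n + 1)))"
    using phi(3,4) by (intro Liminf_mono always_eventually allI ennreal_leI) (simp add: algebra_simps)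
  also have "\<dots> = ennreal (a - K + 0)"
  proof (rule lim_imp_Liminf)
    have "(\<lambda>n. 1 / (real n + 1)) \<longlonglongrightarrow> 0"
      using LIMSEQ_inverse_real_of_nat by (simp add: inverse_eq_divide add.commute)
    then show "(\<lambda>n. ennreal (a - K + 1 / (real n + 1))) \<longlonglongrightarrow> ennreal (a - K + 0)"
      by (intro tendsto_intros)
  qed simp
  finally have def: "(\<integral>\<^sup>+x. e2ennreal (ereal a - \<psi> x) \<partial>Q) \<le> ennreal (a - K)" by simp
  have fin: "mass \<psi> < \<top>" using m\<psi> by (auto intro: le_less_trans)
  have pr: "proper Q \<psi>" and mean: "a - (a - K) \<le> mean Q \<psi>"
    using proper_of_deficit[OF Qp Phi le[OF t\<psi>] fin def aK] by auto
  have "enn2real (mass \<psi>) \<le> 1" using m\<psi> by (intro enn2real_leI) auto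
  then have "K \<le> Lval Q \<psi>" using mean by (simp add: Lval_def)
  moreover have "Lval Q \<psi> \<le> K" using L_sup_ge[OF Qp pr] K by simp
  ultimately show thesis using that[OF pr] by simp
qed

text \<open>Two maximizers are near-maximizers to every precision, hence at distance zero in mean, hence equal everywhere.\<close>

lemma psi_maximizer:
  fixes Q :: "'a::euclidean_space measure"
  assumes Q: "Q \<in> Q1_class" and s: "spread Q c rho eta"
  shows "proper Q (psi Q)" "mass (psi Q) = 1" "L_sup Q = ereal (Lval Q (psi Q))" "mean Q (psi Q) = Lval Q (psi Q)"
proof -
  have Qp: "prob_distribution Q" using Q by (rule Q1_classD)
  have pos: "0 < rho" "0 < eta" using s by (auto simp: spread_def)
  obtain K where K: "L_sup Q = ereal K" using L_sup_finite[OF Q s] .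
  define is_max where "is_max \<psi> \<longleftrightarrow> \<psi> \<in> Phi_class \<and> (\<forall>phi\<in>Phi_class. L_fun phi Q \<le> L_fun \<psi> Q)" for \<psi>
  have max: "proper Q \<psi> \<and> Lval Q \<psi> = K \<and> mass \<psi> = 1" if "is_max \<psi>" for \<psi>
  proof -
    have Phi: "\<psi> \<in> Phi_class" using that by (simp add: is_max_def)
    have L: "L_fun \<psi> Q = ereal K"
      using that unfolding K[symmetric] L_sup_def is_max_def
      by (auto intro!: antisym SUP_upper SUP_least)
    then have pr: "proper Q \<psi>" using proper_iff[OF Qp Phi] by simp
    then have LK: "Lval Q \<psi> = K" using L L_fun_proper[OF Qp pr] by simp
    have "mass \<psi> = 1"
    proof (rule ccontr)
      assume "mass \<psi> \<noteq> 1"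
      then obtain phi where "proper Q phi" "Lval Q \<psi> < Lval Q phi"
        using normalize[OF Qp pr spread_mass_pos[OF Qp s pr]] by metis
      then show False using L_sup_ge[OF Qp] K LK by fastforce
    qed
    then show ?thesis using pr LK by simp
  qed
  obtain \<psi>0 where \<psi>0: "proper Q \<psi>0" "Lval Q \<psi>0 = K" using maximizer_exists[OF Q s K] .
  have max0: "is_max \<psi>0"
  proof -
    have "L_fun phi Q \<le> L_fun \<psi>0 Q" if "phi \<in> Phi_class" for phi
    proof -
      have "L_fun phi Q \<le> L_sup Q" unfolding L_sup_def using that by (rule SUP_upper)
      then show ?thesis using K \<psi>0 L_fun_proper[OF Qp \<psi>0(1)] by simp
    qed
    then show ?thesis using \<psi>0(1) by (simp add: is_max_def proper_def)
  qed
  have uniq: "\<psi>1 = \<psi>2" if m: "is_max \<psi>1" "is_max \<psi>2" for \<psi>1 \<psi>2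
  proof -
    obtain m a b where ap: "\<And>Q phi. prob_distribution Q \<Longrightarrow> spread Q c rho eta \<Longrightarrow> proper Q phi \<Longrightarrow> mass phi \<le> 1 \<Longrightarrow>
        K \<le> mean Q phi \<Longrightarrow> tame c rho m a b phi" using a_priori_bounds[OF pos] by metis
    note M = max[OF m(1)] max[OF m(2)]
    have t: "tame c rho m a b \<psi>1" "tame c rho m a b \<psi>2"
      using ap[OF Qp s] M by (auto simp: Lval_def)
    have "dist1 \<psi>1 \<psi>2 \<le> 0 + ennreal eps" if "0 < eps" for eps
    proof (rule near_maximizers_close[OF that, of c rho m a b])
      fix delta assume delta: "0 < delta"
        "\<And>Q Q' K phi theta. Q \<in> Q1_class \<Longrightarrow> Q' \<in> Q1_class \<Longrightarrow> lip_close Q' Q delta \<Longrightarrow> L_sup Q \<le> ereal K \<Longrightarrow>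
        tame c rho m a b phi \<Longrightarrow> near_max Q K delta phi \<Longrightarrow>
        tame c rho m a b theta \<Longrightarrow> near_max Q' K delta theta \<Longrightarrow>
        dist1 phi theta \<le> ennreal eps"
      have "dist1 \<psi>1 \<psi>2 \<le> ennreal eps"
        using delta(1) K t M by (intro delta(2)[OF Q Q lip_close_refl, of K]) (auto simp: near_max_def)
      then show ?thesis by simp
    qed
    then have "dist1 \<psi>1 \<psi>2 \<le> 0" by (rule ennreal_le_epsilon)
    then show ?thesis using dist1_zero_imp_eq[OF t] by simp
  qed
  have "is_max (psi Q)"
    unfolding psi_def is_max_def[symmetric] by (rule theI[of is_max, OF max0 uniq[OF _ max0]])
  from max[OF this] K show "proper Q (psi Q)" "mass (psi Q) = 1" "L_sup Q = ereal (Lval Q (psi Q))"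
    "mean Q (psi Q) = Lval Q (psi Q)" by (auto simp: Lval_def)
qed

section \<open>Distributions carried by a hyperplane\<close>

text \<open>On the hyperplane \<open>u \<bullet> x = s\<close> the functions \<open>g n\<close> do not depend on \<open>n\<close>, and their integral is \<open>t\<close>, whereas
  off the hyperplane, which is a null set, they tend to minus infinity, so the mass tends to zero.\<close>

lemma degenerate_lipschitz:
  fixes Q :: "'a::euclidean_space measure"
  assumes Q: "Q \<in> Q1_class" "Q \<notin> Qo_class"
  obtains k h c rho m a b where "0 \<le> k" "k-lipschitz_on UNIV h" "tame c rho m a b (\<lambda>x. ereal (h x))"
    "mass (\<lambda>x. ereal (h x)) \<le> 1" "t \<le> (\<integral>x. h x \<partial>Q)"
proof -
  have Qp: "prob_distribution Q" using Q(1) by (rule Q1_classD)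
  interpret prob_space Q using Qp by (rule prob_distributionD)
  obtain u s where u: "u \<noteq> 0" "AE x in Q. u \<bullet> x = s"
    using not_Qo_class_hyperplane[OF Qp Q(2)] by metis
  define A where "A = (\<integral>x. norm x \<partial>Q)"
  have ni: "integrable Q norm" using Q(1) by (rule Q1_classD)
  define g where "g n x = A + t - norm x - real n * \<bar>u \<bullet> x - s\<bar>" for n x
  have dom: "integrable lborel (\<lambda>x::'a. exp (A + t) * exp (- 1 * norm (x - 0)))"
    using exp_norm_integral_finite[of 1 "0::'a"]
    by (intro integrable_mult_right integrableI_bounded) auto
  have "(\<lambda>n. \<integral>x. exp (g n x) \<partial>lborel) \<longlonglongrightarrow> (\<integral>x. 0 \<partial>(lborel :: 'a measure))"
  proof (rule integral_dominated_convergence[OF _ _ dom])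
    show "AE x in lborel. (\<lambda>n. exp (g n x)) \<longlonglongrightarrow> 0"
    proof -
      have "negligible {x. u \<bullet> x = s}" using u(1) by (intro negligible_hyperplane) auto
      then have "{x. u \<bullet> x = s} \<in> null_sets lebesgue" by (simp add: negligible_iff_null_sets)
      then have "AE x in lebesgue. \<not> (u \<bullet> x = s)" by (rule AE_not_in[of "{x. u \<bullet> x = s}", simplified])
      then have "AE x in lborel. \<not> (u \<bullet> x = s)" by (simp add: AE_completion_iff)
      then show ?thesis
      proof eventually_elim
        case (elim x)
        have "norm (exp (- \<bar>u \<bullet> x - s\<bar>)) < 1" using elim by simp
        then have "(\<lambda>n. exp (- \<bar>u \<bullet> x - s\<bar>) ^ n) \<longlonglongrightarrow> 0" by (rule LIMSEQ_power_zero)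
        then have "(\<lambda>n. exp (A + t - norm x) * exp (- \<bar>u \<bullet> x - s\<bar>) ^ n) \<longlonglongrightarrow> exp (A + t - norm x) * 0"
          by (rule tendsto_mult[OF tendsto_const])
        moreover have "exp (g n x) = exp (A + t - norm x) * exp (- \<bar>u \<bullet> x - s\<bar>) ^ n" for n
        proof -
          have "g n x = (A + t - norm x) + real n * - \<bar>u \<bullet> x - s\<bar>" by (simp add: g_def)
          then show ?thesis by (simp only: exp_add exp_of_nat_mult)
        qed
        ultimately show ?case by simp
      qed
    qed
    show "AE x in lborel. norm (exp (g n x)) \<le> exp (A + t) * exp (- 1 * norm (x - 0))" for n
      by (rule AE_I2) (simp add: g_def flip: exp_add)
  qed (simp_all add: g_def)
  then have "(\<lambda>n. \<integral>x. exp (g n x) \<partial>lborel) \<longlonglongrightarrow> 0" by simp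
  then have "\<forall>\<^sub>F n in sequentially. (\<integral>x. exp (g n x) \<partial>lborel) < 1" by (rule order_tendstoD) simp
  then obtain n where n: "(\<integral>x. exp (g n x) \<partial>lborel) < 1"
    using eventually_happens'[OF sequentially_bot] by blast
  define k where "k = 1 + real n * norm u"
  have abs_bound: "\<bar>C - X - p - (C - Y - q)\<bar> \<le> N + M"
    if "\<bar>X - Y\<bar> \<le> N" "\<bar>p - q\<bar> \<le> M" for C X Y p q N M :: real
    using that by linarith
  have lip: "k-lipschitz_on UNIV (g n)"
  proof (rule lipschitz_onI)
    fix x y
    have "\<bar>u \<bullet> x - u \<bullet> y\<bar> \<le> norm u * norm (x - y)"
      using Cauchy_Schwarz_ineq2[of u "x - y"] by (simp add: inner_diff_right)
    then have "\<bar>\<bar>u \<bullet> x - s\<bar> - \<bar>u \<bullet> y - s\<bar>\<bar> \<le> norm u * norm (x - y)" by linarith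
    then have "real n * \<bar>\<bar>u \<bullet> x - s\<bar> - \<bar>u \<bullet> y - s\<bar>\<bar> \<le> real n * (norm u * norm (x - y))"
      by (intro mult_left_mono) auto
    moreover have "real n * \<bar>\<bar>u \<bullet> x - s\<bar> - \<bar>u \<bullet> y - s\<bar>\<bar> = \<bar>real n * \<bar>u \<bullet> x - s\<bar> - real n * \<bar>u \<bullet> y - s\<bar>\<bar>"
      by (simp add: abs_mult right_diff_distrib[symmetric])
    moreover have "\<bar>norm x - norm y\<bar> \<le> norm (x - y)" by (rule norm_triangle_ineq3)
    ultimately have "\<bar>g n x - g n y\<bar> \<le> norm (x - y) + real n * (norm u * norm (x - y))"
      unfolding g_def by (metis abs_bound)
    then show "dist (g n x) (g n y) \<le> k * dist x y"
      by (simp add: k_def dist_norm dist_real_def algebra_simps)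
  qed (simp add: k_def)
  have le: "g n x \<le> (A + t) - 1 * norm (x - 0)" for x by (simp add: g_def)
  have Phi: "(\<lambda>x. ereal (g n x)) \<in> Phi_class"
  proof (rule real_concave_in_Phi[OF lipschitz_on_continuous_on[OF lip] zero_less_one le])
    fix x y :: 'a and l :: real assume l: "0 < l" "l < 1"
    let ?z = "(1 - l) *\<^sub>R x + l *\<^sub>R y"
    have 1: "norm ?z \<le> (1 - l) * norm x + l * norm y"
      using norm_triangle_ineq[of "(1 - l) *\<^sub>R x" "l *\<^sub>R y"] l by simp
    have "u \<bullet> ?z - s = (1 - l) * (u \<bullet> x - s) + l * (u \<bullet> y - s)"
      by (simp add: inner_add_right algebra_simps)
    then have "\<bar>u \<bullet> ?z - s\<bar> \<le> (1 - l) * \<bar>u \<bullet> x - s\<bar> + l * \<bar>u \<bullet> y - s\<bar>"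
      using abs_triangle_ineq[of "(1 - l) * (u \<bullet> x - s)" "l * (u \<bullet> y - s)"] l by (simp add: abs_mult)
    then have 2: "real n * \<bar>u \<bullet> ?z - s\<bar> \<le> real n * ((1 - l) * \<bar>u \<bullet> x - s\<bar> + l * \<bar>u \<bullet> y - s\<bar>)"
      by (intro mult_left_mono) auto
    show "(1 - l) * g n x + l * g n y \<le> g n ?z"
      using 1 2 unfolding g_def by (simp add: algebra_simps)
  qed
  have low: "A + t - 1 - real n * (norm u + \<bar>s\<bar>) \<le> g n x" if "x \<in> cball 0 1" for x
  proof -
    have nx: "norm x \<le> 1" using that by simp
    have "\<bar>u \<bullet> x\<bar> \<le> norm u * norm x" by (rule Cauchy_Schwarz_ineq2)
    also have "\<dots> \<le> norm u" using nx by (simp add: mult_left_le)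
    finally have "\<bar>u \<bullet> x - s\<bar> \<le> norm u + \<bar>s\<bar>" by linarith
    then have "real n * \<bar>u \<bullet> x - s\<bar> \<le> real n * (norm u + \<bar>s\<bar>)" by (intro mult_left_mono) auto
    then show ?thesis using nx by (simp add: g_def)
  qed
  have tame: "tame 0 1 (A + t - 1 - real n * (norm u + \<bar>s\<bar>)) (A + t) 1 (\<lambda>x. ereal (g n x))"
    using Phi le low by (simp add: tame_def)
  have "integrable lborel (\<lambda>x. exp (g n x))"
  proof (rule Bochner_Integration.integrable_bound[OF dom])
    show "AE x in lborel. norm (exp (g n x)) \<le> norm (exp (A + t) * exp (- 1 * norm (x - 0)))"
      by (rule AE_I2) (simp add: g_def flip: exp_add)
  qed (simp add: g_def)
  then have "mass (\<lambda>x. ereal (g n x)) = ennreal (\<integral>x. exp (g n x) \<partial>lborel)"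
    unfolding mass_def by (simp add: nn_integral_eq_integral)
  also have "\<dots> \<le> ennreal 1" using n by (intro ennreal_leI) simp
  finally have mass: "mass (\<lambda>x. ereal (g n x)) \<le> 1" by simp
  have "(\<integral>x. g n x \<partial>Q) = (\<integral>x. A + t - norm x \<partial>Q)"
  proof (rule integral_cong_AE)
    show "AE x in Q. g n x = A + t - norm x"
      using u(2) by eventually_elim (simp add: g_def)
  qed (simp_all add: g_def prob_distribution_measurable[OF Qp])
  also have "\<dots> = t" using ni by (simp add: A_def prob_space)
  finally show thesis using that[OF _ lip tame mass] by (simp add: k_def)
qed

section \<open>Stability\<close>

text \<open>Used in both directions, from the limit to the sequence and back.\<close>

lemma L_sup_transfer:
  fixes c :: "'a::euclidean_space"
  assumes eps: "0 < eps"
  obtains delta where "0 < delta"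
    "\<And>Q Q' phi. Q \<in> Q1_class \<Longrightarrow> Q' \<in> Q1_class \<Longrightarrow> lip_close Q Q' delta \<Longrightarrow> tame c rho m a b phi \<Longrightarrow>
      mass phi \<le> 1 \<Longrightarrow> proper Q phi \<Longrightarrow> ereal (Lval Q phi - eps) \<le> L_sup Q'"
proof -
  have "0 < eps / 2" using eps by simp
  then obtain k where k: "b \<le> k"
    "\<And>phi. tame c rho m a b phi \<Longrightarrow> mass phi \<le> 1 \<Longrightarrow> mass (\<lambda>x. ereal (lipmaj k phi x)) \<le> mass phi + ennreal (eps / 2)"
    using lipmaj_uniform[of "eps / 2" b c rho m a] by metis
  define w where "w = 1 + \<bar>k\<bar>"
  have w: "0 < w" "k \<le> w" by (auto simp: w_def)
  define delta where "delta = eps / 2 / w"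
  have delta: "0 < delta" using eps w by (simp add: delta_def)
  have "k * delta \<le> w * delta" using delta w by (intro mult_right_mono) auto
  also have "\<dots> = eps / 2" using w by (simp add: delta_def)
  finally have kdelta: "k * delta \<le> eps / 2" .
  show thesis
  proof (rule that[OF delta])
    fix Q Q' phi assume Q: "Q \<in> Q1_class" "Q' \<in> Q1_class" "lip_close Q Q' delta"
      and phi: "tame c rho m a b phi" "mass phi \<le> 1" "proper Q phi"
    have "proper Q' (\<lambda>x. ereal (lipmaj k phi x))" "Lval Q phi - k * delta - eps / 2 \<le> Lval Q' (\<lambda>x. ereal (lipmaj k phi x))"
      using tame_proper_lipmaj[OF Q phi(1) k(1) phi(3) k(2)[OF phi(1,2)]] eps by auto
    then have "Lval Q phi - eps \<le> Lval Q' (\<lambda>x. ereal (lipmaj k phi x))"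
      "ereal (Lval Q' (\<lambda>x. ereal (lipmaj k phi x))) \<le> L_sup Q'"
      using kdelta L_sup_ge[OF Q1_classD(1)[OF Q(2)]] by auto
    then show "ereal (Lval Q phi - eps) \<le> L_sup Q'" by (meson ereal_less_eq(3) order_trans)
  qed
qed

lemma L_sup_degenerate_limit:
  fixes Q :: "'a::euclidean_space measure"
  assumes Q: "Q \<in> Q1_class" "Q \<notin> Qo_class" and Qn: "\<And>n. Qn n \<in> Q1_class"
    and close: "\<And>e. 0 < e \<Longrightarrow> \<forall>\<^sub>F n in sequentially. lip_close Q (Qn n) e"
  shows "L_sup Q = \<infinity>" "(\<lambda>n. L_sup (Qn n)) \<longlonglongrightarrow> \<infinity>"
proof -
  have *: "ereal (t - 1) \<le> L_sup Q \<and> (\<forall>\<^sub>F n in sequentially. ereal (t - 1) \<le> L_sup (Qn n))" for t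
  proof -
    obtain k h c rho m a b where k: "0 \<le> k" and lip: "k-lipschitz_on UNIV h"
      and tame: "tame c rho m a b (\<lambda>x. ereal (h x))" and mass: "mass (\<lambda>x. ereal (h x)) \<le> 1" and t: "t \<le> (\<integral>x. h x \<partial>Q)"
      using degenerate_lipschitz[OF Q] by metis
    have m1: "enn2real (mass (\<lambda>x. ereal (h x))) \<le> 1" using mass by (intro enn2real_leI) auto
    have fin: "mass (\<lambda>x. ereal (h x)) < \<top>" using mass by (auto intro: le_less_trans)
    have bound: "ereal (\<integral>x. h x \<partial>Q') \<le> L_sup Q'" if "Q' \<in> Q1_class" for Q'
    proof -
      have "ereal (\<integral>x. h x \<partial>Q') \<le> ereal (Lval Q' (\<lambda>x. ereal (h x)))"
        using m1 by (simp add: Lval_def mean_def)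
      also have "\<dots> \<le> L_sup Q'"
        using that lipschitz_proper[OF that tame lip fin] by (intro L_sup_ge Q1_classD)
      finally show ?thesis .
    qed
    have "0 < 1 / (1 + k)" using k by simp
    from close[OF this] have "\<forall>\<^sub>F n in sequentially. ereal (t - 1) \<le> L_sup (Qn n)"
    proof eventually_elim
      case (elim n)
      have "\<bar>(\<integral>x. h x \<partial>Q) - (\<integral>x. h x \<partial>Qn n)\<bar> \<le> k * (1 / (1 + k))"
        using elim k lip unfolding lip_close_def by blast
      also have "\<dots> \<le> 1" using k by simp
      finally have "ereal (t - 1) \<le> ereal (\<integral>x. h x \<partial>Qn n)" using t by simp
      then show ?case using bound[OF Qn] by (rule order_trans)
    qed
    moreover have "ereal (t - 1) \<le> ereal (\<integral>x. h x \<partial>Q)" using t by simp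
    then have "ereal (t - 1) \<le> L_sup Q" using bound[OF Q(1)] by (rule order_trans)
    ultimately show ?thesis by simp
  qed
  show "L_sup Q = \<infinity>"
  proof (rule ereal_top)
    fix B show "ereal B \<le> L_sup Q" using *[of "B + 1"] by simp
  qed
  show "(\<lambda>n. L_sup (Qn n)) \<longlonglongrightarrow> \<infinity>"
    unfolding tendsto_PInfty
  proof
    fix r :: real
    have "\<forall>\<^sub>F n in sequentially. ereal (r + 1) \<le> L_sup (Qn n)" using *[of "r + 2"] by (simp add: add.commute)
    then show "\<forall>\<^sub>F n in sequentially. ereal r < L_sup (Qn n)"
      by eventually_elim (metis ereal_less_le less_add_one less_ereal.simps(1) less_le_trans)
  qed
qed

context
  fixes Qn :: "nat \<Rightarrow> 'a::euclidean_space measure" and Q :: "'a measure" and c rho eta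
  assumes Q1: "Q \<in> Q1_class" and Qn1: "\<And>n. Qn n \<in> Q1_class"
    and close: "\<And>e. 0 < e \<Longrightarrow> \<forall>\<^sub>F n in sequentially. lip_close Q (Qn n) e"
    and spread: "spread Q c rho eta" and spreadn: "\<forall>\<^sub>F n in sequentially. spread (Qn n) c rho eta"
begin

text \<open>The lower bound uses one near-maximizer for \<open>Q\<close>; it makes the near-maximizers for \<open>Qn n\<close> subject to the a priori
  bounds, which gives the upper bound.\<close>

lemma L_sup_spread_limit: "(\<lambda>n. L_sup (Qn n)) \<longlonglongrightarrow> L_sup Q"
proof -
  obtain K where K: "L_sup Q = ereal K" using L_sup_finite[OF Q1 spread] .
  have pos: "0 < rho" "0 < eta" using spread by (auto simp: spread_def)
  obtain m a b where ap: "\<And>Q phi. prob_distribution Q \<Longrightarrow> spread Q c rho eta \<Longrightarrow> proper Q phi \<Longrightarrow> mass phi \<le> 1 \<Longrightarrow>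
      K - 3 \<le> mean Q phi \<Longrightarrow> tame c rho m a b phi" using a_priori_bounds[OF pos] by metis
  have near: "\<forall>\<^sub>F n in sequentially. ereal (K - 2 * eps) \<le> L_sup (Qn n) \<and> L_sup (Qn n) \<le> ereal (K + 2 * eps)"
    if eps: "0 < eps" "eps \<le> 1" for eps
  proof -
    obtain delta where delta: "0 < delta"
      "\<And>Q Q' phi. Q \<in> Q1_class \<Longrightarrow> Q' \<in> Q1_class \<Longrightarrow> lip_close Q Q' delta \<Longrightarrow> tame c rho m a b phi \<Longrightarrow>
        mass phi \<le> 1 \<Longrightarrow> proper Q phi \<Longrightarrow> ereal (Lval Q phi - eps) \<le> L_sup Q'"
      using L_sup_transfer[OF eps(1), of c rho m a b] by metis
    obtain phi where phi: "proper Q phi" "mass phi = 1" "K - eps \<le> Lval Q phi" "mean Q phi = Lval Q phi"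
      using near_maximizer_exists[OF Q1 spread K eps(1)] by metis
    have tphi: "tame c rho m a b phi" using ap[OF Q1_classD(1)[OF Q1] spread phi(1)] phi eps by simp
    show ?thesis using close[OF delta(1)] spreadn
    proof eventually_elim
      case (elim n)
      have "ereal (Lval Q phi - eps) \<le> L_sup (Qn n)"
        using phi by (intro delta(2)[OF Q1 Qn1 elim(1) tphi]) auto
      moreover have "ereal (K - 2 * eps) \<le> ereal (Lval Q phi - eps)" using phi(3) by simp
      ultimately have lower: "ereal (K - 2 * eps) \<le> L_sup (Qn n)" by (rule order_trans[rotated])
      obtain K' where K': "L_sup (Qn n) = ereal K'" using L_sup_finite[OF Qn1 elim(2)] .
      obtain theta where theta: "proper (Qn n) theta" "mass theta = 1" "K' - eps \<le> Lval (Qn n) theta" "mean (Qn n) theta = Lval (Qn n) theta"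
        using near_maximizer_exists[OF Qn1 elim(2) K' eps(1)] by metis
      have "K - 3 \<le> mean (Qn n) theta" using theta lower K' eps by simp
      then have ttheta: "tame c rho m a b theta" using ap[OF Q1_classD(1)[OF Qn1] elim(2) theta(1)] theta(2) by simp
      have "ereal (Lval (Qn n) theta - eps) \<le> L_sup Q"
        using theta by (intro delta(2)[OF Qn1 Q1 lip_close_sym[OF elim(1)] ttheta]) auto
      then have "K' \<le> K + 2 * eps" using K theta(3) by simp
      then show ?case using lower K' by simp
    qed
  qed
  show ?thesis unfolding K
  proof (rule order_tendstoI)
    fix y assume "y < ereal K"
    then obtain r where r: "y < ereal r" "r < K" using ereal_dense2[of y "ereal K"] by auto
    have "\<forall>\<^sub>F n in sequentially. ereal (K - 2 * min 1 ((K - r) / 2)) \<le> L_sup (Qn n)"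
      using near[of "min 1 ((K - r) / 2)"] r by (auto elim: eventually_mono)
    moreover have "2 * min 1 ((K - r) / 2) \<le> K - r" by (auto simp: min_def)
    then have "ereal r \<le> ereal (K - 2 * min 1 ((K - r) / 2))" by simp
    with r(1) have "y < ereal (K - 2 * min 1 ((K - r) / 2))" by (rule less_le_trans)
    ultimately show "\<forall>\<^sub>F n in sequentially. y < L_sup (Qn n)"
      by (auto elim!: eventually_mono intro: less_le_trans)
  next
    fix y assume "ereal K < y"
    then obtain r where r: "ereal r < y" "K < r" using ereal_dense2[of "ereal K" y] by auto
    have "\<forall>\<^sub>F n in sequentially. L_sup (Qn n) \<le> ereal (K + 2 * min 1 ((r - K) / 2))"
      using near[of "min 1 ((r - K) / 2)"] r by (auto elim: eventually_mono)
    moreover have "2 * min 1 ((r - K) / 2) \<le> r - K" by (auto simp: min_def)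
    then have "ereal (K + 2 * min 1 ((r - K) / 2)) \<le> ereal r" by simp
    then have "ereal (K + 2 * min 1 ((r - K) / 2)) < y" using r(1) by (rule le_less_trans)
    ultimately show "\<forall>\<^sub>F n in sequentially. L_sup (Qn n) < y"
      by (auto elim!: eventually_mono intro: le_less_trans)
  qed
qed

text \<open>The suprema converge, so the maximizers for \<open>Qn n\<close> eventually have values close to the supremum for \<open>Q\<close>, as
  \<open>near_maximizers_close\<close> requires.\<close>

lemma psi_limit:
  obtains m a b where "tame c rho m a b (psi Q)" "\<forall>\<^sub>F n in sequentially. tame c rho m a b (psi (Qn n))"
    "(\<lambda>n. dist1 (psi (Qn n)) (psi Q)) \<longlonglongrightarrow> 0"
proof -
  note psiQ = psi_maximizer[OF Q1 spread]
  define K where "K = Lval Q (psi Q)"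
  have K: "L_sup Q = ereal K" using psiQ(3) by (simp add: K_def)
  have pos: "0 < rho" "0 < eta" using spread by (auto simp: spread_def)
  obtain m a b where ap: "\<And>Q phi. prob_distribution Q \<Longrightarrow> spread Q c rho eta \<Longrightarrow> proper Q phi \<Longrightarrow> mass phi \<le> 1 \<Longrightarrow>
      K - 1 \<le> mean Q phi \<Longrightarrow> tame c rho m a b phi" using a_priori_bounds[OF pos] by metis
  have near: "\<forall>\<^sub>F n in sequentially. K - delta \<le> Lval (Qn n) (psi (Qn n))" if "0 < delta" for delta
  proof -
    have "\<forall>\<^sub>F n in sequentially. ereal (K - delta) < L_sup (Qn n)"
      using L_sup_spread_limit by (rule order_tendstoD) (use that K in simp)
    then show ?thesis using spreadn
      by eventually_elim (use psi_maximizer(3)[OF Qn1] in fastforce)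
  qed
  have t: "tame c rho m a b (psi Q)"
    using ap[OF Q1_classD(1)[OF Q1] spread psiQ(1)] psiQ(2,4) by (simp add: K_def)
  have tn: "\<forall>\<^sub>F n in sequentially. tame c rho m a b (psi (Qn n))"
    using near[OF zero_less_one] spreadn
  proof eventually_elim
    case (elim n)
    note psin = psi_maximizer[OF Qn1 elim(2)]
    show ?case using ap[OF Q1_classD(1)[OF Qn1] elim(2) psin(1)] psin(2,4) elim(1) by simp
  qed
  have "(\<lambda>n. dist1 (psi (Qn n)) (psi Q)) \<longlonglongrightarrow> 0"
  proof (rule order_tendstoI)
    fix y :: ennreal assume "0 < y"
    then obtain y' where y': "0 < y'" "y' < y" using dense by blast
    obtain e where e: "y' = ennreal e" "0 \<le> e" using y'(2) by (cases y') auto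
    then have e: "0 < e" "ennreal e < y" using y' by (auto simp: less_le)
    obtain delta where delta: "0 < delta"
      "\<And>Q Q' K phi theta. Q \<in> Q1_class \<Longrightarrow> Q' \<in> Q1_class \<Longrightarrow> lip_close Q' Q delta \<Longrightarrow> L_sup Q \<le> ereal K \<Longrightarrow>
        tame c rho m a b phi \<Longrightarrow> near_max Q K delta phi \<Longrightarrow>
        tame c rho m a b theta \<Longrightarrow> near_max Q' K delta theta \<Longrightarrow>
        dist1 phi theta \<le> ennreal e"
      using near_maximizers_close[OF e(1), of c rho m a b] by metis
    show "\<forall>\<^sub>F n in sequentially. dist1 (psi (Qn n)) (psi Q) < y"
      using near[OF delta(1)] close[OF delta(1)] spreadn tn
    proof eventually_elim
      case (elim n)
      note psin = psi_maximizer[OF Qn1 elim(3)]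
      have "dist1 (psi Q) (psi (Qn n)) \<le> ennreal e"
        using elim psin psiQ t K delta(1) by (intro delta(2)[OF Q1 Qn1 lip_close_sym[OF elim(2)], of K])
          (auto simp: K_def near_max_def)
      then show ?case using e(2) by (simp add: dist1_sym)
    qed
  qed simp
  with t tn show thesis by (rule that)
qed

end

lemma exp_limsup:
  assumes "\<And>s. theta < ereal s \<Longrightarrow> \<forall>\<^sub>F n in sequentially. phi n < ereal s" "theta \<noteq> \<infinity>" "exp_ereal theta < t"
  shows "\<forall>\<^sub>F n in sequentially. exp_ereal (phi n) < t"
proof -
  have t: "0 < t" using assms(3) exp_ereal_nonneg le_less_trans by blast
  have "theta < ereal (ln t)"
  proof (cases theta)
    case (real p)
    then have "exp p < t" using assms(3) by simp
    then have "ln (exp p) < ln t" using t by (simp only: ln_less_cancel_iff exp_gt_zero)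
    then show ?thesis by (simp add: real)
  qed (use assms(2) in auto)
  from assms(1)[OF this] show ?thesis
  proof eventually_elim
    case (elim n)
    then show ?case
    proof (cases "phi n")
      case (real q)
      then have "q < ln t" using elim by simp
      then have "exp q < exp (ln t)" by (simp only: exp_less_cancel_iff)
      also have "exp (ln t) = t" using t by (rule exp_ln)
      finally show ?thesis by (simp only: real exp_ereal_simps)
    qed (use t in auto)
  qed
qed

lemma exp_liminf:
  assumes low: "\<And>s. ereal s < theta \<Longrightarrow> \<forall>\<^sub>F n in sequentially. ereal s \<le> phi n" and fin: "\<forall>\<^sub>F n in sequentially. phi n \<noteq> \<infinity>"
    and t: "t < exp_ereal theta" "theta \<noteq> \<infinity>"
  shows "\<forall>\<^sub>F n in sequentially. t < exp_ereal (phi n)"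
proof (cases "t < 0")
  case True
  then show ?thesis by (auto intro!: always_eventually intro: less_le_trans)
next
  case False
  then obtain p where p: "theta = ereal p" using t by (cases theta) auto
  define r where "r = (t + exp p) / 2"
  have r: "t < r" "r < exp p" "0 < r" using t False p by (auto simp: r_def)
  then have "ln r < p" by (metis exp_gt_zero ln_exp ln_less_cancel_iff)
  then have "\<forall>\<^sub>F n in sequentially. ereal (ln r) \<le> phi n" using low p by simp
  then show ?thesis using fin
  proof eventually_elim
    case (elim n)
    then have "exp_ereal (ereal (ln r)) \<le> exp_ereal (phi n)" by (rule exp_ereal_mono)
    then show ?case using r by simp
  qed
qed

theorem theorem2p15:
  fixes Qn :: "nat \<Rightarrow> 'a::euclidean_space measure" and Q :: "'a measure"
  assumes "\<And>n. Qn n \<in> Q1_class"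
    and "Q \<in> Q1_class"
    and "(\<lambda>n. mallows_dist (Qn n) Q) \<longlonglongrightarrow> 0"
  shows "(\<lambda>n. L_sup (Qn n)) \<longlonglongrightarrow> L_sup Q \<and>
    (Q \<in> Qo_class \<inter> Q1_class \<longrightarrow>
      (let f = exp_ereal \<circ> psi Q; fn = (\<lambda>n. exp_ereal \<circ> psi (Qn n)) in
        (\<forall>\<^sub>F n in sequentially. Qn n \<in> Qo_class \<inter> Q1_class) \<and>
        (\<forall>y. y \<notin> frontier {x. f x > 0} \<longrightarrow>
          (\<forall>x. x \<longlonglongrightarrow> y \<longrightarrow> (\<lambda>n. fn n (x n)) \<longlonglongrightarrow> f y)) \<and>
        (\<forall>y. y \<in> frontier {x. f x > 0} \<longrightarrow>
          (\<forall>x. x \<longlonglongrightarrow> y \<longrightarrow> limsup (\<lambda>n. ereal (fn n (x n))) \<le> ereal (f y))) \<and>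
        (\<lambda>n. \<integral>\<^sup>+ x. ennreal \<bar>fn n x - f x\<bar> \<partial>lborel) \<longlonglongrightarrow> 0))"
proof -
  have close: "\<forall>\<^sub>F n in sequentially. lip_close Q (Qn n) e" if "0 < e" for e
  proof -
    have "\<forall>\<^sub>F n in sequentially. mallows_dist (Qn n) Q < ennreal e"
      using assms(3) by (rule order_tendstoD) (use that in simp)
    then show ?thesis
      by eventually_elim (rule lip_close_sym, rule mallows_lip_close[OF assms(1,2)])
  qed
  show ?thesis
  proof (cases "Q \<in> Qo_class")
    case False
    then show ?thesis
      using L_sup_degenerate_limit[OF assms(2) False assms(1) close] by simp
  next
    case True
    obtain c rho eta delta where delta: "0 < delta"
      and st: "\<And>Q'. Q' \<in> Q1_class \<Longrightarrow> lip_close Q Q' delta \<Longrightarrow> spread Q' c rho eta"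
      using spread_stable[OF assms(2) True] by metis
    have spread: "spread Q c rho eta" using st[OF assms(2) lip_close_refl] delta by simp
    have spreadn: "\<forall>\<^sub>F n in sequentially. spread (Qn n) c rho eta"
      using close[OF delta] by eventually_elim (intro st assms(1))
    note ctxt = assms(2,1) close spread spreadn
    obtain m a b where t: "tame c rho m a b (psi Q)"
      and tn: "\<forall>\<^sub>F n in sequentially. tame c rho m a b (psi (Qn n))"
      and lim: "(\<lambda>n. dist1 (psi (Qn n)) (psi Q)) \<longlonglongrightarrow> 0"
      using psi_limit[OF ctxt] by metis
    have Phi: "psi Q \<in> Phi_class" using t by (simp add: tame_def)
    have Phin: "\<forall>\<^sub>F n in sequentially. psi (Qn n) \<in> Phi_class"
      using tn by eventually_elim (simp add: tame_def)
    have upper: "\<forall>\<^sub>F n in sequentially. exp_ereal (psi (Qn n) (x n)) < s"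
      if "x \<longlonglongrightarrow> y" "exp_ereal (psi Q y) < s" for x y s
      using limsup_of_dist1_limit[OF tn t lim that(1)] Phi_classD(1)[OF Phi] that(2)
      by (rule exp_limsup)
    define P where "P = {x. 0 < (exp_ereal \<circ> psi Q) x}"
    have P: "P = {x. psi Q x \<noteq> -\<infinity>}"
      using exp_ereal_pos_iff Phi_classD(1)[OF Phi] by (auto simp: P_def)
    have lower: "\<forall>\<^sub>F n in sequentially. s < exp_ereal (psi (Qn n) (x n))"
      if x: "x \<longlonglongrightarrow> y" and y: "y \<notin> frontier P" and s: "s < exp_ereal (psi Q y)" for x y s
    proof (cases "y \<in> P")
      case True
      then have "y \<in> interior P" using y closure_subset[of P] unfolding frontier_def by blast
      then have yi: "y \<in> interior {x. psi Q x \<noteq> -\<infinity>}" unfolding P .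
      show ?thesis
      proof (rule exp_liminf[OF liminf_of_dist1_limit[OF Phin Phi lim x yi]])
        show "\<forall>\<^sub>F n in sequentially. psi (Qn n) (x n) \<noteq> \<infinity>"
          using Phin by eventually_elim (rule Phi_classD)
      qed (use s Phi_classD(1)[OF Phi] in auto)
    next
      case False
      then have "exp_ereal (psi Q y) = 0" by (simp add: P exp_ereal_def)
      then show ?thesis using s by (auto intro!: always_eventually intro: less_le_trans)
    qed
    have "limsup (\<lambda>n. ereal (exp_ereal (psi (Qn n) (x n)))) \<le> ereal (exp_ereal (psi Q y))"
      if "x \<longlonglongrightarrow> y" for x y
      unfolding Limsup_le_iff
    proof (intro allI impI)
      fix s assume s: "ereal (exp_ereal (psi Q y)) < s"
      show "\<forall>\<^sub>F n in sequentially. ereal (exp_ereal (psi (Qn n) (x n))) < s"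
        using s upper[OF that] by (cases s) auto
    qed
    moreover have "(\<lambda>n. exp_ereal (psi (Qn n) (x n))) \<longlonglongrightarrow> exp_ereal (psi Q y)"
      if "x \<longlonglongrightarrow> y" "y \<notin> frontier P" for x y
      using lower[OF that] upper[OF that(1)] by (intro order_tendstoI)
    moreover have "\<forall>\<^sub>F n in sequentially. Qn n \<in> Qo_class \<inter> Q1_class"
      using spreadn by eventually_elim
        (use assms(1) spread_Qo_class[OF Q1_classD(1)[OF assms(1)]] in auto)
    ultimately show ?thesis
      using L_sup_spread_limit[OF ctxt] lim
      unfolding Let_def P_def[symmetric] by (simp add: dist1_def)
  qed
qed

end
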